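(* Let $n\ge 2$ and $k\ge 1$ be integers, let $S_n$ be the star with $n$ edges, and let $c_0\in U_k^{top}(S_n)$ be the basepoint configuration specified in the context. Then the braid group $B_k(S_n,c_0)=\pi_1(U_k^{top}(S_n),c_0)$ is free on $\varphi(k,n)$ generators, where $$\varphi(k,n)=1+(n-1)\binom{n+k-2}{n-1}-\binom{n+k-1}{n-1}.$$
   Context: The star $S_n$ is the (geometric realization of the) graph on $n+1$ vertices with one vertex $v_0$ of degree $n$ and $n$ vertices $v_1,\dots,v_n$ of degree one, each joined to $v_0$ by an edge. It carries the path metric $d$ in which every edge has length $\kappa$, where $\kappa>0$ is a fixed constant with $\kappa\ge k-1$. The unordered $k$-point configuration space is $U_k^{top}(X)=\{c\subset X: |c|=k\}$, with the quotient topology from $X^k-\Delta(X)$ under $(x_1,\dots,x_k)\mapsto\{x_1,\dots,x_k\}$, where $\Delta(X)$ is the fat diagonal, the set of $k$-tuples with $x_i=x_j$ for some $i\ne j$. The $k$-point braid group of $S_n$ is $B_k(S_n,c)=\pi_1(U_k^{top}(S_n),c)$. The basepoint $c_0$ is the configuration of the $k$ points of the edge $[v_0,v_1]$ at distances $0,1,\dots,k-1$ from $v_0$. *)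

theory Defs
  imports "HOL-Analysis.Analysis" "HOL-Algebra.Group"
begin

section \<open>Stars as metric graphs\<close>

text \<open>\<open>(i, t)\<close> is the point of the \<open>i\<close>-th edge (\<open>1 \<le> i \<le> n\<close>) at distance \<open>t\<close> from the
  central vertex. The ends \<open>t = 0\<close> of all edges are identified: the central vertex has the
  single representative \<open>(0, 0)\<close>.\<close>

definition edge_point :: "nat \<Rightarrow> real \<Rightarrow> nat \<times> real" where
  "edge_point i t = (if t = 0 then (0, 0) else (i, t))"

definition star :: "real \<Rightarrow> nat \<Rightarrow> (nat \<times> real) set" where
  "star \<kappa> n = {edge_point i t | i t. 1 \<le> i \<and> i \<le> n \<and> 0 \<le> t \<and> t \<le> \<kappa>}"

text \<open>The path metric: a shortest path between points of different edges runs through the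
  central vertex. On the star the second coordinates are nonnegative; the absolute values
  in the second case only make the function nonnegative off the star, as required by
  \<^locale>\<open>Metric_space\<close>.\<close>

definition star_dist :: "nat \<times> real \<Rightarrow> nat \<times> real \<Rightarrow> real" where
  "star_dist x y = (if fst x = fst y then \<bar>snd x - snd y\<bar> else \<bar>snd x\<bar> + \<bar>snd y\<bar>)"

lemma Metric_space_star: "Metric_space (star \<kappa> n) star_dist"
proof
  show "0 \<le> star_dist x y" for x y
    by (simp add: star_dist_def)
  show "star_dist x y = star_dist y x" for x y
    by (auto simp: star_dist_def)
  show "star_dist x y = 0 \<longleftrightarrow> x = y" if "x \<in> star \<kappa> n" "y \<in> star \<kappa> n" for x y
    using that by (auto simp: star_dist_def star_def edge_point_def split: if_splits)
  show "star_dist x z \<le> star_dist x y + star_dist y z" for x y z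
    by (auto simp: star_dist_def)
qed

definition star_topology :: "real \<Rightarrow> nat \<Rightarrow> (nat \<times> real) topology" where
  "star_topology \<kappa> n = Metric_space.mtopology (star \<kappa> n) star_dist"

lemma topspace_star_topology [simp]: "topspace (star_topology \<kappa> n) = star \<kappa> n"
  by (simp add: star_topology_def Metric_space.topspace_mtopology[OF Metric_space_star])


section \<open>Configuration spaces\<close>

definition quotient_topology :: "'a topology \<Rightarrow> ('a \<Rightarrow> 'b) \<Rightarrow> 'b topology" where
  "quotient_topology X f =
     topology (\<lambda>U. U \<subseteq> f ` topspace X \<and> openin X {x \<in> topspace X. f x \<in> U})"

lemma openin_quotient_topology:
  "openin (quotient_topology X f) U \<longleftrightarrow>
     U \<subseteq> f ` topspace X \<and> openin X {x \<in> topspace X. f x \<in> U}"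
proof -
  have "istopology (\<lambda>U. U \<subseteq> f ` topspace X \<and> openin X {x \<in> topspace X. f x \<in> U})"
    unfolding istopology_def
  proof (intro conjI allI impI)
    fix S T
    assume S: "S \<subseteq> f ` topspace X \<and> openin X {x \<in> topspace X. f x \<in> S}"
      and T: "T \<subseteq> f ` topspace X \<and> openin X {x \<in> topspace X. f x \<in> T}"
    show "S \<inter> T \<subseteq> f ` topspace X"
      using S by blast
    have "{x \<in> topspace X. f x \<in> S \<inter> T} =
        {x \<in> topspace X. f x \<in> S} \<inter> {x \<in> topspace X. f x \<in> T}"
      by blast
    then show "openin X {x \<in> topspace X. f x \<in> S \<inter> T}"
      using S T by auto
  next
    fix \<K>
    assume K: "\<forall>K\<in>\<K>. K \<subseteq> f ` topspace X \<and> openin X {x \<in> topspace X. f x \<in> K}"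
    then show "\<Union>\<K> \<subseteq> f ` topspace X"
      by blast
    have "{x \<in> topspace X. f x \<in> \<Union>\<K>} = (\<Union>K\<in>\<K>. {x \<in> topspace X. f x \<in> K})"
      by blast
    then show "openin X {x \<in> topspace X. f x \<in> \<Union>\<K>}"
      using K by auto
  qed
  then show ?thesis
    by (simp add: quotient_topology_def)
qed

lemma topspace_quotient_topology [simp]:
  "topspace (quotient_topology X f) = f ` topspace X"
proof
  show "topspace (quotient_topology X f) \<subseteq> f ` topspace X"
    using openin_topspace[of "quotient_topology X f"] unfolding openin_quotient_topology
    by (rule conjunct1)
  have "{x \<in> topspace X. f x \<in> f ` topspace X} = topspace X"
    by blast
  then show "f ` topspace X \<subseteq> topspace (quotient_topology X f)"
    by (simp add: openin_quotient_topology openin_subset)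
qed

lemma quotient_map_quotient_topology: "quotient_map X (quotient_topology X f) f"
  by (auto simp: quotient_map_def openin_quotient_topology)

text \<open>\<open>k\<close>-tuples are functions on \<open>{..<k}\<close>.\<close>

definition fat_diagonal :: "'a topology \<Rightarrow> nat \<Rightarrow> (nat \<Rightarrow> 'a) set" where
  "fat_diagonal X k =
     {x \<in> {..<k} \<rightarrow>\<^sub>E topspace X. \<exists>i<k. \<exists>j<k. i \<noteq> j \<and> x i = x j}"

definition ordered_configuration_space :: "'a topology \<Rightarrow> nat \<Rightarrow> (nat \<Rightarrow> 'a) topology" where
  "ordered_configuration_space X k =
     subtopology (product_topology (\<lambda>_. X) {..<k})
       (({..<k} \<rightarrow>\<^sub>E topspace X) - fat_diagonal X k)"

definition configuration_space :: "'a topology \<Rightarrow> nat \<Rightarrow> 'a set topology" where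
  "configuration_space X k =
     quotient_topology (ordered_configuration_space X k) (\<lambda>x. x ` {..<k})"

lemma topspace_configuration_space:
  "topspace (configuration_space X k) = {c. c \<subseteq> topspace X \<and> finite c \<and> card c = k}"
proof -
  have ordered: "topspace (ordered_configuration_space X k) =
      {x \<in> {..<k} \<rightarrow>\<^sub>E topspace X. inj_on x {..<k}}"
    by (auto simp: ordered_configuration_space_def fat_diagonal_def inj_on_def)
  have "c \<in> (\<lambda>x. x ` {..<k}) ` {x \<in> {..<k} \<rightarrow>\<^sub>E topspace X. inj_on x {..<k}}"
    if c: "c \<subseteq> topspace X" "finite c" "card c = k" for c
  proof -
    obtain h where "bij_betw h {..<k} c"
      using ex_bij_betw_nat_finite[OF c(2)] c(3) by (auto simp: atLeast0LessThan)
    then have h: "h ` {..<k} = c" "inj_on h {..<k}"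
      by (auto simp: bij_betw_def)
    show ?thesis
    proof (rule image_eqI)
      show "c = restrict h {..<k} ` {..<k}"
        using h by simp
      show "restrict h {..<k} \<in> {x \<in> {..<k} \<rightarrow>\<^sub>E topspace X. inj_on x {..<k}}"
        using h c by auto
    qed
  qed
  then show ?thesis
    by (auto simp: configuration_space_def ordered card_image)
qed


section \<open>The fundamental group\<close>

text \<open>The library's \<open>homotopic_paths\<close> and \<open>+++\<close> need the space to be a type of class
  \<^class>\<open>topological_space\<close>; these are their analogues for a \<open>topology\<close>.\<close>

definition loops :: "'a topology \<Rightarrow> 'a \<Rightarrow> (real \<Rightarrow> 'a) set" where
  "loops X c = {p. pathin X p \<and> p 0 = c \<and> p 1 = c}"

definition homotopic_loops_at :: "'a topology \<Rightarrow> 'a \<Rightarrow> (real \<Rightarrow> 'a) \<Rightarrow> (real \<Rightarrow> 'a) \<Rightarrow> bool" where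
  "homotopic_loops_at X c = homotopic_with (\<lambda>p. p 0 = c \<and> p 1 = c) (top_of_set {0..1}) X"

definition join_loops :: "(real \<Rightarrow> 'a) \<Rightarrow> (real \<Rightarrow> 'a) \<Rightarrow> real \<Rightarrow> 'a" where
  "join_loops p q = (\<lambda>t. if t \<le> 1/2 then p (2 * t) else q (2 * t - 1))"

definition loop_class :: "'a topology \<Rightarrow> 'a \<Rightarrow> (real \<Rightarrow> 'a) \<Rightarrow> (real \<Rightarrow> 'a) set" where
  "loop_class X c p = {q. homotopic_loops_at X c p q}"

definition fundamental_group :: "'a topology \<Rightarrow> 'a \<Rightarrow> (real \<Rightarrow> 'a) set monoid" where
  "fundamental_group X c =
     \<lparr>carrier = loop_class X c ` loops X c,
      mult = (\<lambda>A B. \<Union>p\<in>A. \<Union>q\<in>B. loop_class X c (join_loops p q)),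
      one = loop_class X c (\<lambda>_. c)\<rparr>"


section \<open>Free groups\<close>

text \<open>The letter \<open>(True, s)\<close> is the generator \<open>s\<close> and \<open>(False, s)\<close> its formal inverse.
  \<open>foldr cons_letter u v\<close> is the reduced form of \<open>u @ v\<close> if \<open>v\<close> is reduced.\<close>

definition inv_letter :: "bool \<times> 'a \<Rightarrow> bool \<times> 'a" where
  "inv_letter x = (\<not> fst x, snd x)"

definition reduced_word :: "(bool \<times> 'a) list \<Rightarrow> bool" where
  "reduced_word = successively (\<lambda>x y. y \<noteq> inv_letter x)"

definition cons_letter :: "bool \<times> 'a \<Rightarrow> (bool \<times> 'a) list \<Rightarrow> (bool \<times> 'a) list" where
  "cons_letter x w = (if w \<noteq> [] \<and> hd w = inv_letter x then tl w else x # w)"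

definition free_group :: "'a set \<Rightarrow> (bool \<times> 'a) list monoid" where
  "free_group S =
     \<lparr>carrier = {w. set w \<subseteq> UNIV \<times> S \<and> reduced_word w},
      mult = foldr cons_letter,
      one = []\<rparr>"

lemma inv_letter_inv_letter [simp]: "inv_letter (inv_letter x) = x"
  by (simp add: inv_letter_def)

lemma reduced_Nil [simp]: "reduced_word []"
  by (simp add: reduced_word_def)

lemma reduced_Cons:
  "reduced_word (x # w) \<longleftrightarrow> reduced_word w \<and> (w = [] \<or> hd w \<noteq> inv_letter x)"
  by (cases w) (auto simp: reduced_word_def)

lemma reduced_cons_letter: "reduced_word w \<Longrightarrow> reduced_word (cons_letter x w)"
  by (cases w) (auto simp: cons_letter_def reduced_Cons)

lemma reduced_foldr_cons_letter: "reduced_word v \<Longrightarrow> reduced_word (foldr cons_letter u v)"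
  by (induction u) (auto simp: reduced_cons_letter)

lemma cons_letter_cancel: "reduced_word w \<Longrightarrow> cons_letter x (cons_letter (inv_letter x) w) = w"
  by (cases w) (auto simp: cons_letter_def reduced_Cons)

lemma foldr_cons_letter_reduced: "reduced_word w \<Longrightarrow> foldr cons_letter w [] = w"
  by (induction w) (auto simp: cons_letter_def reduced_Cons)

lemma foldr_cons_letter_cons_letter:
  assumes "reduced_word v"
  shows "foldr cons_letter (cons_letter x u) v = cons_letter x (foldr cons_letter u v)"
proof (cases "u \<noteq> [] \<and> hd u = inv_letter x")
  case True
  then obtain u' where u: "u = inv_letter x # u'"
    by (cases u) auto
  have "reduced_word (foldr cons_letter u' v)"
    using assms by (rule reduced_foldr_cons_letter)
  then show ?thesis
    by (simp add: u cons_letter_cancel) (simp add: cons_letter_def)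
next
  case False
  then have "cons_letter x u = x # u"
    by (auto simp: cons_letter_def)
  then show ?thesis
    by simp
qed

lemma foldr_cons_letter_assoc:
  assumes "reduced_word w"
  shows "foldr cons_letter (foldr cons_letter u v) w = foldr cons_letter u (foldr cons_letter v w)"
  by (induction u) (simp_all add: foldr_cons_letter_cons_letter assms)

lemma group_free_group: "group (free_group S)"
proof (rule groupI)
  have letters: "set (cons_letter x w) \<subseteq> insert x (set w)" for x :: "bool \<times> 'a" and w
    by (cases w) (auto simp: cons_letter_def)
  have words: "set (foldr cons_letter u v) \<subseteq> set u \<union> set v" for u v :: "(bool \<times> 'a) list"
  proof (induction u)
    case (Cons x u)
    then show ?case
      using letters[of x "foldr cons_letter u v"] by auto
  qed simp
  show "u \<otimes>\<^bsub>free_group S\<^esub> v \<in> carrier (free_group S)"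
    if "u \<in> carrier (free_group S)" "v \<in> carrier (free_group S)" for u v
    using that words[of u v] by (auto simp: free_group_def reduced_foldr_cons_letter)
  show "\<one>\<^bsub>free_group S\<^esub> \<in> carrier (free_group S)"
    by (simp add: free_group_def)
  show "u \<otimes>\<^bsub>free_group S\<^esub> v \<otimes>\<^bsub>free_group S\<^esub> w = u \<otimes>\<^bsub>free_group S\<^esub> (v \<otimes>\<^bsub>free_group S\<^esub> w)"
    if "w \<in> carrier (free_group S)" for u v w
    using that by (simp add: free_group_def foldr_cons_letter_assoc)
  show "\<one>\<^bsub>free_group S\<^esub> \<otimes>\<^bsub>free_group S\<^esub> u = u" for u
    by (simp add: free_group_def)
  show "\<exists>v\<in>carrier (free_group S). v \<otimes>\<^bsub>free_group S\<^esub> u = \<one>\<^bsub>free_group S\<^esub>"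
    if "u \<in> carrier (free_group S)" for u
  proof -
    have u: "set u \<subseteq> UNIV \<times> S" "reduced_word u"
      using that by (auto simp: free_group_def)
    have cancel: "foldr cons_letter (rev (map inv_letter u)) u = []"
      using u(2)
    proof (induction u)
      case (Cons x u)
      then show ?case
        by (simp add: reduced_Cons cons_letter_def)
    qed simp
    define v where "v = foldr cons_letter (rev (map inv_letter u)) []"
    have "set v \<subseteq> inv_letter ` set u"
      using words[of "rev (map inv_letter u)" "[]"] by (simp add: v_def)
    also have "\<dots> \<subseteq> UNIV \<times> S"
      using u(1) by (auto simp: inv_letter_def)
    finally have "set v \<subseteq> UNIV \<times> S" .
    moreover have "reduced_word v"
      by (simp add: v_def reduced_foldr_cons_letter)
    moreover have "foldr cons_letter v u = []"
      using cancel by (simp add: v_def foldr_cons_letter_assoc u(2))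
    ultimately show ?thesis
      by (auto simp: free_group_def)
  qed
qed

definition free_on_generators :: "('g, 'b) monoid_scheme \<Rightarrow> nat \<Rightarrow> bool" where
  "free_on_generators G r \<longleftrightarrow> group G \<and> G \<cong> free_group {..<r}"


section \<open>Braid groups of stars\<close>

definition star_braid_group ::
    "real \<Rightarrow> nat \<Rightarrow> nat \<Rightarrow> (nat \<times> real) set \<Rightarrow> (real \<Rightarrow> (nat \<times> real) set) set monoid" where
  "star_braid_group \<kappa> n k c = fundamental_group (configuration_space (star_topology \<kappa> n) k) c"

definition base_configuration :: "nat \<Rightarrow> (nat \<times> real) set" where
  "base_configuration k = (\<lambda>j. edge_point 1 (real j)) ` {..<k}"

lemma base_configuration_in_configuration_space:
  assumes "1 \<le> n" "0 < \<kappa>" "real k - 1 \<le> \<kappa>"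
  shows "base_configuration k \<in> topspace (configuration_space (star_topology \<kappa> n) k)"
proof -
  have "inj_on (\<lambda>j. edge_point 1 (real j)) {..<k}"
    by (auto simp: inj_on_def edge_point_def split: if_splits)
  moreover have "edge_point 1 (real j) \<in> star \<kappa> n" if "j < k" for j
  proof -
    have "real j \<le> \<kappa>"
      using that assms(3) by linarith
    then show ?thesis
      unfolding star_def using assms(1)
      by (intro CollectI exI[of _ 1] exI[of _ "real j"]) simp
  qed
  ultimately show ?thesis
    by (auto simp: topspace_configuration_space base_configuration_def card_image)
qed

definition \<phi> :: "nat \<Rightarrow> nat \<Rightarrow> int" where
  "\<phi> k n = 1 + (int n - 1) * int ((n + k - 2) choose (n - 1)) - int ((n + k - 1) choose (n - 1))"

end

theory Submission
  imports Defs
begin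

text \<open>Record a configuration by the decreasing sequence of the positive distances from the centre
  on each edge. This identifies the configuration space with a subset of a normed space, by
  compactness of the star. The configurations avoiding the centre split into open convex cells,
  indexed by the \<open>(n + k - 1) choose (n - 1)\<close> ways to distribute \<open>k\<close> points over the \<open>n\<close> edges.
  The configurations whose innermost point is strictly innermost split into open star-shaped
  sets, indexed by the \<open>(n + k - 2) choose (n - 1)\<close> distributions of the other \<open>k - 1\<close> points.
  The two families cover everything, each is disjoint, and a set of the second family meets
  exactly \<open>n\<close> of the cells, in convex sets. So the fundamental group is that of a bipartite graph
  with \<open>n * ((n + k - 2) choose (n - 1))\<close> edges, and it is free on the edges outside a spanning
  tree. For that, edges outside the tree are labelled by generators and the others by the
  identity. A path then has a holonomy in the free group, which is homotopy invariant and
  determines a loop up to homotopy.\<close>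

section \<open>Holonomy for covers by two disjoint families\<close>

text \<open>Within each family the sets are disjoint, so a point lies in at most two sets of the
  cover and the nerve is a graph. Without triple overlaps there is no cocycle condition: any
  assignment of group elements to edges is a system of transition functions, and no relations arise
  between the generators. The walls need neighbourhoods because a configuration with a point at the
  centre borders \<open>n\<close> cells at once. Asking that a strictly innermost point exist keeps
  the neighbourhoods of different walls apart, and each still contracts along segments onto a
  configuration with occupied centre. Sorting disposes of the symmetric group before any homotopy is
  considered: a configuration becomes a vector, the cells and the wall neighbourhoods are cut out of
  the model by strict linear inequalities, and segments supply all contractions. The rank is one
  minus the Euler characteristic of the graph, \<open>n * card B - (card A + card B) + 1\<close>,
  and substituting the two binomial coefficients gives \<open>\<phi> k n\<close>.\<close>

locale two_family_cover =
  fixes M :: "'a::real_normed_vector set" and A B :: "'v set" and U :: "'v \<Rightarrow> 'a set"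
  assumes disjoint_index: "A \<inter> B = {}"
    and openin_U: "v \<in> A \<union> B \<Longrightarrow> openin (top_of_set M) (U v)"
    and simply_connected_U: "v \<in> A \<union> B \<Longrightarrow> simply_connected (U v)"
    and disjoint_A: "a \<in> A \<Longrightarrow> a' \<in> A \<Longrightarrow> a \<noteq> a' \<Longrightarrow> U a \<inter> U a' = {}"
    and disjoint_B: "b \<in> B \<Longrightarrow> b' \<in> B \<Longrightarrow> b \<noteq> b' \<Longrightarrow> U b \<inter> U b' = {}"
    and path_connected_Int: "a \<in> A \<Longrightarrow> b \<in> B \<Longrightarrow> path_connected (U a \<inter> U b)"
    and cover: "M \<subseteq> (\<Union>v\<in>A \<union> B. U v)"
begin

lemma U_subset: "v \<in> A \<union> B \<Longrightarrow> U v \<subseteq> M"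
  using openin_U openin_imp_subset by blast

lemma in_cover: 
  assumes "x \<in> M" obtains v where "v \<in> A \<union> B" "x \<in> U v"
  using assms cover by blast

end

section \<open>Lifts to a covering space with group fibre\<close>

locale labelled_cover = two_family_cover M A B U + group G
  for M :: "'a::real_normed_vector set" and A B :: "'v set" and U :: "'v \<Rightarrow> 'a set"
    and G (structure) +
  fixes wt :: "'v \<Rightarrow> 'v \<Rightarrow> 'g"
  assumes wt_closed: "wt a b \<in> carrier G"
begin

text \<open>The label of an edge is charged entirely to its \<open>A\<close>-end. Disjointness of
  the \<open>B\<close>-sets makes \<open>THE\<close> meaningful. With the default one at points
  outside every \<open>B\<close>-set, the function \<open>f\<close> of a labelling is the coordinate
  over the \<open>B\<close>-set where there is one and over the \<open>A\<close>-set elsewhere; it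
  may jump at the border between the two.\<close>

definition weight :: "'v \<Rightarrow> 'a \<Rightarrow> 'g" where
  "weight v x = (if v \<in> A \<and> (\<exists>b\<in>B. x \<in> U b) then wt v (THE b. b \<in> B \<and> x \<in> U b) else \<one>)"

lemma weight_closed [simp]: "weight v x \<in> carrier G"
  by (simp add: weight_def wt_closed)

lemma weight_B: "b \<in> B \<Longrightarrow> weight b x = \<one>"
  using disjoint_index by (auto simp: weight_def)

lemma weight_A:
  assumes "a \<in> A" "b \<in> B" "x \<in> U b"
  shows "weight a x = wt a b"
proof -
  have "(THE b. b \<in> B \<and> x \<in> U b) = b"
    using assms disjoint_B by (intro the_equality) auto
  then show ?thesis
    using assms by (auto simp: weight_def)
qed

text \<open>If \<open>v\<close> is in \<open>A\<close>, then \<open>u\<close> is in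
  \<open>B\<close>, and by disjointness it is the only \<open>B\<close>-set containing a point of
  the overlap.\<close>

lemma weight_eq:
  assumes "u \<in> A \<union> B" "v \<in> A \<union> B" "u \<noteq> v" "x \<in> U u \<inter> U v" "y \<in> U u \<inter> U v"
  shows "weight v x = weight v y"
proof (cases "v \<in> B")
  case True
  then show ?thesis by (simp add: weight_B)
next
  case False
  then have "v \<in> A" "u \<in> B"
    using assms disjoint_A by blast+
  then show ?thesis
    using assms by (auto simp: weight_A)
qed

text \<open>A labelling of \<open>h\<close> is a lift of \<open>h\<close> to the covering space with fibre \<open>G\<close> that is trivial
  over each \<open>U v\<close>, with transition functions given by the weights: \<open>f r\<close> times the weight at
  \<open>v\<close> is the fibre coordinate over \<open>U v\<close>.\<close>

definition labelling :: "'p::topological_space set \<Rightarrow> ('p \<Rightarrow> 'a) \<Rightarrow> ('p \<Rightarrow> 'g) \<Rightarrow> bool" where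
  "labelling Q h f \<longleftrightarrow> f \<in> Q \<rightarrow> carrier G \<and>
     (\<forall>q\<in>Q. \<forall>v\<in>A \<union> B. h q \<in> U v \<longrightarrow>
        (\<exists>W. open W \<and> q \<in> W \<and>
           (\<forall>r\<in>Q \<inter> W. h r \<in> U v \<and> f r \<otimes> weight v (h r) = f q \<otimes> weight v (h q))))"

lemma labelling_closed: "labelling Q h f \<Longrightarrow> q \<in> Q \<Longrightarrow> f q \<in> carrier G"
  by (auto simp: labelling_def)

lemma labellingD:
  assumes "labelling Q h f" "q \<in> Q" "v \<in> A \<union> B" "h q \<in> U v"
  obtains W where "open W" "q \<in> W"
    "\<And>r. r \<in> Q \<Longrightarrow> r \<in> W \<Longrightarrow> h r \<in> U v \<and> f r \<otimes> weight v (h r) = f q \<otimes> weight v (h q)"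
proof -
  have "\<exists>W. open W \<and> q \<in> W \<and>
      (\<forall>r\<in>Q \<inter> W. h r \<in> U v \<and> f r \<otimes> weight v (h r) = f q \<otimes> weight v (h q))"
    using assms by (simp add: labelling_def)
  then obtain W where W: "open W" "q \<in> W"
      "\<forall>r\<in>Q \<inter> W. h r \<in> U v \<and> f r \<otimes> weight v (h r) = f q \<otimes> weight v (h q)"
    by (elim exE conjE)
  show thesis
    using W(3) by (intro that[OF W(1,2)]) (blast dest: bspec)
qed

text \<open>Pullback of a lift. Restrictions, halves of joined paths, reversed paths and slices of
  homotopies are all instances.\<close>

lemma labelling_compose:
  assumes f: "labelling Q h f" and \<sigma>: "continuous_on Q' \<sigma>" "\<sigma> ` Q' \<subseteq> Q"
  shows "labelling Q' (h \<circ> \<sigma>) (f \<circ> \<sigma>)"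
  unfolding labelling_def
proof (intro conjI ballI impI)
  show "f \<circ> \<sigma> \<in> Q' \<rightarrow> carrier G"
    using labelling_closed[OF f] \<sigma> by auto
next
  fix q v assume q: "q \<in> Q'" "v \<in> A \<union> B" "(h \<circ> \<sigma>) q \<in> U v"
  then obtain W where W: "open W" "\<sigma> q \<in> W"
    "\<And>r. r \<in> Q \<Longrightarrow> r \<in> W \<Longrightarrow> h r \<in> U v \<and> f r \<otimes> weight v (h r) = f (\<sigma> q) \<otimes> weight v (h (\<sigma> q))"
    using labellingD[OF f, of "\<sigma> q" v] \<sigma> by (auto simp: image_subset_iff)
  obtain W' where "open W'" "W' \<inter> Q' = \<sigma> -` W \<inter> Q'"
    using \<sigma>(1) \<open>open W\<close> by (metis continuous_on_open_invariant)
  moreover have "\<sigma> r \<in> Q \<and> \<sigma> r \<in> W" if "r \<in> Q' \<inter> W'" for r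
    using that calculation(2) \<sigma>(2) by blast
  moreover have "q \<in> W'"
    using calculation(2) W(2) q(1) by blast
  ultimately show "\<exists>W. open W \<and> q \<in> W \<and> (\<forall>r\<in>Q' \<inter> W. (h \<circ> \<sigma>) r \<in> U v \<and>
     (f \<circ> \<sigma>) r \<otimes> weight v ((h \<circ> \<sigma>) r) = (f \<circ> \<sigma>) q \<otimes> weight v ((h \<circ> \<sigma>) q))"
    using W(3) by (intro exI[of _ W']) simp
qed

lemma labelling_subset: "labelling Q h f \<Longrightarrow> Q' \<subseteq> Q \<Longrightarrow> labelling Q' h f"
  using labelling_compose[of Q h f Q' id] by (simp add: continuous_on_id' id_def o_def)

lemma labelling_mult:
  assumes f: "labelling Q h f" and k: "k \<in> carrier G"
  shows "labelling Q h (\<lambda>q. k \<otimes> f q)"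
  unfolding labelling_def
proof (intro conjI ballI impI)
  fix q v assume q: "q \<in> Q" "v \<in> A \<union> B" "h q \<in> U v"
  then obtain W where W: "open W" "q \<in> W"
    "\<And>r. r \<in> Q \<Longrightarrow> r \<in> W \<Longrightarrow> h r \<in> U v \<and> f r \<otimes> weight v (h r) = f q \<otimes> weight v (h q)"
    using labellingD[OF f] by metis
  moreover have "k \<otimes> f r \<otimes> weight v (h r) = k \<otimes> f q \<otimes> weight v (h q)" if "r \<in> Q" "r \<in> W" for r
    using W(3)[OF that] that q(1) k labelling_closed[OF f] by (simp add: m_assoc)
  ultimately show "\<exists>W. open W \<and> q \<in> W \<and> (\<forall>r\<in>Q \<inter> W. h r \<in> U v \<and>
     k \<otimes> f r \<otimes> weight v (h r) = k \<otimes> f q \<otimes> weight v (h q))"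
    by (intro exI[of _ W]) simp
qed (use labelling_closed[OF f] k in auto)

text \<open>Two lifts differ by a deck transformation, which is a left multiplication because the
  weights act on the right. In \<open>g q \<otimes> inv f q\<close> the weights cancel, so it is
  locally constant.\<close>

lemma labelling_unique:
  assumes f: "labelling Q h f" and g: "labelling Q h g" and "connected Q" and hQ: "h ` Q \<subseteq> M"
  obtains k where "k \<in> carrier G" "\<And>q. q \<in> Q \<Longrightarrow> g q = k \<otimes> f q"
proof (cases "Q = {}")
  case False
  then obtain q0 where q0: "q0 \<in> Q" by blast
  note cl = labelling_closed[OF f] labelling_closed[OF g]
  have const: "g q0 \<otimes> inv f q0 = g q \<otimes> inv f q" if "q \<in> Q" for q
  proof (rule connected_local_const[OF \<open>connected Q\<close> q0 that], intro ballI)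
    fix q assume q: "q \<in> Q"
    then obtain v where v: "v \<in> A \<union> B" "h q \<in> U v"
      using hQ in_cover by blast
    obtain W where W: "open W" "q \<in> W"
      "\<And>r. r \<in> Q \<Longrightarrow> r \<in> W \<Longrightarrow> h r \<in> U v \<and> f r \<otimes> weight v (h r) = f q \<otimes> weight v (h q)"
      using labellingD[OF f q v] by metis
    obtain W' where W': "open W'" "q \<in> W'"
      "\<And>r. r \<in> Q \<Longrightarrow> r \<in> W' \<Longrightarrow> h r \<in> U v \<and> g r \<otimes> weight v (h r) = g q \<otimes> weight v (h q)"
      using labellingD[OF g q v] by metis
    have "g q \<otimes> inv f q = g r \<otimes> inv f r" if r: "r \<in> Q" "r \<in> W" "r \<in> W'" for r
    proof -
      have quot: "(x \<otimes> y) \<otimes> inv (z \<otimes> y) = x \<otimes> inv z"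
        if "x \<in> carrier G" "y \<in> carrier G" "z \<in> carrier G" for x y z
      proof -
        have "y \<otimes> (inv y \<otimes> inv z) = inv z"
          using that by (simp flip: m_assoc)
        then show ?thesis
          using that by (simp add: inv_mult_group m_assoc)
      qed
      show ?thesis
        using quot[of "g q" "weight v (h q)" "f q"] quot[of "g r" "weight v (h r)" "f r"] W(3) W'(3) r q cl
        by simp
    qed
    moreover have "open (W \<inter> W')" "q \<in> W \<inter> W'"
      using W W' by auto
    ultimately show "\<forall>\<^sub>F r in at q within Q. g q \<otimes> inv f q = g r \<otimes> inv f r"
      unfolding eventually_at_topological by blast
  qed
  show thesis
  proof
    show "g q0 \<otimes> inv f q0 \<in> carrier G"
      using q0 cl by simp
    show "g q = g q0 \<otimes> inv f q0 \<otimes> f q" if "q \<in> Q" for q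
      using const[OF that] that cl by (simp add: m_assoc)
  qed
qed (use that[of \<one>] in auto)

text \<open>The lift whose coordinate over \<open>U v\<close> is constantly one.\<close>

lemma labelling_local:
  assumes v: "v \<in> A \<union> B" and h: "continuous_on Q h" "h ` Q \<subseteq> U v"
  shows "labelling Q h (\<lambda>q. inv (weight v (h q)))"
  unfolding labelling_def
proof (intro conjI ballI impI)
  fix q u assume q: "q \<in> Q" "u \<in> A \<union> B" "h q \<in> U u"
  have "h ` Q \<subseteq> M"
    using h(2) U_subset[OF v] by blast
  then have "openin (top_of_set Q) (Q \<inter> h -` U u)"
    using continuous_openin_preimage[OF h(1) _ openin_U[OF q(2)]] by blast
  then obtain W where W: "open W" "Q \<inter> h -` U u = Q \<inter> W"
    by (auto simp: openin_open)
  have "inv (weight v (h r)) \<otimes> weight u (h r) = inv (weight v (h q)) \<otimes> weight u (h q)"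
    if r: "r \<in> Q" "h r \<in> U u" for r
  proof (cases "u = v")
    case False
    then have "weight u (h r) = weight u (h q)" "weight v (h r) = weight v (h q)"
      using weight_eq[of u v "h r" "h q"] weight_eq[of v u "h r" "h q"] q r h(2) v
      by (simp_all add: image_subset_iff)
    then show ?thesis by simp
  qed simp
  moreover have "h r \<in> U u" if "r \<in> Q \<inter> W" for r
    using W(2) that by blast
  moreover have "q \<in> W"
    using W(2) q by blast
  ultimately show "\<exists>W. open W \<and> q \<in> W \<and> (\<forall>r\<in>Q \<inter> W. h r \<in> U u \<and>
     inv (weight v (h r)) \<otimes> weight u (h r) = inv (weight v (h q)) \<otimes> weight u (h q))"
    using W(1) by (intro exI[of _ W]) simp
qed simp

text \<open>Connectedness of the intersection yields a single factor \<open>k\<close> that aligns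
  the two lifts there. Closedness allows the local condition to be checked on each piece separately:
  a point outside a piece has a neighbourhood that misses it.\<close>

lemma labelling_Un:
  assumes f1: "labelling Q1 h f1" and f2: "labelling Q2 h f2" and "closed Q1" "closed Q2"
    and conn: "connected (Q1 \<inter> Q2)" and hQ: "h ` (Q1 \<union> Q2) \<subseteq> M"
  obtains f where "labelling (Q1 \<union> Q2) h f"
proof -
  have "h ` (Q1 \<inter> Q2) \<subseteq> M"
    using hQ by auto
  then obtain k where k: "k \<in> carrier G" "\<And>q. q \<in> Q1 \<inter> Q2 \<Longrightarrow> f1 q = k \<otimes> f2 q"
    using labelling_unique[OF labelling_subset[OF f2] labelling_subset[OF f1] conn] by auto
  define f where "f q = (if q \<in> Q1 then f1 q else k \<otimes> f2 q)" for q
  have f2': "labelling Q2 h (\<lambda>q. k \<otimes> f2 q)"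
    using labelling_mult[OF f2 k(1)] .
  have f_eq: "q \<in> Q1 \<Longrightarrow> f q = f1 q" "q \<in> Q2 \<Longrightarrow> f q = k \<otimes> f2 q" for q
    using k(2) by (auto simp: f_def)
  have loc: "\<exists>W. open W \<and> q \<in> W \<and> (\<forall>r\<in>Q \<inter> W. h r \<in> U v \<and> f r \<otimes> weight v (h r) = f q \<otimes> weight v (h q))"
    if g: "labelling Q h g" "\<And>q. q \<in> Q \<Longrightarrow> f q = g q" and Q: "closed Q" 
      and v: "v \<in> A \<union> B" "h q \<in> U v" for Q g q v
  proof (cases "q \<in> Q")
    case True
    with labellingD[OF g(1) True v] g(2) show ?thesis
      by (metis Int_iff)
  next
    case False
    with Q show ?thesis
      by (intro exI[of _ "- Q"]) auto
  qed
  have "labelling (Q1 \<union> Q2) h f"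
    unfolding labelling_def
  proof (intro conjI ballI impI)
    show "f \<in> Q1 \<union> Q2 \<rightarrow> carrier G"
      using labelling_closed[OF f1] labelling_closed[OF f2] k by (auto simp: f_def)
    fix q v assume v: "v \<in> A \<union> B" "h q \<in> U v" and "q \<in> Q1 \<union> Q2"
    have "\<exists>W. open W \<and> q \<in> W \<and>
        (\<forall>r\<in>Q1 \<inter> W. h r \<in> U v \<and> f r \<otimes> weight v (h r) = f q \<otimes> weight v (h q))"
      by (rule loc[OF f1 _ \<open>closed Q1\<close> v]) (rule f_eq(1))
    then obtain W1 where W1: "open W1" "q \<in> W1"
      "\<forall>r\<in>Q1 \<inter> W1. h r \<in> U v \<and> f r \<otimes> weight v (h r) = f q \<otimes> weight v (h q)"
      by (elim exE conjE)
    have "\<exists>W. open W \<and> q \<in> W \<and>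
        (\<forall>r\<in>Q2 \<inter> W. h r \<in> U v \<and> f r \<otimes> weight v (h r) = f q \<otimes> weight v (h q))"
      by (rule loc[OF f2' _ \<open>closed Q2\<close> v]) (rule f_eq(2))
    then obtain W2 where W2: "open W2" "q \<in> W2"
      "\<forall>r\<in>Q2 \<inter> W2. h r \<in> U v \<and> f r \<otimes> weight v (h r) = f q \<otimes> weight v (h q)"
      by (elim exE conjE)
    show "\<exists>W. open W \<and> q \<in> W \<and> (\<forall>r\<in>(Q1 \<union> Q2) \<inter> W. h r \<in> U v \<and>
        f r \<otimes> weight v (h r) = f q \<otimes> weight v (h q))"
      using W1 W2 by (intro exI[of _ "W1 \<inter> W2"]) (simp add: open_Int ball_Un Int_Un_distrib2)
  qed
  then show thesis
    using that by blast
qed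

text \<open>Subdivision by bisection instead of an explicit grid. Small squares carry a labelling
  because they map into one set of the cover; one use of \<open>Bolzano\<close> stacks them into
  thin strips across the unit square, a second one joins the strips.\<close>

lemma labelling_rectangle_exists:
  fixes h :: "real \<times> real \<Rightarrow> 'a"
  assumes h: "continuous_on ({0..1} \<times> {0..1}) h" "h ` ({0..1} \<times> {0..1}) \<subseteq> M"
  obtains f where "labelling ({0..1} \<times> {0..1}) h f"
proof -
  \<comment> \<open>The intersections with the unit interval let a small square about a boundary
    point stick out of the unit square.\<close>
  define L where "L a b c d \<longleftrightarrow> (\<exists>f. labelling (({0..1} \<inter> {a..b}) \<times> ({0..1} \<inter> {c..d})) h f)" for a b c d
  have mono: "L a' b' c' d'" if "L a b c d" "a \<le> a'" "b' \<le> b" "c \<le> c'" "d' \<le> d" for a b c d a' b' c' d'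
    using that unfolding L_def
    by (meson Int_mono Sigma_mono atLeastatMost_subset_iff labelling_subset order_refl)
  have joinable: "closed (({0..1} \<inter> {a..b}) \<times> ({0..1} \<inter> {c..d::real}))" 
    "connected (({0..1} \<inter> {a..b}) \<times> ({0..1} \<inter> {c..d::real}))" for a b c d :: real
    by (auto intro!: closed_Times connected_Times)
  have join1: "L a b c e" if l: "L a b c d" "L a b d e" "c \<le> d" "d \<le> e" for a b c d e
  proof -
    obtain f g where "labelling (({0..1} \<inter> {a..b}) \<times> ({0..1} \<inter> {c..d})) h f"
      "labelling (({0..1} \<inter> {a..b}) \<times> ({0..1} \<inter> {d..e})) h g"
      using l unfolding L_def by blast
    moreover have "({0..1} \<inter> {a..b}) \<times> ({0..1} \<inter> {c..d}) \<union> ({0..1} \<inter> {a..b}) \<times> ({0..1} \<inter> {d..e})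
        = ({0..1} \<inter> {a..b}) \<times> ({0..1} \<inter> {c..e})"
      using that by auto
    moreover have "({0..1} \<inter> {a..b}) \<times> ({0..1} \<inter> {c..d}) \<inter> ({0..1} \<inter> {a..b}) \<times> ({0..1} \<inter> {d..e})
        = ({0..1} \<inter> {a..b}) \<times> ({0..1} \<inter> {d..d})"
      using that by auto
    moreover have "h ` (({0..1} \<inter> {a..b}) \<times> ({0..1} \<inter> {c..e})) \<subseteq> M"
      using h(2) by auto
    ultimately show ?thesis
      using labelling_Un[of _ h f _ g] joinable unfolding L_def by metis
  qed
  have join2: "L a c d e" if l: "L a b d e" "L b c d e" "a \<le> b" "b \<le> c" for a b c d e
  proof -
    obtain f g where "labelling (({0..1} \<inter> {a..b}) \<times> ({0..1} \<inter> {d..e})) h f"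
      "labelling (({0..1} \<inter> {b..c}) \<times> ({0..1} \<inter> {d..e})) h g"
      using l unfolding L_def by blast
    moreover have "({0..1} \<inter> {a..b}) \<times> ({0..1} \<inter> {d..e}) \<union> ({0..1} \<inter> {b..c}) \<times> ({0..1} \<inter> {d..e})
        = ({0..1} \<inter> {a..c}) \<times> ({0..1} \<inter> {d..e})"
      using that by auto
    moreover have "({0..1} \<inter> {a..b}) \<times> ({0..1} \<inter> {d..e}) \<inter> ({0..1} \<inter> {b..c}) \<times> ({0..1} \<inter> {d..e})
        = ({0..1} \<inter> {b..b}) \<times> ({0..1} \<inter> {d..e})"
      using that by auto
    moreover have "h ` (({0..1} \<inter> {a..c}) \<times> ({0..1} \<inter> {d..e})) \<subseteq> M"
      using h(2) by auto
    ultimately show ?thesis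
      using labelling_Un[of _ h f _ g] joinable unfolding L_def by metis
  qed
  have small: "\<exists>d>0. L (s - d) (s + d) (t - d) (t + d)" if st: "s \<in> {0..1}" "t \<in> {0..1}" for s t
  proof -
    have "h (s, t) \<in> M"
      using h(2) st by blast
    then obtain v where v: "v \<in> A \<union> B" "h (s, t) \<in> U v"
      using in_cover by blast
    have "openin (top_of_set ({0..1} \<times> {0..1})) (({0..1} \<times> {0..1}) \<inter> h -` U v)"
      using continuous_openin_preimage[OF h(1) _ openin_U[OF v(1)]] h(2) by blast
    then obtain W where W: "open W" "({0..1} \<times> {0..1}) \<inter> h -` U v = ({0..1} \<times> {0..1}) \<inter> W"
      by (auto simp: openin_open)
    moreover have "(s, t) \<in> W"
      using W st v by blast
    ultimately obtain S T where ST: "open S" "open T" "s \<in> S" "t \<in> T" "S \<times> T \<subseteq> W"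
      by (auto elim!: open_prod_elim)
    obtain d1 where d1: "d1 > 0" "cball s d1 \<subseteq> S"
      using ST open_contains_cball by blast
    obtain d2 where d2: "d2 > 0" "cball t d2 \<subseteq> T"
      using ST open_contains_cball by blast
    define d where "d = min d1 d2"
    have "d \<le> d1" "d \<le> d2"
      by (auto simp: d_def)
    have sub: "{s - d..s + d} \<subseteq> S" "{t - d..t + d} \<subseteq> T"
      using d1(2) d2(2) \<open>d \<le> d1\<close> \<open>d \<le> d2\<close> by (force simp: cball_eq_atLeastAtMost subset_iff)+
    let ?Q = "({0..1} \<inter> {s - d..s + d}) \<times> ({0..1} \<inter> {t - d..t + d})"
    have "?Q \<subseteq> {0..1} \<times> {0..1}"
      by auto
    moreover have "?Q \<subseteq> S \<times> T"
      using sub by blast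
    ultimately have "?Q \<subseteq> ({0..1} \<times> {0..1}) \<inter> W"
      using ST by blast
    then have "?Q \<subseteq> ({0..1} \<times> {0..1}) \<inter> h -` U v"
      using W(2) by simp
    then have "h ` ?Q \<subseteq> U v" "continuous_on ?Q h"
      using continuous_on_subset[OF h(1)] by blast+
    from labelling_local[OF v(1) this(2,1)] show ?thesis
      unfolding L_def using d1(1) d2(1) by (intro exI[of _ d]) (auto simp: d_def)
  qed
  have strip: "\<exists>d>0. L (s - d) (s + d) 0 1" if s: "s \<in> {0..1}" for s
  proof -
    show ?thesis
    proof (rule Bolzano[where P = "\<lambda>a b. \<exists>d>0. L (s - d) (s + d) a b"], goal_cases le trans local)
      case (trans a b c)
      then obtain d e where "d > 0" "L (s - d) (s + d) a b" "e > 0" "L (s - e) (s + e) b c"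
        by blast
      \<comment> \<open>Rectangles of different widths are glued along their common edge only after
        shrinking both to the narrower width.\<close>
      then have "L (s - min d e) (s + min d e) a c"
        using trans by (intro join1[of _ _ a b c]) (auto elim: mono)
      then show ?case
        using \<open>d > 0\<close> \<open>e > 0\<close> by (intro exI[of _ "min d e"]) auto
    next
      case (local t)
      then obtain d where "d > 0" "L (s - d) (s + d) (t - d) (t + d)"
        using small[OF s, of t] by auto
      then show ?case
        by (intro exI[of _ d]) (auto elim!: mono)
    qed simp
  qed
  have "L 0 1 0 1"
  proof (rule Bolzano[where P = "\<lambda>a b. L a b 0 1"], goal_cases le trans local)
    case (trans a b c)
    then show ?case
      using join2 by blast
  next
    case (local s)
    then obtain d where "d > 0" "L (s - d) (s + d) 0 1"
      using strip[of s] by auto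
    then show ?case
      by (intro exI[of _ d]) (auto elim!: mono)
  qed simp
  then show thesis
    using that by (auto simp: L_def)
qed

lemma labelling_path_exists:
  assumes "path p" "path_image p \<subseteq> M"
  obtains f where "labelling {0..1} p f"
proof -
  have "continuous_on ({0..1} \<times> {0..1}) (\<lambda>x. p (snd x))"
    using assms(1) by (intro continuous_on_compose2[of "{0..1}" p _ snd]) (auto simp: path_def intro!: continuous_intros)
  moreover have "(\<lambda>x. p (snd x)) ` ({0..1} \<times> {0..1}) \<subseteq> M"
    using assms(2) by (auto simp: path_image_def)
  ultimately obtain f :: "real \<times> real \<Rightarrow> 'g" where f: "labelling ({0..1} \<times> {0..1}) (\<lambda>x. p (snd x)) f"
    using labelling_rectangle_exists by blast
  have "labelling {0..1} ((\<lambda>x. p (snd x)) \<circ> Pair (0::real)) (f \<circ> Pair 0)"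
    by (intro labelling_compose[OF f]) (auto intro!: continuous_intros)
  then show thesis
    using that by (simp add: o_def)
qed

section \<open>Holonomy of a path\<close>

definition hol :: "(real \<Rightarrow> 'a) \<Rightarrow> 'g" where
  "hol p = (let f = (SOME f. labelling {0..1} p f) in inv (f 0) \<otimes> f 1)"

text \<open>Labellings of a path differ by a left factor, which cancels in
  \<open>inv (f 0) \<otimes> f 1\<close>; hence the choice made by \<open>SOME\<close> is
  irrelevant.\<close>

lemma hol_eq:
  assumes f: "labelling {0..1} p f" and p: "path_image p \<subseteq> M"
  shows "hol p = inv (f 0) \<otimes> f 1"
proof -
  define g where "g = (SOME f. labelling {0..1} p f)"
  have g: "labelling {0..1} p g"
    unfolding g_def using someI_ex[of "labelling {0..1} p"] f by blast
  obtain k where k: "k \<in> carrier G" "\<And>q. q \<in> {0..1} \<Longrightarrow> g q = k \<otimes> f q"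
    using labelling_unique[OF f g] p by (metis connected_Icc path_image_def)
  have "f 0 \<in> carrier G" "f 1 \<in> carrier G"
    using labelling_closed[OF f] by auto
  then have "inv (g 0) \<otimes> g 1 = inv (f 0) \<otimes> f 1"
    using k by (simp add: inv_mult_group m_assoc) (simp flip: m_assoc)
  then show ?thesis
    by (simp add: hol_def g_def)
qed

lemma hol_closed [simp]: "path p \<Longrightarrow> path_image p \<subseteq> M \<Longrightarrow> hol p \<in> carrier G"
  using labelling_path_exists[of p] hol_eq[of p] labelling_closed
  by (metis atLeastAtMost_iff inv_closed m_closed order_refl zero_le_one)

lemma hol_local:
  assumes "v \<in> A \<union> B" "path p" "path_image p \<subseteq> U v"
  shows "hol p = weight v (pathstart p) \<otimes> inv (weight v (pathfinish p))"
  using hol_eq[OF labelling_local[of v "{0..1}" p]] assms U_subset[of v]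
  by (auto simp: path_def path_image_def pathstart_def pathfinish_def)

lemma hol_join:
  assumes p: "path p" "path_image p \<subseteq> M" and q: "path q" "path_image q \<subseteq> M"
    and pq: "pathfinish p = pathstart q"
  shows "hol (p +++ q) = hol p \<otimes> hol q"
proof -
  have pq_im: "path_image (p +++ q) \<subseteq> M"
    using p q by (simp add: subset_path_image_join)
  obtain f where f: "labelling {0..1} (p +++ q) f"
    using labelling_path_exists[of "p +++ q"] p q pq pq_im by auto
  have cl: "f x \<in> carrier G" if "x \<in> {0..1}" for x
    using labelling_closed[OF f that] .
  have 1: "labelling {0..1} ((p +++ q) \<circ> (\<lambda>t. t / 2)) (f \<circ> (\<lambda>t. t / 2))"
    by (intro labelling_compose[OF f]) (auto intro!: continuous_intros)
  have 2: "labelling {0..1} ((p +++ q) \<circ> (\<lambda>t. (t + 1) / 2)) (f \<circ> (\<lambda>t. (t + 1) / 2))"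
    by (intro labelling_compose[OF f]) (auto intro!: continuous_intros)
  have cong: "labelling {0..1} h' g" if "labelling {0..1} h g" "\<And>t. t \<in> {0..1} \<Longrightarrow> h t = h' t" for h h' :: "real \<Rightarrow> 'a" and g
    using that by (simp add: labelling_def)
  have "labelling {0..1} p (f \<circ> (\<lambda>t. t / 2))"
    by (rule cong[OF 1]) (auto simp: joinpaths_def)
  then have hp: "hol p = inv (f 0) \<otimes> f (1/2)"
    using hol_eq p by fastforce
  have "labelling {0..1} q (f \<circ> (\<lambda>t. (t + 1) / 2))"
    using pq by (intro cong[OF 2]) (auto simp: joinpaths_def pathstart_def pathfinish_def add_divide_distrib)
  then have hq: "hol q = inv (f (1/2)) \<otimes> f 1"
    using hol_eq q by fastforce
  show ?thesis
    using hol_eq[OF f pq_im] cl[of 0] cl[of 1] cl[of "1/2"]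
    by (simp add: hp hq m_assoc) (simp flip: m_assoc)
qed

lemma hol_reversepath:
  assumes p: "path p" "path_image p \<subseteq> M"
  shows "hol (reversepath p) = inv (hol p)"
proof -
  obtain f where f: "labelling {0..1} p f"
    using labelling_path_exists[OF p] by blast
  have cl: "f 0 \<in> carrier G" "f 1 \<in> carrier G"
    using labelling_closed[OF f] by auto
  have "labelling {0..1} (p \<circ> (\<lambda>t. 1 - t)) (f \<circ> (\<lambda>t. 1 - t))"
    by (intro labelling_compose[OF f]) (auto intro!: continuous_intros)
  then have "labelling {0..1} (reversepath p) (f \<circ> (\<lambda>t. 1 - t))"
    by (simp add: reversepath_def o_def)
  then have "hol (reversepath p) = inv (f 1) \<otimes> f 0"
    using hol_eq p by fastforce
  then show ?thesis
    using hol_eq[OF f p(2)] cl by (simp add: inv_mult_group)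
qed

text \<open>A labelling of the whole homotopy restricts to labellings of both paths. On the two
  sides where the homotopy stands still, it is a multiple of a constant labelling, so its values at
  the four corners match in pairs.\<close>

lemma hol_homotopic:
  assumes "homotopic_paths M p q"
  shows "hol p = hol q"
proof -
  obtain h :: "real \<times> real \<Rightarrow> 'a" where h: "continuous_on ({0..1} \<times> {0..1}) h" "h \<in> ({0..1} \<times> {0..1}) \<rightarrow> M"
    "\<forall>x\<in>{0..1}. h (0, x) = p x" "\<forall>x\<in>{0..1}. h (1, x) = q x"
    "\<forall>t\<in>{0..1}. pathstart (h \<circ> Pair t) = pathstart p \<and> pathfinish (h \<circ> Pair t) = pathfinish p"
    using assms unfolding homotopic_paths by (elim exE conjE)
  have pq: "path_image p \<subseteq> M" "path_image q \<subseteq> M"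
    using assms homotopic_paths_imp_subset by blast+
  obtain f where f: "labelling ({0..1} \<times> {0..1}) h f"
    using labelling_rectangle_exists[OF h(1)] h(2) by blast
  have side: "labelling {0..1} r (f \<circ> Pair t)" if "t \<in> {0..1}" "\<And>x. x \<in> {0..1} \<Longrightarrow> h (t, x) = r x" for t r
  proof -
    have "labelling {0..1} (h \<circ> Pair t) (f \<circ> Pair t)"
      using that by (intro labelling_compose[OF f]) (auto intro!: continuous_intros)
    then show ?thesis
      using that(2) by (simp add: labelling_def)
  qed
  have end_const: "f (0, x) = f (1, x)" if "x \<in> {0, 1}" for x
  proof -
    have c: "h (t, x) = p x" if "t \<in> {0..1}" for t
      using bspec[OF h(5) that] \<open>x \<in> {0, 1}\<close> by (auto simp: pathstart_def pathfinish_def)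
    have "p x \<in> M"
      using pq \<open>x \<in> {0, 1}\<close> by (auto simp: path_image_def)
    then obtain v where v: "v \<in> A \<union> B" "p x \<in> U v"
      using in_cover by blast
    have lab: "labelling {0..1} (h \<circ> (\<lambda>t. (t, x))) (f \<circ> (\<lambda>t. (t, x)))"
      using that by (intro labelling_compose[OF f]) (auto intro!: continuous_intros)
    have "labelling {0..1} (\<lambda>_. p x) (\<lambda>_. inv (weight v (p x)))"
      using v by (intro labelling_local) auto
    then have lab': "labelling {0..1} (h \<circ> (\<lambda>t. (t, x))) (\<lambda>_. inv (weight v (p x)))"
      using c by (simp add: labelling_def)
    have "(h \<circ> (\<lambda>t. (t, x))) ` {0..1} \<subseteq> M"
      using c \<open>p x \<in> M\<close> by auto
    then obtain k where "k \<in> carrier G"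
      "\<And>t. t \<in> {0..1} \<Longrightarrow> (f \<circ> (\<lambda>t. (t, x))) t = k \<otimes> inv (weight v (p x))"
      by (rule labelling_unique[OF lab' lab connected_Icc]) (rule that)
    then show ?thesis
      by simp
  qed
  show ?thesis
    using hol_eq[OF side[of 0 p] pq(1)] hol_eq[OF side[of 1 q] pq(2)] h(3,4) end_const[of 0] end_const[of 1]
    by simp
qed

end

section \<open>Generators from a spanning tree\<close>

definition path_between :: "'a::topological_space set \<Rightarrow> 'a \<Rightarrow> 'a \<Rightarrow> (real \<Rightarrow> 'a) \<Rightarrow> bool" where
  "path_between S x y p \<longleftrightarrow> path p \<and> path_image p \<subseteq> S \<and> pathstart p = x \<and> pathfinish p = y"

lemma path_between_join: "path_between S x y p \<Longrightarrow> path_between S y z q \<Longrightarrow> path_between S x z (p +++ q)"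
  by (auto simp: path_between_def subset_path_image_join)

lemma path_between_reversepath: "path_between S x y p \<Longrightarrow> path_between S y x (reversepath p)"
  by (auto simp: path_between_def)

lemma path_between_refl: "x \<in> S \<Longrightarrow> path_between S x x (linepath x x)"
  by (simp add: path_between_def)

lemma path_between_mono: "path_between S x y p \<Longrightarrow> S \<subseteq> T \<Longrightarrow> path_between T x y p"
  by (auto simp: path_between_def)

lemma path_between_homotopic:
  "homotopic_paths S p q \<Longrightarrow> path_between S x y p \<Longrightarrow> path_between S x y q"
  unfolding path_between_def
  by (metis homotopic_paths_imp_path homotopic_paths_imp_pathfinish homotopic_paths_imp_pathstart
      homotopic_paths_imp_subset)

lemma homotopic_assoc:
  assumes "path_between S x y p" "path_between S y z q" "path_between S z w r"
  shows "homotopic_paths S ((p +++ q) +++ r) (p +++ (q +++ r))"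
  using assms homotopic_paths_assoc[of p S q r] homotopic_paths_sym by (auto simp: path_between_def)

lemma homotopic_join:
  assumes "homotopic_paths S p p'" "homotopic_paths S q q'" "path_between S x y p" "path_between S y z q"
  shows "homotopic_paths S (p +++ q) (p' +++ q')"
  using assms by (intro homotopic_paths_join) (auto simp: path_between_def)

lemma homotopic_join_left:
  "homotopic_paths S p p' \<Longrightarrow> path_between S x y p \<Longrightarrow> path_between S y z q \<Longrightarrow>
     homotopic_paths S (p +++ q) (p' +++ q)"
  by (rule homotopic_join) (auto simp: path_between_def)

lemma homotopic_join_right:
  "homotopic_paths S q q' \<Longrightarrow> path_between S x y p \<Longrightarrow> path_between S y z q \<Longrightarrow>
     homotopic_paths S (p +++ q) (p +++ q')"
  by (rule homotopic_join) (auto simp: path_between_def)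

lemma homotopic_cancel_inv:
  fixes S :: "'a::real_normed_vector set"
  assumes p: "path_between S x y p" and q: "path_between S y z q"
  shows "homotopic_paths S (reversepath p +++ (p +++ q)) q"
proof -
  note r = path_between_reversepath[OF p]
  have "homotopic_paths S (reversepath p +++ (p +++ q)) ((reversepath p +++ p) +++ q)"
    using homotopic_assoc[OF r p q] by (rule homotopic_paths_sym)
  also have "homotopic_paths S \<dots> (linepath y y +++ q)"
    using homotopic_paths_linv[of p S] p q r
    by (intro homotopic_join_left[OF _ path_between_join[OF r p] q]) (auto simp: path_between_def)
  also have "homotopic_paths S \<dots> q"
    using q homotopic_paths_lid[of q S] by (auto simp: path_between_def)
  finally show ?thesis .
qed

lemma homotopic_cancel_inv':
  fixes S :: "'a::real_normed_vector set"
  assumes p: "path_between S y x p" and q: "path_between S y z q"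
  shows "homotopic_paths S (p +++ (reversepath p +++ q)) q"
  using homotopic_cancel_inv[OF path_between_reversepath[OF p] q] by simp

lemma homotopic_cancel_right:
  fixes S :: "'a::real_normed_vector set"
  assumes p: "path_between S x y p" and q: "path_between S z y q"
  shows "homotopic_paths S ((p +++ reversepath q) +++ q) p"
proof -
  note r = path_between_reversepath[OF q]
  have "homotopic_paths S ((p +++ reversepath q) +++ q) (p +++ (reversepath q +++ q))"
    by (rule homotopic_assoc[OF p r q])
  also have "homotopic_paths S \<dots> (p +++ linepath y y)"
    using homotopic_paths_linv[of q S] q
    by (intro homotopic_join_right[OF _ p path_between_join[OF r q]]) (auto simp: path_between_def)
  also have "homotopic_paths S \<dots> p"
    using p homotopic_paths_rid[of p S] by (auto simp: path_between_def)
  finally show ?thesis .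
qed

lemma homotopic_lid:
  "path_between S x y p \<Longrightarrow> homotopic_paths S (linepath x x +++ p) p"
  using homotopic_paths_lid[of p S] by (auto simp: path_between_def)

lemma subpath_in:
  assumes p: "path p" "path_image p \<subseteq> S" and ab: "a \<in> {0..1}" "b \<in> {0..1}"
  shows "path_between S (p a) (p b) (subpath a b p)"
  using assms path_image_subpath_subset[OF ab] by (auto simp: path_between_def)

text \<open>The spanning tree is encoded by parent pointers: \<open>rank\<close> excludes cycles and
  leads every vertex to the root, and \<open>par_meet\<close> makes every pointer an edge, hence one
  between the two families. A root in \<open>B\<close> has weight one at the base point.\<close>

locale rooted_cover = two_family_cover M A B U
  for M :: "'a::real_normed_vector set" and A B :: "'v set" and U :: "'v \<Rightarrow> 'a set" +
  fixes root :: 'v and c :: 'a and par :: "'v \<Rightarrow> 'v" and rank :: "'v \<Rightarrow> nat"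
  assumes root: "root \<in> B" "c \<in> U root"
    and par: "v \<in> A \<union> B \<Longrightarrow> v \<noteq> root \<Longrightarrow> par v \<in> A \<union> B"
    and rank_par: "v \<in> A \<union> B \<Longrightarrow> v \<noteq> root \<Longrightarrow> rank (par v) < rank v"
    and par_meet: "v \<in> A \<union> B \<Longrightarrow> v \<noteq> root \<Longrightarrow> U v \<inter> U (par v) \<noteq> {}"
begin

declare linepath_trivial [simp del]

section \<open>Tree paths and access paths\<close>

definition generator_edges :: "('v \<times> 'v) set" where
  "generator_edges = {(a, b) \<in> A \<times> B. U a \<inter> U b \<noteq> {} \<and>
     \<not> (a \<noteq> root \<and> par a = b) \<and> \<not> (b \<noteq> root \<and> par b = a)}"

definition edge_label :: "'v \<Rightarrow> 'v \<Rightarrow> (bool \<times> ('v \<times> 'v)) list" where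
  "edge_label a b = (if (a, b) \<in> generator_edges then [(True, (a, b))] else [])"

lemma edge_label_carrier: "edge_label a b \<in> carrier (free_group generator_edges)"
  by (simp add: edge_label_def free_group_def reduced_Cons)

sublocale labelled_cover M A B U "free_group generator_edges" edge_label
proof (rule labelled_cover.intro[OF two_family_cover_axioms group_free_group])
  show "labelled_cover_axioms (free_group generator_edges) edge_label"
    by (rule labelled_cover_axioms.intro) (rule edge_label_carrier)
qed

definition centre :: "'v \<Rightarrow> 'a" where
  "centre v = (if v = root then c else SOME x. x \<in> U v)"

lemma centre_in: "v \<in> A \<union> B \<Longrightarrow> centre v \<in> U v"
  using root par_meet[of v] some_in_eq[of "U v"] by (cases "v = root") (auto simp: centre_def)

definition local_path :: "'v \<Rightarrow> 'a \<Rightarrow> real \<Rightarrow> 'a" where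
  "local_path v x = (SOME p. path_between (U v) (centre v) x p)"

lemma local_path: 
  assumes "v \<in> A \<union> B" "x \<in> U v"
  shows "path_between (U v) (centre v) x (local_path v x)"
proof -
  have "path_connected (U v)"
    using assms simply_connected_U simply_connected_imp_path_connected by blast
  then have "\<exists>p. path_between (U v) (centre v) x p"
    using assms centre_in[of v] by (auto simp: path_connected_def path_between_def)
  then show ?thesis
    unfolding local_path_def by (rule someI_ex)
qed

lemma local_path_M: "v \<in> A \<union> B \<Longrightarrow> x \<in> U v \<Longrightarrow> path_between M (centre v) x (local_path v x)"
  using local_path U_subset path_between_mono by blast

definition crossing :: "'v \<Rightarrow> 'v \<Rightarrow> 'a" where
  "crossing u v = (SOME x. x \<in> U u \<inter> U v)"

lemma crossing_commute: "crossing u v = crossing v u"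
  by (simp add: crossing_def Int_commute)

lemma crossing_in: "U u \<inter> U v \<noteq> {} \<Longrightarrow> crossing u v \<in> U u \<inter> U v"
  unfolding crossing_def by (rule someI_ex) blast

function tree_path :: "'v \<Rightarrow> real \<Rightarrow> 'a" where
  "tree_path v = (if v \<in> A \<union> B \<and> v \<noteq> root
     then tree_path (par v) +++ (local_path (par v) (crossing v (par v)) +++
            reversepath (local_path v (crossing v (par v))))
     else linepath c c)"
  by auto
termination
  by (relation "Wellfounded.measure rank") (auto intro: rank_par)

declare tree_path.simps [simp del]

lemma tree_path_root: "tree_path root = linepath c c"
  by (subst tree_path.simps) simp

lemma tree_path_step:
  "v \<in> A \<union> B \<Longrightarrow> v \<noteq> root \<Longrightarrow> tree_path v = tree_path (par v) +++
     (local_path (par v) (crossing v (par v)) +++ reversepath (local_path v (crossing v (par v))))"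
  by (subst tree_path.simps) simp

lemma tree_induct [consumes 1, case_names base step]:
  assumes "v \<in> A \<union> B" and "P root"
    and "\<And>v. v \<in> A \<union> B \<Longrightarrow> v \<noteq> root \<Longrightarrow> P (par v) \<Longrightarrow> P v"
  shows "P v"
  using assms(1)
proof (induction "rank v" arbitrary: v rule: less_induct)
  case less
  then show ?case
    using assms(2,3) par rank_par by (cases "v = root") auto
qed

lemma tree_path: "v \<in> A \<union> B \<Longrightarrow> path_between M c (centre v) (tree_path v)"
proof (induction v rule: tree_induct)
  case base
  then show ?case
    using root U_subset[of root] by (simp add: tree_path_root centre_def path_between_refl subset_iff)
next
  case (step v)
  note x = crossing_in[OF par_meet[OF step(1,2)]]
  have "path_between M c (centre v) (tree_path (par v) +++
      (local_path (par v) (crossing v (par v)) +++ reversepath (local_path v (crossing v (par v)))))"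
    using x step(1) par[OF step(1,2)]
    by (intro path_between_join[OF step(3)]
        path_between_join[OF local_path_M path_between_reversepath[OF local_path_M]]) auto
  then show ?case
    by (simp only: tree_path_step[OF step(1,2)])
qed

definition access :: "'v \<Rightarrow> 'a \<Rightarrow> real \<Rightarrow> 'a" where
  "access v x = tree_path v +++ local_path v x"

lemma access: "v \<in> A \<union> B \<Longrightarrow> x \<in> U v \<Longrightarrow> path_between M c x (access v x)"
  unfolding access_def using tree_path local_path_M by (blast intro: path_between_join)

lemma homotopic_local:
  assumes "v \<in> A \<union> B" "path_between (U v) x y p" "path_between (U v) x y q"
  shows "homotopic_paths M p q"
proof -
  have "homotopic_paths (U v) p q"
    using assms simply_connected_U[OF assms(1)]
    unfolding simply_connected_eq_homotopic_paths path_between_def by simp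
  then show ?thesis
    using homotopic_paths_subset U_subset[OF assms(1)] by blast
qed

text \<open>In the simply connected \<open>U v\<close> any two routes from the centre to
  \<open>y\<close> are homotopic, so access paths through \<open>v\<close> are carried along by any
  path inside \<open>U v\<close>.\<close>

lemma access_move:
  assumes v: "v \<in> A \<union> B" and p: "path_between (U v) x y p"
  shows "homotopic_paths M (access v x +++ p) (access v y)"
proof -
  have xy: "x \<in> U v" "y \<in> U v"
    using p by (auto simp: path_between_def)
  have pM: "path_between M x y p"
    using p U_subset[OF v] path_between_mono by blast
  have "homotopic_paths M (access v x +++ p) (tree_path v +++ (local_path v x +++ p))"
    unfolding access_def by (rule homotopic_assoc[OF tree_path[OF v] local_path_M[OF v xy(1)] pM])
  also have "homotopic_paths M \<dots> (tree_path v +++ local_path v y)"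
  proof (rule homotopic_join_right[OF _ tree_path[OF v] path_between_join[OF local_path_M[OF v xy(1)] pM]])
    show "homotopic_paths M (local_path v x +++ p) (local_path v y)"
      using homotopic_local[OF v path_between_join[OF local_path[OF v xy(1)] p] local_path[OF v xy(2)]] .
  qed
  finally show ?thesis
    by (simp add: access_def)
qed

text \<open>\<open>tree_path v\<close> runs through this very crossing point, so its last leg
  cancels against \<open>local_path v\<close>.\<close>

lemma access_tree:
  assumes v: "v \<in> A \<union> B" "v \<noteq> root"
  shows "homotopic_paths M (access v (crossing v (par v))) (access (par v) (crossing v (par v)))"
proof -
  let ?x = "crossing v (par v)"
  note x = crossing_in[OF par_meet[OF v]]
  have u: "par v \<in> A \<union> B"
    using par v by blast
  have lv: "path_between M (centre v) ?x (local_path v ?x)"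
    and lu: "path_between M (centre (par v)) ?x (local_path (par v) ?x)"
    using x u v local_path_M by auto
  note t = tree_path[OF u]
  have "homotopic_paths M
      ((tree_path (par v) +++ (local_path (par v) ?x +++ reversepath (local_path v ?x))) +++ local_path v ?x)
      (tree_path (par v) +++
      ((local_path (par v) ?x +++ reversepath (local_path v ?x)) +++ local_path v ?x))"
    by (rule homotopic_assoc[OF t path_between_join[OF lu path_between_reversepath[OF lv]] lv])
  also have "homotopic_paths M \<dots> (tree_path (par v) +++ local_path (par v) ?x)"
    by (rule homotopic_join_right[OF homotopic_cancel_right[OF lu lv] t
          path_between_join[OF path_between_join[OF lu path_between_reversepath[OF lv]] lv]])
  finally show ?thesis
    by (simp only: access_def tree_path_step[OF v])
qed

text \<open>Connectedness of the overlaps enters here: the loop \<open>g\<close> that compares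
  access through \<open>u\<close> with access through \<open>v\<close> is the same at every point of
  the overlap.\<close>

lemma access_change:
  assumes uv: "u \<in> A \<union> B" "v \<in> A \<union> B" and conn: "path_connected (U u \<inter> U v)"
    and xy: "x \<in> U u \<inter> U v" "y \<in> U u \<inter> U v" and g: "path_between M c c g"
    and hom: "homotopic_paths M (access u x) (g +++ access v x)"
  shows "homotopic_paths M (access u y) (g +++ access v y)"
proof -
  obtain p where "path_between (U u \<inter> U v) x y p"
    using conn xy unfolding path_connected_def path_between_def by metis
  then have p: "path_between (U u) x y p" "path_between (U v) x y p"
    by (auto simp: path_between_def)
  then have pM: "path_between M x y p"
    using U_subset[OF uv(1)] path_between_mono by blast
  have au: "path_between M c x (access u x)" and av: "path_between M c x (access v x)"
    using access uv xy by auto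
  have "homotopic_paths M (access u y) (access u x +++ p)"
    using access_move[OF uv(1) p(1)] by (rule homotopic_paths_sym)
  also have "homotopic_paths M \<dots> ((g +++ access v x) +++ p)"
    by (rule homotopic_join_left[OF hom au pM])
  also have "homotopic_paths M \<dots> (g +++ (access v x +++ p))"
    by (rule homotopic_assoc[OF g av pM])
  also have "homotopic_paths M \<dots> (g +++ access v y)"
    by (rule homotopic_join_right[OF access_move[OF uv(2) p(2)] g path_between_join[OF av pM]])
  finally show ?thesis .
qed

section \<open>Loops of words\<close>

definition generator_loop :: "'v \<times> 'v \<Rightarrow> real \<Rightarrow> 'a" where
  "generator_loop = (\<lambda>(a, b). access b (crossing a b) +++ reversepath (access a (crossing a b)))"

definition letter_loop :: "bool \<times> 'v \<times> 'v \<Rightarrow> real \<Rightarrow> 'a" where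
  "letter_loop l = (if fst l then generator_loop (snd l) else reversepath (generator_loop (snd l)))"

primrec word_loop :: "(bool \<times> 'v \<times> 'v) list \<Rightarrow> real \<Rightarrow> 'a" where
  "word_loop [] = linepath c c"
| "word_loop (l # w) = letter_loop l +++ word_loop w"

lemma c_in: "c \<in> M"
  using root U_subset[of root] by blast

lemma generator_edgesD:
  assumes "(a, b) \<in> generator_edges"
  shows "a \<in> A" "b \<in> B" "crossing a b \<in> U a \<inter> U b"
  using assms crossing_in[of a b] by (auto simp: generator_edges_def)

lemma generator_loop: "s \<in> generator_edges \<Longrightarrow> path_between M c c (generator_loop s)"
proof (cases s)
  case (Pair a b)
  assume "s \<in> generator_edges"
  note ab = generator_edgesD[OF this[unfolded Pair]]
  have "path_between M c (crossing a b) (access a (crossing a b))"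
    "path_between M c (crossing a b) (access b (crossing a b))"
    using access ab by auto
  then show ?thesis
    unfolding Pair generator_loop_def prod.case by (rule path_between_join[OF _ path_between_reversepath, rotated])
qed

lemma letter_loop: "snd l \<in> generator_edges \<Longrightarrow> path_between M c c (letter_loop l)"
  by (simp add: letter_loop_def generator_loop path_between_reversepath)

lemma letter_loop_inv: "letter_loop (inv_letter l) = reversepath (letter_loop l)"
  by (simp add: letter_loop_def inv_letter_def)

lemma word_loop: "set w \<subseteq> UNIV \<times> generator_edges \<Longrightarrow> path_between M c c (word_loop w)"
  by (induction w) (auto intro!: path_between_join path_between_refl c_in letter_loop)

lemma set_cons_letter: "set (cons_letter l w) \<subseteq> insert l (set w)"
  by (cases w) (auto simp: cons_letter_def)

lemma set_foldr_cons_letter: "set (foldr cons_letter u v) \<subseteq> set u \<union> set v"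
proof (induction u)
  case (Cons l u)
  then show ?case
    using set_cons_letter[of l "foldr cons_letter u v"] by auto
qed simp

lemma word_loop_cons_letter:
  assumes "snd l \<in> generator_edges" and w: "set w \<subseteq> UNIV \<times> generator_edges"
  shows "homotopic_paths M (word_loop (cons_letter l w)) (letter_loop l +++ word_loop w)"
proof (cases "w \<noteq> [] \<and> hd w = inv_letter l")
  case True
  then obtain w' where w': "w = inv_letter l # w'"
    by (cases w) auto
  have "homotopic_paths M (word_loop w') (letter_loop l +++ (reversepath (letter_loop l) +++ word_loop w'))"
    using w w' by (intro homotopic_paths_sym[OF homotopic_cancel_inv'[OF letter_loop[OF assms(1)] word_loop]]) auto
  then show ?thesis
    by (simp add: w' cons_letter_def letter_loop_inv)
next
  case False
  then have "cons_letter l w = l # w"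
    by (auto simp: cons_letter_def)
  moreover have "path_between M c c (letter_loop l +++ word_loop w)"
    using path_between_join[OF letter_loop[OF assms(1)] word_loop[OF w]] .
  ultimately show ?thesis
    by (simp add: path_between_def)
qed

text \<open>The product in the free group reduces words, but each cancelled pair of letters is a
  loop followed by its reverse, hence contractible.\<close>

lemma word_loop_append:
  assumes u: "set u \<subseteq> UNIV \<times> generator_edges" and v: "set v \<subseteq> UNIV \<times> generator_edges"
  shows "homotopic_paths M (word_loop (foldr cons_letter u v)) (word_loop u +++ word_loop v)"
  using u
proof (induction u)
  case Nil
  then show ?case
    using homotopic_paths_sym[OF homotopic_lid[OF word_loop[OF v]]] by simp
next
  case (Cons l u)
  let ?w = "foldr cons_letter u v"
  have l: "snd l \<in> generator_edges" and u: "set u \<subseteq> UNIV \<times> generator_edges"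
    using Cons.prems by auto
  have w: "set ?w \<subseteq> UNIV \<times> generator_edges"
    using set_foldr_cons_letter[of u v] u v by blast
  have "homotopic_paths M (word_loop (foldr cons_letter (l # u) v)) (letter_loop l +++ word_loop ?w)"
    using word_loop_cons_letter[OF l w] by simp
  also have "homotopic_paths M \<dots> (letter_loop l +++ (word_loop u +++ word_loop v))"
    by (rule homotopic_join_right[OF Cons.IH[OF u] letter_loop[OF l] word_loop[OF w]])
  also have "homotopic_paths M \<dots> (word_loop (l # u) +++ word_loop v)"
    using homotopic_paths_sym[OF homotopic_assoc[OF letter_loop[OF l] word_loop[OF u] word_loop[OF v]]]
    by simp
  finally show ?case .
qed

abbreviation "F \<equiv> free_group generator_edges"

lemma carrier_F: "w \<in> carrier F \<longleftrightarrow> set w \<subseteq> UNIV \<times> generator_edges \<and> reduced_word w"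
  by (auto simp: free_group_def)

lemma one_F: "\<one>\<^bsub>F\<^esub> = []" and mult_F: "u \<otimes>\<^bsub>F\<^esub> v = foldr cons_letter u v"
  by (simp_all add: free_group_def)

lemma word_loop_F: "w \<in> carrier F \<Longrightarrow> path_between M c c (word_loop w)"
  by (simp add: word_loop carrier_F)

lemma word_loop_mult:
  "u \<in> carrier F \<Longrightarrow> v \<in> carrier F \<Longrightarrow>
     homotopic_paths M (word_loop (u \<otimes>\<^bsub>F\<^esub> v)) (word_loop u +++ word_loop v)"
  by (simp add: carrier_F mult_F word_loop_append)

text \<open>The geometric meaning of the labels. At the chosen crossing point the claim holds by
  construction of \<open>generator_loop\<close> for a generator and by \<open>access_tree\<close>
  for a tree edge; \<open>access_change\<close> moves it to any other point of the overlap.\<close>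

lemma access_weight_BA:
  assumes ab: "a \<in> A" "b \<in> B" and x: "x \<in> U a \<inter> U b"
  shows "homotopic_paths M (access b x) (word_loop (edge_label a b) +++ access a x)"
proof -
  let ?y = "crossing a b"
  have y: "?y \<in> U a \<inter> U b"
    using x crossing_in by blast
  have acc: "path_between M c ?y (access a ?y)" "path_between M c ?y (access b ?y)"
    using ab y access by auto
  have "homotopic_paths M (access b ?y) (word_loop (edge_label a b) +++ access a ?y)"
  proof (cases "(a, b) \<in> generator_edges")
    case True
    have g: "path_between M c c (generator_loop (a, b))"
      using True by (rule generator_loop)
    have "homotopic_paths M (access b ?y) (generator_loop (a, b) +++ access a ?y)"
      using homotopic_paths_sym[OF homotopic_cancel_right[OF acc(2,1)]] by (simp add: generator_loop_def)
    also have "homotopic_paths M \<dots> (word_loop [(True, (a, b))] +++ access a ?y)"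
      using g homotopic_paths_rid[of "generator_loop (a, b)" M]
      by (intro homotopic_join_left[OF _ g acc(1)]) (auto simp: letter_loop_def path_between_def homotopic_paths_sym_eq)
    finally show ?thesis
      using True by (simp add: edge_label_def)
  next
    case False
    have "homotopic_paths M (access b ?y) (access a ?y)"
    proof (cases "a \<noteq> root \<and> par a = b")
      case True
      then show ?thesis
        using access_tree[of a] ab homotopic_paths_sym by auto
    next
      case par_a: False
      then have "b \<noteq> root" "par b = a"
        using False ab x by (auto simp: generator_edges_def)
      then show ?thesis
        using access_tree[of b] ab by (auto simp: crossing_commute)
    qed
    also have "homotopic_paths M \<dots> (linepath c c +++ access a ?y)"
      by (rule homotopic_paths_sym[OF homotopic_lid[OF acc(1)]])
    finally show ?thesis
      using False by (simp add: edge_label_def)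
  qed
  moreover have "path_connected (U b \<inter> U a)"
    using path_connected_Int[OF ab] by (simp add: Int_commute)
  ultimately show ?thesis
    using access_change[of b a ?y x "word_loop (edge_label a b)"] ab x y word_loop_F wt_closed by auto
qed

text \<open>The quotient of weights is the transition function from \<open>U u\<close> to
  \<open>U v\<close>; it covers both directions of an edge and the case
  \<open>u = v\<close>.\<close>

lemma access_weight:
  assumes uv: "u \<in> A \<union> B" "v \<in> A \<union> B" and x: "x \<in> U u \<inter> U v"
  shows "homotopic_paths M (access u x) (word_loop (inv\<^bsub>F\<^esub> weight u x \<otimes>\<^bsub>F\<^esub> weight v x) +++ access v x)"
proof -
  have au: "path_between M c x (access u x)" and av: "path_between M c x (access v x)"
    using access uv x by auto
  consider "u = v" | "u \<in> B" "v \<in> A" | "u \<in> A" "v \<in> B"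
    using uv x disjoint_A[of u v] disjoint_B[of u v] by blast
  then show ?thesis
  proof cases
    case 1
    then show ?thesis
      using homotopic_paths_sym[OF homotopic_lid[OF au]] by (simp add: one_F)
  next
    case 2
    then show ?thesis
      using access_weight_BA[of v u x] x by (simp add: weight_B weight_A wt_closed)
  next
    case 3
    let ?g = "edge_label u v"
    have g: "?g \<in> carrier F"
      by (rule wt_closed)
    note wl = word_loop_F[OF g] word_loop_F[OF inv_closed[OF g]]
    have "homotopic_paths M (access u x) (linepath c c +++ access u x)"
      by (rule homotopic_paths_sym[OF homotopic_lid[OF au]])
    also have "\<dots> = word_loop (inv\<^bsub>F\<^esub> ?g \<otimes>\<^bsub>F\<^esub> ?g) +++ access u x"
      using g by (simp add: one_F)
    also have "homotopic_paths M \<dots> ((word_loop (inv\<^bsub>F\<^esub> ?g) +++ word_loop ?g) +++ access u x)"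
      using g by (intro homotopic_join_left[OF word_loop_mult word_loop_F au]) auto
    also have "homotopic_paths M \<dots> (word_loop (inv\<^bsub>F\<^esub> ?g) +++ (word_loop ?g +++ access u x))"
      by (rule homotopic_assoc[OF wl(2,1) au])
    also have "homotopic_paths M \<dots> (word_loop (inv\<^bsub>F\<^esub> ?g) +++ access v x)"
      using homotopic_paths_sym[OF access_weight_BA[OF 3 x]]
      by (rule homotopic_join_right[OF _ wl(2) path_between_join[OF wl(1) au]])
    finally show ?thesis
      using 3 x g by (simp add: weight_B weight_A)
  qed
qed

text \<open>The key step, by Lebesgue subdivision: every path is homotopic to its holonomy word, once
  access paths are added at the ends.\<close>

lemma homotopic_hol:
  assumes p: "path p" "path_image p \<subseteq> M"
    and uv: "u \<in> A \<union> B" "pathstart p \<in> U u" "v \<in> A \<union> B" "pathfinish p \<in> U v"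
  shows "homotopic_paths M (access u (pathstart p) +++ p)
    (word_loop (inv\<^bsub>F\<^esub> weight u (pathstart p) \<otimes>\<^bsub>F\<^esub> hol p \<otimes>\<^bsub>F\<^esub> weight v (pathfinish p)) +++
       access v (pathfinish p))"
proof -
  \<comment> \<open>The bounds make \<open>P\<close> vacuous for the intervals around an end point
    that leave the unit interval. \<open>P\<close> speaks of all \<open>u\<close> and
    \<open>v\<close>, so that two subpaths can be composed through any set containing the point
    where they meet.\<close>
  define P where "P s t \<longleftrightarrow> (0 \<le> s \<longrightarrow> s \<le> t \<longrightarrow> t \<le> 1 \<longrightarrow>
     (\<forall>u\<in>A \<union> B. \<forall>v\<in>A \<union> B. p s \<in> U u \<longrightarrow> p t \<in> U v \<longrightarrow>
       homotopic_paths M (access u (p s) +++ subpath s t p)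
         (word_loop (inv\<^bsub>F\<^esub> weight u (p s) \<otimes>\<^bsub>F\<^esub> hol (subpath s t p) \<otimes>\<^bsub>F\<^esub> weight v (p t)) +++ access v (p t))))"
    for s t
  have sub: "path_between M (p s) (p t) (subpath s t p)" if "s \<in> {0..1}" "t \<in> {0..1}" for s t
    using subpath_in[OF p that] .
  have hol_cl: "hol (subpath s t p) \<in> carrier F" if "s \<in> {0..1}" "t \<in> {0..1}" for s t
    using sub[OF that] by (auto simp: path_between_def)
  have "P 0 1"
  proof (rule Bolzano[where P = P], goal_cases le trans local)
    case (trans a b d)
    show ?case
      unfolding P_def
    proof (intro impI ballI)
      fix u v assume *: "0 \<le> a" "a \<le> d" "d \<le> 1" and uv: "u \<in> A \<union> B" "v \<in> A \<union> B" "p a \<in> U u" "p d \<in> U v"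
      have abd: "a \<in> {0..1}" "b \<in> {0..1}" "d \<in> {0..1}"
        using * trans(3,4) by auto
      have "p b \<in> M"
        using p(2) abd by (auto simp: path_image_def)
      then obtain z where z: "z \<in> A \<union> B" "p b \<in> U z"
        using in_cover by blast
      let ?s = "subpath a b p" and ?t = "subpath b d p"
      let ?g = "inv\<^bsub>F\<^esub> weight u (p a) \<otimes>\<^bsub>F\<^esub> hol ?s \<otimes>\<^bsub>F\<^esub> weight z (p b)"
      let ?h = "inv\<^bsub>F\<^esub> weight z (p b) \<otimes>\<^bsub>F\<^esub> hol ?t \<otimes>\<^bsub>F\<^esub> weight v (p d)"
      have 1: "homotopic_paths M (access u (p a) +++ ?s) (word_loop ?g +++ access z (p b))"
        and 2: "homotopic_paths M (access z (p b) +++ ?t) (word_loop ?h +++ access v (p d))"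
        using trans * uv z by (auto simp: P_def)
      note s = sub[OF abd(1,2)] and t = sub[OF abd(2,3)]
      have gh: "?g \<in> carrier F" "?h \<in> carrier F"
        using hol_cl abd by auto
      have au: "path_between M c (p a) (access u (p a))" and az: "path_between M c (p b) (access z (p b))"
        and av: "path_between M c (p d) (access v (p d))"
        using access uv z by auto
      note wl = word_loop_F[OF gh(1)] word_loop_F[OF gh(2)]
      have joined: "homotopic_paths M (subpath a d p) (?s +++ ?t)"
        using homotopic_join_subpaths[OF p abd] homotopic_paths_sym by blast
      have hol_ad: "hol (subpath a d p) = hol ?s \<otimes>\<^bsub>F\<^esub> hol ?t"
        using hol_homotopic[OF joined] hol_join[of ?s ?t] s t by (auto simp: path_between_def)
      have "homotopic_paths M (access u (p a) +++ subpath a d p) (access u (p a) +++ (?s +++ ?t))"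
        by (rule homotopic_join_right[OF joined au sub[OF abd(1,3)]])
      also have "homotopic_paths M \<dots> ((access u (p a) +++ ?s) +++ ?t)"
        by (rule homotopic_paths_sym[OF homotopic_assoc[OF au s t]])
      also have "homotopic_paths M \<dots> ((word_loop ?g +++ access z (p b)) +++ ?t)"
        by (rule homotopic_join_left[OF 1 path_between_join[OF au s] t])
      also have "homotopic_paths M \<dots> (word_loop ?g +++ (access z (p b) +++ ?t))"
        by (rule homotopic_assoc[OF wl(1) az t])
      also have "homotopic_paths M \<dots> (word_loop ?g +++ (word_loop ?h +++ access v (p d)))"
        by (rule homotopic_join_right[OF 2 wl(1) path_between_join[OF az t]])
      also have "homotopic_paths M \<dots> ((word_loop ?g +++ word_loop ?h) +++ access v (p d))"
        by (rule homotopic_paths_sym[OF homotopic_assoc[OF wl av]])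
      also have "homotopic_paths M \<dots> (word_loop (?g \<otimes>\<^bsub>F\<^esub> ?h) +++ access v (p d))"
        by (rule homotopic_join_left[OF homotopic_paths_sym[OF word_loop_mult[OF gh]] path_between_join[OF wl] av])
      finally have hom: "homotopic_paths M (access u (p a) +++ subpath a d p)
          (word_loop (?g \<otimes>\<^bsub>F\<^esub> ?h) +++ access v (p d))" .
      \<comment> \<open>The weights of the intermediate set \<open>z\<close> at the dividing point
        cancel.\<close>
      have "x \<otimes>\<^bsub>F\<^esub> (inv\<^bsub>F\<^esub> x \<otimes>\<^bsub>F\<^esub> y) = y" if "x \<in> carrier F" "y \<in> carrier F" for x y
        using that by (simp flip: m_assoc)
      then have "?g \<otimes>\<^bsub>F\<^esub> ?h = inv\<^bsub>F\<^esub> weight u (p a) \<otimes>\<^bsub>F\<^esub> hol (subpath a d p) \<otimes>\<^bsub>F\<^esub> weight v (p d)"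
        using hol_cl[OF abd(1,2)] hol_cl[OF abd(2,3)] by (simp add: hol_ad m_assoc)
      with hom show "homotopic_paths M (access u (p a) +++ subpath a d p)
          (word_loop (inv\<^bsub>F\<^esub> weight u (p a) \<otimes>\<^bsub>F\<^esub> hol (subpath a d p) \<otimes>\<^bsub>F\<^esub> weight v (p d)) +++ access v (p d))"
        by (simp only:)
    qed
  next
    case (local x)
    then have "p x \<in> M"
      using p(2) by (auto simp: path_image_def)
    then obtain z where z: "z \<in> A \<union> B" "p x \<in> U z"
      using in_cover by blast
    have "openin (top_of_set {0..1}) ({0..1} \<inter> p -` U z)"
      using continuous_openin_preimage[of "{0..1}" p M] openin_U[OF z(1)] p by (auto simp: path_def path_image_def)
    then obtain W where W: "open W" "{0..1} \<inter> p -` U z = {0..1} \<inter> W"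
      by (auto simp: openin_open)
    moreover have "x \<in> {0..1} \<inter> p -` U z"
      using z local by simp
    then have "x \<in> W"
      using W(2) by blast
    ultimately obtain d where d: "d > 0" "ball x d \<subseteq> W"
      using openE by blast
    have "P a b" if ab: "a \<le> x" "x \<le> b" "b - a < d" for a b
      unfolding P_def
    proof (intro impI ballI)
      fix u v assume *: "0 \<le> a" "a \<le> b" "b \<le> 1" and uv: "u \<in> A \<union> B" "v \<in> A \<union> B" "p a \<in> U u" "p b \<in> U v"
      have "{a..b} \<subseteq> {0..1} \<inter> W"
        using * ab d by (auto simp: dist_real_def subset_iff)
      then have im: "p ` {a..b} \<subseteq> U z"
        using W by blast
      then have "p a \<in> U z" "p b \<in> U z"
        using * by auto
      let ?s = "subpath a b p"
      have s: "path_between (U z) (p a) (p b) ?s"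
        using * im p(1) by (auto simp: path_between_def path_image_subpath)
      have sM: "path_between M (p a) (p b) ?s"
        using sub * by auto
      have au: "path_between M c (p a) (access u (p a))" and az: "path_between M c (p a) (access z (p a))"
         "path_between M c (p b) (access z (p b))"
        and av: "path_between M c (p b) (access v (p b))"
        using access uv z \<open>p a \<in> U z\<close> \<open>p b \<in> U z\<close> by auto
      let ?g = "inv\<^bsub>F\<^esub> weight u (p a) \<otimes>\<^bsub>F\<^esub> weight z (p a)"
      let ?h = "inv\<^bsub>F\<^esub> weight z (p b) \<otimes>\<^bsub>F\<^esub> weight v (p b)"
      have gh: "?g \<in> carrier F" "?h \<in> carrier F"
        by auto
      note wl = word_loop_F[OF gh(1)] word_loop_F[OF gh(2)]
      have 1: "homotopic_paths M (access u (p a)) (word_loop ?g +++ access z (p a))"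
        using access_weight[OF uv(1) z(1)] uv \<open>p a \<in> U z\<close> by simp
      have 2: "homotopic_paths M (access z (p b)) (word_loop ?h +++ access v (p b))"
        using access_weight[OF z(1) uv(2)] uv \<open>p b \<in> U z\<close> by simp
      have "homotopic_paths M (access u (p a) +++ ?s) ((word_loop ?g +++ access z (p a)) +++ ?s)"
        by (rule homotopic_join_left[OF 1 au sM])
      also have "homotopic_paths M \<dots> (word_loop ?g +++ (access z (p a) +++ ?s))"
        by (rule homotopic_assoc[OF wl(1) az(1) sM])
      also have "homotopic_paths M \<dots> (word_loop ?g +++ access z (p b))"
        by (rule homotopic_join_right[OF access_move[OF z(1) s] wl(1) path_between_join[OF az(1) sM]])
      also have "homotopic_paths M \<dots> (word_loop ?g +++ (word_loop ?h +++ access v (p b)))"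
        by (rule homotopic_join_right[OF 2 wl(1) az(2)])
      also have "homotopic_paths M \<dots> ((word_loop ?g +++ word_loop ?h) +++ access v (p b))"
        by (rule homotopic_paths_sym[OF homotopic_assoc[OF wl av]])
      also have "homotopic_paths M \<dots> (word_loop (?g \<otimes>\<^bsub>F\<^esub> ?h) +++ access v (p b))"
        by (rule homotopic_join_left[OF homotopic_paths_sym[OF word_loop_mult[OF gh]] path_between_join[OF wl] av])
      finally have hom: "homotopic_paths M (access u (p a) +++ ?s)
          (word_loop (?g \<otimes>\<^bsub>F\<^esub> ?h) +++ access v (p b))" .
      have "?g \<otimes>\<^bsub>F\<^esub> ?h = inv\<^bsub>F\<^esub> weight u (p a) \<otimes>\<^bsub>F\<^esub> hol ?s \<otimes>\<^bsub>F\<^esub> weight v (p b)"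
        using hol_local[OF z(1), of ?s] s by (auto simp: m_assoc path_between_def)
      with hom show "homotopic_paths M (access u (p a) +++ ?s)
          (word_loop (inv\<^bsub>F\<^esub> weight u (p a) \<otimes>\<^bsub>F\<^esub> hol ?s \<otimes>\<^bsub>F\<^esub> weight v (p b)) +++ access v (p b))"
        by (simp only:)
    qed
    then show ?case
      using d(1) by blast
  qed simp
  then show ?thesis
    using uv by (simp add: P_def pathstart_def pathfinish_def)
qed

section \<open>Holonomy of the standard paths and loops\<close>

lemma hol_tree_path:
  assumes "v \<in> A \<union> B"
  shows "hol (tree_path v) = inv\<^bsub>F\<^esub> weight v (centre v)"
  using assms
proof (induction v rule: tree_induct)
  case base
  then show ?case
    using root hol_local[of root "linepath c c"] by (auto simp add: tree_path_root weight_B)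
next
  case (step v)
  let ?u = "par v" and ?x = "crossing v (par v)"
  have u: "?u \<in> A \<union> B"
    using par[OF step(1,2)] .
  have x: "?x \<in> U v" "?x \<in> U ?u"
    using crossing_in[OF par_meet[OF step(1,2)]] by auto
  have "?u \<noteq> v"
    using rank_par[OF step(1,2)] by auto
  then consider "v \<in> A" "?u \<in> B" | "v \<in> B" "?u \<in> A"
    using x u step(1) disjoint_A[of v ?u] disjoint_B[of v ?u] by auto
  \<comment> \<open>A tree edge is labelled by the identity. So a lift that starts with coordinate
    one over the root has coordinate one over every set along the tree, and the inverse weight is
    its value \<open>f\<close> at the end.\<close>
  then have same: "weight ?u ?x = weight v ?x"
  proof cases
    case 1
    then have "edge_label v ?u = []"
      using step(2) by (auto simp: edge_label_def generator_edges_def)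
    then show ?thesis
      using 1 x by (simp add: weight_A weight_B one_F)
  next
    case 2
    then have "edge_label ?u v = []"
      using step(2) by (auto simp: edge_label_def generator_edges_def)
    then show ?thesis
      using 2 x by (simp add: weight_A weight_B one_F)
  qed
  note t = tree_path[OF u]
  note lu = local_path[OF u x(2)] and lv = local_path[OF step(1) x(1)]
  note luM = local_path_M[OF u x(2)] and lvM = local_path_M[OF step(1) x(1)]
  have holu: "hol (local_path ?u ?x) = weight ?u (centre ?u) \<otimes>\<^bsub>F\<^esub> inv\<^bsub>F\<^esub> weight ?u ?x"
    using hol_local[OF u, of "local_path ?u ?x"] lu by (auto simp: path_between_def)
  have holv: "hol (local_path v ?x) = weight v (centre v) \<otimes>\<^bsub>F\<^esub> inv\<^bsub>F\<^esub> weight v ?x"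
    using hol_local[OF step(1), of "local_path v ?x"] lv by (auto simp: path_between_def)
  have "hol (tree_path v) = hol (tree_path ?u +++ (local_path ?u ?x +++ reversepath (local_path v ?x)))"
    by (simp only: tree_path_step[OF step(1,2)])
  also have "\<dots> = hol (tree_path ?u) \<otimes>\<^bsub>F\<^esub> hol (local_path ?u ?x +++ reversepath (local_path v ?x))"
    using t path_between_join[OF luM path_between_reversepath[OF lvM]]
    by (intro hol_join) (auto simp: path_between_def)
  also have "hol (local_path ?u ?x +++ reversepath (local_path v ?x)) =
      hol (local_path ?u ?x) \<otimes>\<^bsub>F\<^esub> hol (reversepath (local_path v ?x))"
    using luM path_between_reversepath[OF lvM] by (intro hol_join) (auto simp: path_between_def)
  also have "hol (reversepath (local_path v ?x)) = inv\<^bsub>F\<^esub> hol (local_path v ?x)"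
    using lvM by (intro hol_reversepath) (auto simp: path_between_def)
  finally have *: "hol (tree_path v) = hol (tree_path ?u) \<otimes>\<^bsub>F\<^esub>
      (hol (local_path ?u ?x) \<otimes>\<^bsub>F\<^esub> inv\<^bsub>F\<^esub> hol (local_path v ?x))" .
  have cancel: "inv\<^bsub>F\<^esub> x \<otimes>\<^bsub>F\<^esub> (x \<otimes>\<^bsub>F\<^esub> y) = y" if "x \<in> carrier F" "y \<in> carrier F" for x y
    using that by (simp flip: m_assoc)
  show ?case
    unfolding * step(3) holu holv same by (simp add: m_assoc inv_mult_group cancel)
qed

lemma hol_access:
  assumes v: "v \<in> A \<union> B" and x: "x \<in> U v"
  shows "hol (access v x) = inv\<^bsub>F\<^esub> weight v x"
proof -
  have "hol (access v x) = hol (tree_path v) \<otimes>\<^bsub>F\<^esub> hol (local_path v x)"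
    using tree_path[OF v] local_path_M[OF v x] unfolding access_def
    by (intro hol_join) (auto simp: path_between_def)
  also have "hol (local_path v x) = weight v (centre v) \<otimes>\<^bsub>F\<^esub> inv\<^bsub>F\<^esub> weight v x"
    using hol_local[OF v, of "local_path v x"] local_path[OF v x] by (auto simp: path_between_def)
  finally show ?thesis
    by (simp add: hol_tree_path[OF v] flip: m_assoc)
qed

lemma hol_generator_loop:
  assumes "s \<in> generator_edges"
  shows "hol (generator_loop s) = [(True, s)]"
proof -
  obtain a b where s: "s = (a, b)"
    by (cases s)
  note ab = generator_edgesD[OF assms[unfolded s]]
  let ?x = "crossing a b"
  have acc: "path_between M c ?x (access a ?x)" "path_between M c ?x (access b ?x)"
    using access ab by auto
  have "hol (generator_loop s) = hol (access b ?x) \<otimes>\<^bsub>F\<^esub> hol (reversepath (access a ?x))"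
    using acc path_between_reversepath[OF acc(1)] unfolding s generator_loop_def prod.case
    by (intro hol_join) (auto simp: path_between_def)
  also have "hol (reversepath (access a ?x)) = inv\<^bsub>F\<^esub> hol (access a ?x)"
    using acc by (intro hol_reversepath) (auto simp: path_between_def)
  \<comment> \<open>Leaving through the \<open>B\<close>-set and returning through the
    \<open>A\<close>-set gives the label itself; the opposite orientation would give its
    inverse.\<close>
  also have "hol (access b ?x) \<otimes>\<^bsub>F\<^esub> \<dots> = edge_label a b"
    using ab hol_access[of a ?x] hol_access[of b ?x] wt_closed by (simp add: weight_A weight_B)
  also have "edge_label a b = [(True, s)]"
    using assms by (simp add: edge_label_def s)
  finally show ?thesis .
qed

lemma hol_letter_loop:
  assumes "snd l \<in> generator_edges"
  shows "hol (letter_loop l) = [l]"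
proof (cases "fst l")
  case True
  then show ?thesis
    using assms hol_generator_loop[of "snd l"] by (cases l) (simp add: letter_loop_def)
next
  case False
  have "[(False, snd l)] \<otimes>\<^bsub>F\<^esub> [(True, snd l)] = \<one>\<^bsub>F\<^esub>"
    by (simp add: mult_F one_F cons_letter_def inv_letter_def)
  moreover have "[(False, snd l)] \<in> carrier F" "[(True, snd l)] \<in> carrier F"
    using assms by (cases l; auto simp: carrier_F reduced_Cons)+
  ultimately have "inv\<^bsub>F\<^esub> [(True, snd l)] = [(False, snd l)]"
    by (intro inv_equality)
  then show ?thesis
    using False assms generator_loop[OF assms] hol_reversepath[of "generator_loop (snd l)"]
      hol_generator_loop[of "snd l"]
    by (cases l) (auto simp: letter_loop_def path_between_def)
qed

text \<open>This is the freeness of the generators: a reduced word can be read off from its loop. In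
  a reduced word the first letter does not cancel against the rest, so the product just prepends
  it.\<close>

lemma hol_word_loop:
  assumes "w \<in> carrier F"
  shows "hol (word_loop w) = w"
  using assms
proof (induction w)
  case Nil
  then show ?case
    using hol_local[of root "linepath c c"] root by (simp add: weight_B one_F)
next
  case (Cons l w)
  then have w: "w \<in> carrier F" and l: "snd l \<in> generator_edges"
    by (auto simp: carrier_F reduced_Cons)
  have "hol (word_loop (l # w)) = hol (letter_loop l) \<otimes>\<^bsub>F\<^esub> hol (word_loop w)"
    using letter_loop[OF l] word_loop_F[OF w] by (simp add: path_between_def hol_join)
  then show ?case
    using Cons w l by (auto simp: hol_letter_loop mult_F cons_letter_def carrier_F reduced_Cons)
qed

text \<open>As the root is in \<open>B\<close>, the weights at \<open>c\<close> are one, and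
  \<open>homotopic_hol\<close> expresses a loop by its holonomy word up to conjugation by one fixed
  access loop, which cancels.\<close>

lemma hol_eq_iff_homotopic:
  assumes p: "path_between M c c p" and q: "path_between M c c q"
  shows "hol p = hol q \<longleftrightarrow> homotopic_paths M p q"
proof
  assume eq: "hol p = hol q"
  let ?a = "access root c"
  have a: "path_between M c c ?a"
    using access[of root c] root by auto
  have loop: "homotopic_paths M (?a +++ r) (word_loop (hol r) +++ ?a)" if "path_between M c c r" for r
    using homotopic_hol[of r root root] that root by (auto simp: path_between_def weight_B)
  have "homotopic_paths M p (reversepath ?a +++ (?a +++ p))"
    by (rule homotopic_paths_sym[OF homotopic_cancel_inv[OF a p]])
  also have "homotopic_paths M \<dots> (reversepath ?a +++ (word_loop (hol p) +++ ?a))"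
    by (rule homotopic_join_right[OF loop[OF p] path_between_reversepath[OF a] path_between_join[OF a p]])
  also have "homotopic_paths M \<dots> (reversepath ?a +++ (?a +++ q))"
    unfolding eq
    by (rule homotopic_join_right[OF homotopic_paths_sym[OF loop[OF q]] path_between_reversepath[OF a]
          path_between_homotopic[OF loop[OF q] path_between_join[OF a q]]])
  also have "homotopic_paths M \<dots> q"
    by (rule homotopic_cancel_inv[OF a q])
  finally show "homotopic_paths M p q" .
qed (rule hol_homotopic)

end

section \<open>The fundamental group of the cover\<close>

text \<open>The fundamental group is so far only a record. Its group laws are inherited from the
  free group through the bijection, instead of being derived from reparametrisations of
  loops.\<close>

lemma group_transfer:
  fixes G :: "('g, 'x) monoid_scheme" and K :: "('h, 'y) monoid_scheme"
  assumes K: "group K" and bij: "bij_betw h (carrier G) (carrier K)"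
    and closed: "\<And>x y. x \<in> carrier G \<Longrightarrow> y \<in> carrier G \<Longrightarrow> x \<otimes>\<^bsub>G\<^esub> y \<in> carrier G"
    and mult: "\<And>x y. x \<in> carrier G \<Longrightarrow> y \<in> carrier G \<Longrightarrow> h (x \<otimes>\<^bsub>G\<^esub> y) = h x \<otimes>\<^bsub>K\<^esub> h y"
    and one: "\<one>\<^bsub>G\<^esub> \<in> carrier G" "h \<one>\<^bsub>G\<^esub> = \<one>\<^bsub>K\<^esub>"
  shows "group G" "G \<cong> K"
proof -
  interpret K: group K by fact
  have inj: "x = y" if "h x = h y" "x \<in> carrier G" "y \<in> carrier G" for x y
    using bij that by (auto simp: bij_betw_def inj_on_def)
  have h: "h x \<in> carrier K" if "x \<in> carrier G" for x
    using bij that by (auto simp: bij_betw_def)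
  show "group G"
  proof (rule groupI)
    fix x y z assume "x \<in> carrier G" "y \<in> carrier G" "z \<in> carrier G"
    then show "x \<otimes>\<^bsub>G\<^esub> y \<otimes>\<^bsub>G\<^esub> z = x \<otimes>\<^bsub>G\<^esub> (y \<otimes>\<^bsub>G\<^esub> z)"
      by (intro inj) (auto simp: mult closed h K.m_assoc)
  next
    fix x assume x: "x \<in> carrier G"
    then show "\<one>\<^bsub>G\<^esub> \<otimes>\<^bsub>G\<^esub> x = x"
      by (intro inj) (auto simp: mult one closed h)
    have "inv\<^bsub>K\<^esub> h x \<in> h ` carrier G"
      using h[OF x] bij by (simp add: bij_betw_def)
    then obtain y where "y \<in> carrier G" "h y = inv\<^bsub>K\<^esub> h x"
      by auto
    then show "\<exists>y\<in>carrier G. y \<otimes>\<^bsub>G\<^esub> x = \<one>\<^bsub>G\<^esub>"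
      using x by (intro bexI[of _ y] inj) (auto simp: mult one closed h)
  qed (use closed one in auto)
  have "h \<in> iso G K"
    using bij h by (auto simp: iso_def hom_def mult)
  then show "G \<cong> K"
    by (auto simp: is_iso_def)
qed

section \<open>Renaming the generators of a free group\<close>

lemma cons_letter_map:
  assumes "inj_on f S" "snd l \<in> S" "set w \<subseteq> UNIV \<times> S"
  shows "cons_letter (apsnd f l) (map (apsnd f) w) = map (apsnd f) (cons_letter l w)"
proof (cases w)
  case (Cons m w')
  have "snd m \<in> S"
    using assms(3) Cons by auto
  then have "apsnd f m = inv_letter (apsnd f l) \<longleftrightarrow> m = inv_letter l"
    using inj_onD[OF assms(1), of "snd m" "snd l"] assms(2)
    by (cases m; cases l) (auto simp: inv_letter_def)
  then show ?thesis
    by (simp add: Cons cons_letter_def)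
qed (simp add: cons_letter_def)

lemma reduced_word_map:
  assumes "inj_on f S" "set w \<subseteq> UNIV \<times> S"
  shows "reduced_word (map (apsnd f) w) \<longleftrightarrow> reduced_word w"
  using assms(2)
proof (induction w)
  case (Cons l w)
  have "apsnd f (hd w) = inv_letter (apsnd f l) \<longleftrightarrow> hd w = inv_letter l" if "w \<noteq> []"
  proof -
    have "hd w \<in> UNIV \<times> S" "l \<in> UNIV \<times> S"
      using subsetD[OF Cons.prems, of "hd w"] subsetD[OF Cons.prems, of l] hd_in_set[OF that] by simp_all
    then show ?thesis
      using inj_onD[OF assms(1), of "snd (hd w)" "snd l"]
      by (cases "hd w"; cases l) (auto simp: inv_letter_def)
  qed
  then show ?case
    using Cons by (cases "w = []") (auto simp: reduced_Cons hd_map)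
qed simp

text \<open>An injective renaming neither creates nor destroys cancellations, so it commutes with
  the reducing product and preserves reduced words.\<close>

lemma free_group_iso:
  assumes "bij_betw f S T"
  shows "free_group S \<cong> free_group T"
proof -
  have inj: "inj_on f S" and im: "f ` S = T"
    using assms by (auto simp: bij_betw_def)
  let ?f = "map (apsnd f)"
  have fold: "foldr cons_letter (?f u) (?f v) = ?f (foldr cons_letter u v) \<and>
      set (foldr cons_letter u v) \<subseteq> UNIV \<times> S"
    if "set u \<subseteq> UNIV \<times> S" "set v \<subseteq> UNIV \<times> S" for u v :: "(bool \<times> 'a) list"
    using that(1)
  proof (induction u)
    case (Cons l u)
    let ?w = "foldr cons_letter u v"
    have IH: "foldr cons_letter (?f u) (?f v) = ?f ?w" and w: "set ?w \<subseteq> UNIV \<times> S" and l: "snd l \<in> S"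
      using Cons by auto
    have "set (cons_letter l ?w) \<subseteq> insert l (set ?w)"
      by (cases ?w) (auto simp: cons_letter_def)
    then have "set (cons_letter l ?w) \<subseteq> UNIV \<times> S"
      using w Cons.prems by auto
    then show ?case
      using cons_letter_map[OF inj l w] IH by simp
  qed (use that(2) in auto)
  have "set (?f u) \<subseteq> UNIV \<times> T" if "set u \<subseteq> UNIV \<times> S" for u :: "(bool \<times> 'a) list"
    using that im by fastforce
  then have "?f \<in> hom (free_group S) (free_group T)"
    using fold by (simp add: hom_def free_group_def reduced_word_map[OF inj] Pi_def)
  moreover have "inj_on ?f (carrier (free_group S))"
  proof (rule inj_onI)
    fix u v assume uv: "u \<in> carrier (free_group S)" "v \<in> carrier (free_group S)" "?f u = ?f v"
    have "inj_on (apsnd f) (set u \<union> set v)"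
      using uv inj by (auto simp: free_group_def inj_on_def subset_iff)
    then show "u = v"
      by (rule map_inj_on[OF uv(3)])
  qed
  moreover have "carrier (free_group T) \<subseteq> ?f ` carrier (free_group S)"
  proof
    fix w assume "w \<in> carrier (free_group T)"
    then have w: "set w \<subseteq> UNIV \<times> T" "reduced_word w"
      by (auto simp: free_group_def)
    let ?u = "map (apsnd (the_inv_into S f)) w"
    have "apsnd f (apsnd (the_inv_into S f) x) = x" if "x \<in> set w" for x
      using that w f_the_inv_into_f[OF inj] im by (cases x) auto
    then have fu: "?f ?u = w"
      by (simp add: map_idI)
    have u: "set ?u \<subseteq> UNIV \<times> S"
      using w im the_inv_into_into[OF inj] by auto
    then have "reduced_word ?u"
      using reduced_word_map[OF inj u] fu w(2) by simp
    then show "w \<in> ?f ` carrier (free_group S)"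
      using fu u by (intro image_eqI[of _ _ ?u]) (auto simp: free_group_def)
  qed
  ultimately have "?f \<in> iso (free_group S) (free_group T)"
    by (auto simp: iso_def bij_betw_def hom_def Pi_def)
  then show ?thesis
    by (auto simp: is_iso_def)
qed

context rooted_cover
begin

text \<open>Every vertex but the root owns the edge to its parent. Two vertices owning the same edge
  would be parents of each other, against \<open>rank\<close>; so the tree has
  \<open>card A + card B - 1\<close> edges.\<close>

lemma card_generator_edges:
  assumes fin: "finite A" "finite B"
  shows "finite generator_edges"
    and "card generator_edges + card A + card B = card {(a, b) \<in> A \<times> B. U a \<inter> U b \<noteq> {}} + 1"
proof -
  let ?E = "{(a, b) \<in> A \<times> B. U a \<inter> U b \<noteq> {}}"
  let ?V = "A \<union> B - {root}"
  define edge where "edge v = (if v \<in> A then (v, par v) else (par v, v))" for v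
  have finE: "finite ?E"
    by (rule finite_subset[of _ "A \<times> B"]) (use fin in auto)
  \<comment> \<open>A vertex meets its parent but is different from it, so disjointness within the
    families puts the parent on the other side.\<close>
  have sides: "(v \<in> A \<and> v \<notin> B \<and> par v \<in> B \<and> par v \<notin> A) \<or> (v \<in> B \<and> v \<notin> A \<and> par v \<in> A \<and> par v \<notin> B)"
    if "v \<in> ?V" for v
    using that par[of v] par_meet[of v] rank_par[of v] disjoint_A[of v "par v"] disjoint_B[of v "par v"]
      disjoint_index by (cases "v = par v") auto
  have "inj_on edge ?V"
  proof (rule inj_onI)
    fix u v assume uv: "u \<in> ?V" "v \<in> ?V" "edge u = edge v"
    show "u = v"
    proof (rule ccontr)
      assume "u \<noteq> v"
      then have "par u = v" "par v = u"
        using uv(3) by (auto simp: edge_def split: if_splits)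
      then show False
        using rank_par[of u] rank_par[of v] uv by auto
    qed
  qed
  then have card_edge: "card (edge ` ?V) = card ?V"
    by (rule card_image)
  have edge_image: "edge ` ?V = ?E - generator_edges"
  proof
    show "edge ` ?V \<subseteq> ?E - generator_edges"
    proof
      fix e assume "e \<in> edge ` ?V"
      then obtain v where v: "v \<in> ?V" "e = edge v"
        by auto
      have "U v \<inter> U (par v) \<noteq> {}" "U (par v) \<inter> U v \<noteq> {}"
        using par_meet[of v] v by auto
      then show "e \<in> ?E - generator_edges"
        using sides[OF v(1)] v by (auto simp: edge_def generator_edges_def)
    qed
    show "?E - generator_edges \<subseteq> edge ` ?V"
    proof
      fix e assume "e \<in> ?E - generator_edges"
      then obtain a b where e: "e = (a, b)" "a \<in> A" "b \<in> B" 
        and or: "(a \<noteq> root \<and> par a = b) \<or> (b \<noteq> root \<and> par b = a)"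
        by (auto simp: generator_edges_def)
      from or show "e \<in> edge ` ?V"
      proof
        assume "a \<noteq> root \<and> par a = b"
        then show ?thesis
          using e by (intro image_eqI[of _ _ a]) (auto simp: edge_def)
      next
        assume "b \<noteq> root \<and> par b = a"
        then show ?thesis
          using e disjoint_index by (intro image_eqI[of _ _ b]) (auto simp: edge_def)
      qed
    qed
  qed
  have sub: "generator_edges \<subseteq> ?E"
    by (auto simp: generator_edges_def)
  then show "finite generator_edges"
    using finE by (rule finite_subset)
  then have "card ?V = card ?E - card generator_edges" "card generator_edges \<le> card ?E"
    using sub finE card_edge edge_image by (auto simp: card_Diff_subset card_mono)
  moreover have "card ?V + 1 = card A + card B"
  proof -
    have "card ?V + 1 = card (A \<union> B)"
      using fin root by (metis Suc_eq_plus1 UnI2 card_Suc_Diff1 finite_UnI)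
    then show ?thesis
      using card_Un_disjoint[OF fin disjoint_index] by simp
  qed
  ultimately show "card generator_edges + card A + card B = card ?E + 1"
    by linarith
qed

section \<open>Transfer along a homeomorphism\<close>

context
  fixes X :: "'x topology" and f :: "'x \<Rightarrow> 'a" and g :: "'a \<Rightarrow> 'x" and x0 :: 'x
  assumes fg: "homeomorphic_maps X (top_of_set M) f g" and x0: "x0 \<in> topspace X" "f x0 = c"
begin

lemma f_cont: "continuous_map X (top_of_set M) f" and g_cont: "continuous_map (top_of_set M) X g"
  and gf: "x \<in> topspace X \<Longrightarrow> g (f x) = x" and fg': "y \<in> M \<Longrightarrow> f (g y) = y"
  using fg by (auto simp: homeomorphic_maps_def)

lemma loop_image: "p \<in> loops X x0 \<Longrightarrow> path_between M c c (f \<circ> p)"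
proof -
  assume p: "p \<in> loops X x0"
  then have "continuous_map (top_of_set {0..1}) X p"
    by (simp add: loops_def pathin_def)
  then have "continuous_map (top_of_set {0..1}) (top_of_set M) (f \<circ> p)"
    by (rule continuous_map_compose[OF _ f_cont])
  then show ?thesis
    using p x0(2) by (auto simp: path_between_def path_def path_image_def loops_def pathstart_def pathfinish_def)
qed

lemma loop_preimage:
  assumes "path_between M c c q"
  shows "g \<circ> q \<in> loops X x0"
proof -
  have "continuous_map (top_of_set {0..1}) (top_of_set M) q"
    using assms by (auto simp: path_between_def path_def path_image_def)
  then have "continuous_map (top_of_set {0..1}) X (g \<circ> q)"
    using g_cont continuous_map_compose by blast
  then show ?thesis
    using assms gf[OF x0(1)] x0(2)
    by (auto simp: loops_def pathin_def path_between_def pathstart_def pathfinish_def)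
qed

lemma loop_topspace: "p \<in> loops X x0 \<Longrightarrow> t \<in> {0..1} \<Longrightarrow> p t \<in> topspace X"
  by (auto simp: loops_def pathin_def continuous_map_def Pi_iff)

lemma homotopic_loops_at_iff:
  assumes p: "p \<in> loops X x0" and q: "q \<in> loops X x0"
  shows "homotopic_loops_at X x0 p q \<longleftrightarrow> homotopic_paths M (f \<circ> p) (f \<circ> q)"
proof
  assume "homotopic_loops_at X x0 p q"
  then show "homotopic_paths M (f \<circ> p) (f \<circ> q)"
    unfolding homotopic_loops_at_def homotopic_paths_def
    using p x0(2) by (elim homotopic_with_compose_continuous_map_left[OF _ f_cont])
      (auto simp: pathstart_def pathfinish_def loops_def)
next
  assume *: "homotopic_paths M (f \<circ> p) (f \<circ> q)"
  have "homotopic_with (\<lambda>r. r 0 = x0 \<and> r 1 = x0) (top_of_set {0..1}) X (g \<circ> (f \<circ> p)) (g \<circ> (f \<circ> q))"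
    using p gf[OF x0(1)]
    by (intro homotopic_with_compose_continuous_map_left[OF *[unfolded homotopic_paths_def] g_cont])
      (auto simp: pathstart_def pathfinish_def loops_def)
  then show "homotopic_loops_at X x0 p q"
    unfolding homotopic_loops_at_def
    by (rule homotopic_with_eq) (use gf loop_topspace[OF p] loop_topspace[OF q] in auto)
qed

lemma homotopic_loops_at_imp_loops:
  assumes "homotopic_loops_at X x0 p q"
  shows "q \<in> loops X x0"
  using homotopic_with_imp_continuous_maps[OF assms[unfolded homotopic_loops_at_def]]
    homotopic_with_imp_property[OF assms[unfolded homotopic_loops_at_def]]
  by (simp add: loops_def pathin_def)

lemma mem_loop_class:
  "p \<in> loops X x0 \<Longrightarrow>
     q \<in> loop_class X x0 p \<longleftrightarrow> q \<in> loops X x0 \<and> homotopic_paths M (f \<circ> p) (f \<circ> q)"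
  unfolding loop_class_def mem_Collect_eq using homotopic_loops_at_imp_loops homotopic_loops_at_iff by blast

lemma loop_class_eq_iff:
  assumes p: "p \<in> loops X x0" and q: "q \<in> loops X x0"
  shows "loop_class X x0 p = loop_class X x0 q \<longleftrightarrow> hol (f \<circ> p) = hol (f \<circ> q)"
  unfolding hol_eq_iff_homotopic[OF loop_image[OF p] loop_image[OF q]]
proof
  assume "loop_class X x0 p = loop_class X x0 q"
  moreover have "q \<in> loop_class X x0 q"
    using mem_loop_class[OF q] q loop_image[OF q] by (auto simp: path_between_def)
  ultimately show "homotopic_paths M (f \<circ> p) (f \<circ> q)"
    using mem_loop_class[OF p] by auto
next
  assume *: "homotopic_paths M (f \<circ> p) (f \<circ> q)"
  show "loop_class X x0 p = loop_class X x0 q"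
  proof (intro equalityI subsetI)
    fix r assume "r \<in> loop_class X x0 p"
    then show "r \<in> loop_class X x0 q"
      using homotopic_paths_trans[OF homotopic_paths_sym[OF *]] mem_loop_class[OF p] mem_loop_class[OF q] by simp
  next
    fix r assume "r \<in> loop_class X x0 q"
    then show "r \<in> loop_class X x0 p"
      using homotopic_paths_trans[OF *] mem_loop_class[OF p] mem_loop_class[OF q] by simp
  qed
qed

lemma join_loops_image: "f \<circ> join_loops p q = (f \<circ> p) +++ (f \<circ> q)"
  by (auto simp: join_loops_def joinpaths_def)

lemma join_loops:
  assumes p: "p \<in> loops X x0" and q: "q \<in> loops X x0"
  shows "join_loops p q \<in> loops X x0"
proof -
  have "g \<circ> (f \<circ> join_loops p q) \<in> loops X x0"
    unfolding join_loops_image by (rule loop_preimage[OF path_between_join[OF loop_image[OF p] loop_image[OF q]]])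
  \<comment> \<open>Loops are arbitrary outside the unit interval, where their values may leave the
    space and \<open>g\<close> need not undo \<open>f\<close>.\<close>
  moreover have "(g \<circ> (f \<circ> join_loops p q)) t = join_loops p q t" if "t \<in> {0..1}" for t
    using that loop_topspace[OF p, of "2 * t"] loop_topspace[OF q, of "2 * t - 1"] gf
    by (auto simp: join_loops_def)
  ultimately show ?thesis
    using continuous_map_eq[of "top_of_set {0..1}" X "g \<circ> (f \<circ> join_loops p q)" "join_loops p q"]
    by (auto simp: loops_def pathin_def)
qed

text \<open>The product is a union over all representatives; it is a single class because homotopic
  factors have homotopic joins.\<close>

lemma loop_class_mult:
  assumes p: "p \<in> loops X x0" and q: "q \<in> loops X x0"
  shows "loop_class X x0 p \<otimes>\<^bsub>fundamental_group X x0\<^esub> loop_class X x0 q = loop_class X x0 (join_loops p q)"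
proof -
  have "loop_class X x0 (join_loops p' q') = loop_class X x0 (join_loops p q)"
    if "p' \<in> loop_class X x0 p" "q' \<in> loop_class X x0 q" for p' q'
  proof -
    have pq': "p' \<in> loops X x0" "q' \<in> loops X x0" "homotopic_paths M (f \<circ> p) (f \<circ> p')"
      "homotopic_paths M (f \<circ> q) (f \<circ> q')"
      using that mem_loop_class[OF p] mem_loop_class[OF q] by simp_all
    have "homotopic_paths M (f \<circ> join_loops p q) (f \<circ> join_loops p' q')"
      unfolding join_loops_image
      by (rule homotopic_join[OF pq'(3,4) loop_image[OF p] loop_image[OF q]])
    then have "hol (f \<circ> join_loops p q) = hol (f \<circ> join_loops p' q')"
      by (rule hol_homotopic)
    then show ?thesis
      using loop_class_eq_iff join_loops p q pq'(1,2) by metis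
  qed
  moreover have "p \<in> loop_class X x0 p"
    using mem_loop_class[OF p] p loop_image[OF p] by (simp add: path_between_def)
  moreover have "q \<in> loop_class X x0 q"
    using mem_loop_class[OF q] q loop_image[OF q] by (simp add: path_between_def)
  ultimately have "(\<Union>p'\<in>loop_class X x0 p. \<Union>q'\<in>loop_class X x0 q. loop_class X x0 (join_loops p' q')) =
      loop_class X x0 (join_loops p q)"
    by blast
  then show ?thesis
    by (simp add: fundamental_group_def)
qed

text \<open>The isomorphism is induced by \<open>hol\<close>: it is injective on classes because
  holonomy determines a loop up to homotopy, and the loops of reduced words make it
  surjective.\<close>

lemma fundamental_group_iso_free:
  "group (fundamental_group X x0)" "fundamental_group X x0 \<cong> F"
proof -
  let ?G = "fundamental_group X x0"
  define h where "h C = hol (f \<circ> (SOME p. p \<in> loops X x0 \<and> loop_class X x0 p = C))" for C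
  have h: "h (loop_class X x0 p) = hol (f \<circ> p)" if "p \<in> loops X x0" for p
  proof -
    define q where "q = (SOME q. q \<in> loops X x0 \<and> loop_class X x0 q = loop_class X x0 p)"
    have "q \<in> loops X x0 \<and> loop_class X x0 q = loop_class X x0 p"
      unfolding q_def by (rule someI[of _ p]) (use that in simp)
    then show ?thesis
      using loop_class_eq_iff[of q p] that by (simp add: h_def q_def)
  qed
  have carrier: "carrier ?G = loop_class X x0 ` loops X x0"
    by (simp add: fundamental_group_def)
  have const: "(\<lambda>_. x0) \<in> loops X x0"
    using x0 by (simp add: loops_def pathin_def)
  have one: "\<one>\<^bsub>?G\<^esub> = loop_class X x0 (\<lambda>_. x0)"
    by (simp add: fundamental_group_def)
  have bij: "bij_betw h (carrier ?G) (carrier F)"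
    unfolding bij_betw_def carrier
  proof
    show "inj_on h (loop_class X x0 ` loops X x0)"
      using h loop_class_eq_iff by (auto simp: inj_on_def)
    show "h ` loop_class X x0 ` loops X x0 = carrier F"
    proof
      show "h ` loop_class X x0 ` loops X x0 \<subseteq> carrier F"
        using h loop_image hol_closed by (auto simp: path_between_def)
      show "carrier F \<subseteq> h ` loop_class X x0 ` loops X x0"
      proof
        fix w assume w: "w \<in> carrier F"
        note wl = word_loop_F[OF w]
        have l: "g \<circ> word_loop w \<in> loops X x0"
          by (rule loop_preimage[OF wl])
        have "homotopic_paths M (word_loop w) (f \<circ> (g \<circ> word_loop w))"
          using wl fg'[OF subsetD[of "path_image (word_loop w)" M]]
          by (intro homotopic_paths_eq) (simp_all add: path_between_def path_image_def)
        then have "h (loop_class X x0 (g \<circ> word_loop w)) = w"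
          using h[OF l] hol_homotopic hol_word_loop[OF w] by metis
        then show "w \<in> h ` loop_class X x0 ` loops X x0"
          using l by (metis imageI)
      qed
    qed
  qed
  have "f \<circ> (\<lambda>_. x0) = linepath c c"
    using x0(2) by (auto simp: linepath_refl)
  then have h_one: "h \<one>\<^bsub>?G\<^esub> = \<one>\<^bsub>F\<^esub>"
    using h[OF const] hol_word_loop[of "[]"] by (simp add: one one_F carrier_F)
  have closed: "C \<otimes>\<^bsub>?G\<^esub> D \<in> carrier ?G" if "C \<in> carrier ?G" "D \<in> carrier ?G" for C D
    using that join_loops loop_class_mult by (auto simp: carrier)
  have mult: "h (C \<otimes>\<^bsub>?G\<^esub> D) = h C \<otimes>\<^bsub>F\<^esub> h D" if CD: "C \<in> carrier ?G" "D \<in> carrier ?G" for C D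
  proof -
    obtain p q where p: "p \<in> loops X x0" "C = loop_class X x0 p" and q: "q \<in> loops X x0" "D = loop_class X x0 q"
      using CD by (auto simp: carrier)
    have "hol ((f \<circ> p) +++ (f \<circ> q)) = hol (f \<circ> p) \<otimes>\<^bsub>F\<^esub> hol (f \<circ> q)"
      using loop_image[OF p(1)] loop_image[OF q(1)] by (intro hol_join) (auto simp: path_between_def)
    then show ?thesis
      using h[OF p(1)] h[OF q(1)] h[OF join_loops[OF p(1) q(1)]] loop_class_mult[OF p(1) q(1)]
      by (simp add: p(2) q(2) join_loops_image)
  qed
  have one_in: "\<one>\<^bsub>?G\<^esub> \<in> carrier ?G"
    using const by (simp add: one carrier)
  show "group ?G" "?G \<cong> F"
    using group_transfer[OF group_free_group bij closed mult one_in h_one] by blast+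
qed

end

theorem fundamental_group_free:
  assumes "finite A" "finite B"
    "homeomorphic_maps X (top_of_set M) f g" "x0 \<in> topspace X" "f x0 = c"
  shows "free_on_generators (fundamental_group X x0) (card generator_edges)"
proof -
  obtain e where "bij_betw e generator_edges {..<card generator_edges}"
    using ex_bij_betw_finite_nat[OF card_generator_edges(1)[OF assms(1,2)]] by (auto simp: atLeast0LessThan)
  then have "F \<cong> free_group {..<card generator_edges}"
    by (rule free_group_iso)
  then show ?thesis
    using fundamental_group_iso_free[OF assms(3-5)] iso_trans unfolding free_on_generators_def by blast
qed

end

section \<open>Sorted coordinates of configurations\<close>

lemma continuous_map_Max:
  fixes g :: "'b \<Rightarrow> 'a \<Rightarrow> real"
  assumes "finite A" "A \<noteq> {}" "\<And>a. a \<in> A \<Longrightarrow> continuous_map X euclideanreal (g a)"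
  shows "continuous_map X euclideanreal (\<lambda>x. Max ((\<lambda>a. g a x) ` A))"
  using assms
proof (induction rule: finite_ne_induct)
  case (insert a A)
  then show ?case
    by (simp add: continuous_map_real_max)
qed simp

lemma continuous_map_Min:
  fixes g :: "'b \<Rightarrow> 'a \<Rightarrow> real"
  assumes "finite A" "A \<noteq> {}" "\<And>a. a \<in> A \<Longrightarrow> continuous_map X euclideanreal (g a)"
  shows "continuous_map X euclideanreal (\<lambda>x. Min ((\<lambda>a. g a x) ` A))"
  using assms
proof (induction rule: finite_ne_induct)
  case (insert a A)
  then show ?case
    by (simp add: continuous_map_real_min)
qed simp

text \<open>Each edge is the image of an interval under a 1-Lipschitz map. Compactness is used to
  make the sorting map closed.\<close>

lemma compact_space_star: "compact_space (star_topology \<kappa> n)"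
proof -
  interpret S: Metric_space "star \<kappa> n" star_dist
    by (rule Metric_space_star)
  have edge: "continuous_map (top_of_set {0..\<kappa>}) (star_topology \<kappa> n) (edge_point i)" if i: "i \<in> {1..n}" for i
    unfolding star_topology_def S.continuous_map_to_metric
  proof (intro ballI allI impI)
    fix s and \<epsilon> :: real assume s: "s \<in> topspace (top_of_set {0..\<kappa>})" and "\<epsilon> > 0"
    have in_star: "edge_point i t \<in> star \<kappa> n" if "t \<in> {0..\<kappa>}" for t
      using that i by (auto simp: star_def)
    have "star_dist (edge_point i s) (edge_point i t) \<le> \<bar>s - t\<bar>" for t
      by (auto simp: star_dist_def edge_point_def)
    then have "edge_point i t \<in> S.mball (edge_point i s) \<epsilon>" if "t \<in> {0..\<kappa>} \<inter> ball s \<epsilon>" for t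
      using that in_star s by (auto simp: S.in_mball dist_real_def intro: le_less_trans)
    moreover have "openin (top_of_set {0..\<kappa>}) ({0..\<kappa>} \<inter> ball s \<epsilon>)"
      by (simp add: openin_open_Int)
    ultimately show "\<exists>W. openin (top_of_set {0..\<kappa>}) W \<and> s \<in> W \<and> (\<forall>t\<in>W. edge_point i t \<in> S.mball (edge_point i s) \<epsilon>)"
      using s \<open>\<epsilon> > 0\<close> by (intro exI[of _ "{0..\<kappa>} \<inter> ball s \<epsilon>"]) auto
  qed
  have "compactin (star_topology \<kappa> n) (edge_point i ` {0..\<kappa>})" if "i \<in> {1..n}" for i
    by (rule image_compactin[OF _ edge[OF that]]) (simp add: compactin_subtopology)
  then have "compactin (star_topology \<kappa> n) (\<Union>i\<in>{1..n}. edge_point i ` {0..\<kappa>})"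
    by (intro compactin_Union) auto
  moreover have "star \<kappa> n = (\<Union>i\<in>{1..n}. edge_point i ` {0..\<kappa>})"
  proof (intro equalityI subsetI)
    fix p assume "p \<in> star \<kappa> n"
    then obtain i t where "p = edge_point i t" "i \<in> {1..n}" "t \<in> {0..\<kappa>}"
      unfolding star_def by auto
    then show "p \<in> (\<Union>i\<in>{1..n}. edge_point i ` {0..\<kappa>})"
      by blast
  next
    fix p assume "p \<in> (\<Union>i\<in>{1..n}. edge_point i ` {0..\<kappa>})"
    then obtain i t where "i \<in> {1..n}" "t \<in> {0..\<kappa>}" "p = edge_point i t"
      by blast
    then show "p \<in> star \<kappa> n"
      unfolding star_def by (intro CollectI exI[of _ i] exI[of _ t]) auto
  qed
  ultimately show ?thesis
    by (simp add: compact_space_def)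
qed

lemma star_cases:
  assumes "p \<in> star \<kappa> n"
  obtains "p = (0, 0)" | i t where "p = (i, t)" "1 \<le> i" "i \<le> n" "0 < t" "t \<le> \<kappa>"
  using assms by (force simp: star_def edge_point_def split: if_splits)

lemma edge_in_star: "1 \<le> i \<Longrightarrow> i \<le> n \<Longrightarrow> 0 < t \<Longrightarrow> t \<le> \<kappa> \<Longrightarrow> (i, t) \<in> star \<kappa> n"
  unfolding star_def by (intro CollectI exI[of _ i] exI[of _ t]) (simp add: edge_point_def)

lemma centre_in_star: "1 \<le> n \<Longrightarrow> 0 \<le> \<kappa> \<Longrightarrow> (0, 0) \<in> star \<kappa> n"
  unfolding star_def by (intro CollectI exI[of _ 1] exI[of _ 0]) (simp add: edge_point_def)

text \<open>The value zero off the edge makes the coordinate 1-Lipschitz across the centre. The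
  price is that zero does not distinguish the centre from points of other edges.\<close>

definition edge_coord :: "nat \<Rightarrow> nat \<times> real \<Rightarrow> real" where
  "edge_coord i p = (if fst p = i then snd p else 0)"

lemma edge_coord_star: "p \<in> star \<kappa> n \<Longrightarrow> 0 \<le> edge_coord i p" "p \<in> star \<kappa> n \<Longrightarrow> 0 \<le> \<kappa> \<Longrightarrow> edge_coord i p \<le> \<kappa>"
  by (auto elim!: star_cases simp: edge_coord_def)

lemma continuous_map_edge_coord: "continuous_map (star_topology \<kappa> n) euclideanreal (edge_coord i)"
proof -
  interpret S: Metric_space "star \<kappa> n" star_dist
    by (rule Metric_space_star)
  have lip: "\<bar>edge_coord i p - edge_coord i q\<bar> \<le> star_dist p q" for p q
    by (auto simp: edge_coord_def star_dist_def)
  show ?thesis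
    unfolding continuous_map_def
  proof (intro conjI allI impI)
    fix V :: "real set" assume "openin euclideanreal V"
    then have V: "open V" by simp
    show "openin (star_topology \<kappa> n) {p \<in> topspace (star_topology \<kappa> n). edge_coord i p \<in> V}"
      unfolding star_topology_def S.openin_mtopology
    proof (intro conjI allI impI)
      fix p assume p: "p \<in> {p \<in> topspace S.mtopology. edge_coord i p \<in> V}"
      then obtain e where e: "e > 0" "ball (edge_coord i p) e \<subseteq> V"
        using V openE by blast
      have "edge_coord i q \<in> V" if "q \<in> S.mball p e" for q
        using that e(2) lip[of p q] by (auto simp: S.in_mball dist_real_def subset_iff)
      then show "\<exists>r>0. S.mball p r \<subseteq> {p \<in> topspace S.mtopology. edge_coord i p \<in> V}"
        using e(1) by (intro exI[of _ e]) auto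
    qed auto
  qed auto
qed

text \<open>The \<open>j\<close>-th largest of the \<open>i\<close>-th coordinates of a \<open>k\<close>-tuple, counted from \<open>j = 0\<close>. The
  maximum over index sets makes its continuity evident.\<close>

definition order_stat :: "nat \<Rightarrow> (nat \<Rightarrow> nat \<times> real) \<Rightarrow> nat \<Rightarrow> nat \<Rightarrow> real" where
  "order_stat k y i j = Max ((\<lambda>J. Min ((\<lambda>l. edge_coord i (y l)) ` J)) ` {J. J \<subseteq> {..<k} \<and> card J = Suc j})"

definition coord_count :: "nat \<Rightarrow> (nat \<Rightarrow> nat \<times> real) \<Rightarrow> nat \<Rightarrow> real \<Rightarrow> nat" where
  "coord_count k y i r = card {l. l < k \<and> r \<le> edge_coord i (y l)}"

lemma index_sets: 
  assumes "j < k"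
  shows "finite {J. J \<subseteq> {..<k} \<and> card J = Suc j}" "{J. J \<subseteq> {..<k} \<and> card J = Suc j} \<noteq> {}"
proof -
  have "{..<Suc j} \<in> {J. J \<subseteq> {..<k} \<and> card J = Suc j}"
    using assms by auto
  then show "{J. J \<subseteq> {..<k} \<and> card J = Suc j} \<noteq> {}"
    by blast
qed simp

text \<open>A maximum of minima is at least \<open>r\<close> iff some index set of size
  \<open>Suc j\<close> has all its coordinates at least \<open>r\<close>. This turns questions about
  sorted coordinates into counts, in which ties need no attention.\<close>

lemma order_stat_ge_iff:
  assumes "j < k"
  shows "r \<le> order_stat k y i j \<longleftrightarrow> Suc j \<le> coord_count k y i r"
proof -
  note fin = index_sets[OF assms]
  have "r \<le> order_stat k y i j \<longleftrightarrow>
      (\<exists>J. J \<subseteq> {..<k} \<and> card J = Suc j \<and> r \<le> Min ((\<lambda>l. edge_coord i (y l)) ` J))"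
    unfolding order_stat_def using fin by (subst Max_ge_iff) auto
  also have "\<dots> \<longleftrightarrow> (\<exists>J. J \<subseteq> {..<k} \<and> card J = Suc j \<and> (\<forall>l\<in>J. r \<le> edge_coord i (y l)))"
  proof (intro ex_cong1 conj_cong refl)
    fix J assume J: "J \<subseteq> {..<k}" "card J = Suc j"
    then have "finite J" "J \<noteq> {}"
      by (auto intro: finite_subset)
    then show "r \<le> Min ((\<lambda>l. edge_coord i (y l)) ` J) \<longleftrightarrow> (\<forall>l\<in>J. r \<le> edge_coord i (y l))"
      by simp
  qed
  also have "\<dots> \<longleftrightarrow> (\<exists>J. J \<subseteq> {l. l < k \<and> r \<le> edge_coord i (y l)} \<and> card J = Suc j)"
    by (intro ex_cong1) auto
  also have "\<dots> \<longleftrightarrow> Suc j \<le> coord_count k y i r"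
  proof
    assume "\<exists>J. J \<subseteq> {l. l < k \<and> r \<le> edge_coord i (y l)} \<and> card J = Suc j"
    then obtain J where J: "J \<subseteq> {l. l < k \<and> r \<le> edge_coord i (y l)}" "card J = Suc j"
      by blast
    then show "Suc j \<le> coord_count k y i r"
      using card_mono[OF _ J(1)] by (simp add: coord_count_def)
  next
    assume "Suc j \<le> coord_count k y i r"
    then show "\<exists>J. J \<subseteq> {l. l < k \<and> r \<le> edge_coord i (y l)} \<and> card J = Suc j"
      unfolding coord_count_def by (rule obtain_subset_with_card_n) blast
  qed
  finally show ?thesis .
qed

lemma continuous_map_order_stat:
  assumes "j < k"
  shows "continuous_map (product_topology (\<lambda>_. star_topology \<kappa> n) {..<k}) euclideanreal
    (\<lambda>y. order_stat k y i j)"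
  unfolding order_stat_def
proof (rule continuous_map_Max[OF index_sets[OF assms]])
  fix J assume "J \<in> {J. J \<subseteq> {..<k} \<and> card J = Suc j}"
  then have J: "finite J" "J \<noteq> {}" "J \<subseteq> {..<k}"
    by (auto intro: finite_subset)
  show "continuous_map (product_topology (\<lambda>_. star_topology \<kappa> n) {..<k}) euclideanreal
      (\<lambda>y. Min ((\<lambda>l. edge_coord i (y l)) ` J))"
  proof (rule continuous_map_Min[OF J(1,2)])
    fix l assume "l \<in> J"
    then have "continuous_map (product_topology (\<lambda>_. star_topology \<kappa> n) {..<k}) euclideanreal
        (edge_coord i \<circ> (\<lambda>y. y l))"
      using J by (intro continuous_map_compose[where X' = "star_topology \<kappa> n"] continuous_map_edge_coord
          continuous_map_product_projection[of l "{..<k}" "\<lambda>_. star_topology \<kappa> n"]) auto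
    then show "continuous_map (product_topology (\<lambda>_. star_topology \<kappa> n) {..<k}) euclideanreal
        (\<lambda>y. edge_coord i (y l))"
      by (simp add: o_def)
  qed
qed

text \<open>The index set is discrete, so these are all bounded families of reals: one normed space
  for every \<open>n\<close> and \<open>k\<close>. The entry at \<open>(i, j)\<close> is meant to be
  the \<open>j\<close>-th largest distance on edge \<open>i\<close>.\<close>

type_synonym array = "(nat \<times> nat) \<Rightarrow>\<^sub>C real"

lemma open_nat_pair: "open (S :: (nat \<times> nat) set)"
proof -
  have "open {p}" for p :: "nat \<times> nat"
    using open_Times[of "{fst p}" "{snd p}"] by (simp add: open_discrete)
  then have "open (\<Union>p\<in>S. {p})"
    by blast
  then show ?thesis
    by simp
qed

definition unit_array :: "nat \<times> nat \<Rightarrow> array" where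
  "unit_array p = Bcontfun (\<lambda>q. if q = p then 1 else 0)"

lemma apply_unit_array: "apply_bcontfun (unit_array p) q = (if q = p then 1 else 0)"
proof -
  have "continuous_on UNIV (\<lambda>q. if q = p then 1 else 0 :: real)"
    by (simp add: continuous_on_open_vimage open_nat_pair)
  then have "(\<lambda>q. if q = p then 1 else 0 :: real) \<in> bcontfun"
    by (rule bcontfun_normI[where b = 1]) auto
  then show ?thesis
    by (simp add: unit_array_def Bcontfun_inverse)
qed

lemma continuous_on_apply_array: "continuous_on S (\<lambda>x :: array. apply_bcontfun x p)"
proof (rule continuous_onI)
  fix x :: array and e :: real assume "e > 0"
  then show "\<exists>d>0. \<forall>x'\<in>S. dist x' x < d \<longrightarrow> dist (apply_bcontfun x' p) (apply_bcontfun x p) \<le> e"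
    by (intro exI[of _ e]) (auto intro: order.trans[OF dist_bounded less_imp_le])
qed

lemma apply_sum_array: "apply_bcontfun (sum f I) q = (\<Sum>i\<in>I. apply_bcontfun (f i :: array) q)"
  by (induction I rule: infinite_finite_induct) auto

definition array_of :: "nat \<Rightarrow> nat \<Rightarrow> (nat \<times> nat \<Rightarrow> real) \<Rightarrow> array" where
  "array_of k n g = (\<Sum>p\<in>{1..n} \<times> {..<k}. g p *\<^sub>R unit_array p)"

lemma apply_array_of: "apply_bcontfun (array_of k n g) p = (if p \<in> {1..n} \<times> {..<k} then g p else 0)"
  by (simp add: array_of_def apply_sum_array apply_unit_array if_distrib sum.delta cong: if_cong)

definition sorted_coords :: "nat \<Rightarrow> nat \<Rightarrow> (nat \<Rightarrow> nat \<times> real) \<Rightarrow> array" where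
  "sorted_coords k n y = array_of k n (\<lambda>(i, j). order_stat k y i j)"

lemma apply_sorted_coords:
  "apply_bcontfun (sorted_coords k n y) (i, j) = (if i \<in> {1..n} \<and> j < k then order_stat k y i j else 0)"
  by (auto simp: sorted_coords_def apply_array_of)

lemma continuous_map_sorted_coords:
  "continuous_map (product_topology (\<lambda>_. star_topology \<kappa> n) {..<k}) euclidean (sorted_coords k n)"
proof -
  have "continuous_map (product_topology (\<lambda>_. star_topology \<kappa> n) {..<k}) euclidean
     (\<lambda>y. \<Sum>p\<in>{1..n} \<times> {..<k}. order_stat k y (fst p) (snd p) *\<^sub>R unit_array p)"
  proof (intro continuous_map_sum)
    fix p assume "p \<in> {1..n} \<times> {..<k}"
    then have "continuous_map (product_topology (\<lambda>_. star_topology \<kappa> n) {..<k}) euclideanreal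
        (\<lambda>y. order_stat k y (fst p) (snd p))"
      by (intro continuous_map_order_stat) auto
    then have "continuous_map (product_topology (\<lambda>_. star_topology \<kappa> n) {..<k}) euclidean
        ((\<lambda>t. t *\<^sub>R unit_array p) \<circ> (\<lambda>y. order_stat k y (fst p) (snd p)))"
      by (rule continuous_map_compose) (auto intro!: continuous_intros)
    then show "continuous_map (product_topology (\<lambda>_. star_topology \<kappa> n) {..<k}) euclidean
        (\<lambda>y. order_stat k y (fst p) (snd p) *\<^sub>R unit_array p)"
      by (simp add: o_def)
  qed simp
  then show ?thesis
    by (simp add: sorted_coords_def[abs_def] array_of_def case_prod_unfold)
qed

text \<open>Zeros pad the list of an edge; a positive entry stands for a point. Strict decrease
  expresses that the points are distinct and can therefore be asked only in front of positive
  entries.\<close>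

definition decreasing_array :: "real \<Rightarrow> nat \<Rightarrow> nat \<Rightarrow> array \<Rightarrow> bool" where
  "decreasing_array \<kappa> k n x \<longleftrightarrow>
     (\<forall>p. p \<notin> {1..n} \<times> {..<k} \<longrightarrow> apply_bcontfun x p = 0) \<and>
     (\<forall>p. 0 \<le> apply_bcontfun x p \<and> apply_bcontfun x p \<le> \<kappa>) \<and>
     (\<forall>i j j'. j < j' \<longrightarrow> 0 < apply_bcontfun x (i, j') \<longrightarrow> apply_bcontfun x (i, j') < apply_bcontfun x (i, j))"

lemma decreasing_arrayD:
  assumes "decreasing_array \<kappa> k n x"
  shows "0 \<le> apply_bcontfun x p" "apply_bcontfun x p \<le> \<kappa>"
    and "0 < apply_bcontfun x (i, j) \<Longrightarrow> i \<in> {1..n} \<and> j < k"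
    and "j < j' \<Longrightarrow> 0 < apply_bcontfun x (i, j') \<Longrightarrow> apply_bcontfun x (i, j') < apply_bcontfun x (i, j)"
proof -
  show "i \<in> {1..n} \<and> j < k" if pos: "0 < apply_bcontfun x (i, j)"
  proof (rule ccontr)
    assume "\<not> (i \<in> {1..n} \<and> j < k)"
    then have "(i, j) \<notin> {1..n} \<times> {..<k}"
      by simp
    then have "apply_bcontfun x (i, j) = 0"
      using assms unfolding decreasing_array_def by blast
    then show False
      using pos by simp
  qed
qed (use assms in \<open>unfold decreasing_array_def, blast+\<close>)

definition array_type :: "array \<Rightarrow> nat \<Rightarrow> nat" where
  "array_type x i = card {j. 0 < apply_bcontfun x (i, j)}"

text \<open>Since the centre has coordinate \<open>0\<close> on every edge, at most one of the \<open>k\<close> points has no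
  positive coordinate.\<close>

definition model :: "real \<Rightarrow> nat \<Rightarrow> nat \<Rightarrow> array set" where
  "model \<kappa> k n = {x. decreasing_array \<kappa> k n x \<and> (\<Sum>i=1..n. array_type x i) \<in> {k - 1, k}}"

section \<open>Configurations have sorted coordinates in the model\<close>

lemma order_stat_pos_iff:
  assumes "j < k"
  shows "0 < order_stat k y i j \<longleftrightarrow> Suc j \<le> card {l. l < k \<and> 0 < edge_coord i (y l)}"
proof
  assume pos: "0 < order_stat k y i j"
  have "Suc j \<le> coord_count k y i (order_stat k y i j)"
    using order_stat_ge_iff[OF assms, of "order_stat k y i j" y i] by simp
  also have "\<dots> \<le> card {l. l < k \<and> 0 < edge_coord i (y l)}"
    unfolding coord_count_def using pos by (intro card_mono) auto
  finally show "Suc j \<le> card {l. l < k \<and> 0 < edge_coord i (y l)}" .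
next
  let ?S = "{l. l < k \<and> 0 < edge_coord i (y l)}"
  assume "Suc j \<le> card ?S"
  then have S: "finite ?S" "?S \<noteq> {}"
    by (simp, intro notI) (simp only: card.empty)
  \<comment> \<open>The least positive coordinate serves as a threshold that replaces the strict
    inequality by a weak one.\<close>
  let ?m = "Min ((\<lambda>l. edge_coord i (y l)) ` ?S)"
  have "0 < ?m"
    using S by (subst Min_gr_iff) auto
  have "card ?S \<le> coord_count k y i ?m"
    unfolding coord_count_def using S by (intro card_mono) auto
  then have "?m \<le> order_stat k y i j"
    using \<open>Suc j \<le> card ?S\<close> by (simp add: order_stat_ge_iff[OF assms])
  then show "0 < order_stat k y i j"
    using \<open>0 < ?m\<close> by linarith
qed

lemma array_type_sorted_coords:
  assumes "i \<in> {1..n}"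
  shows "array_type (sorted_coords k n y) i = card {l. l < k \<and> 0 < edge_coord i (y l)}"
proof -
  have "card {l. l < k \<and> 0 < edge_coord i (y l)} \<le> card {..<k}"
    by (intro card_mono) auto
  then have "{j. 0 < apply_bcontfun (sorted_coords k n y) (i, j)} = {..<card {l. l < k \<and> 0 < edge_coord i (y l)}}"
    using assms order_stat_pos_iff[of _ k y i] by (auto simp: apply_sorted_coords Suc_le_eq)
  then show ?thesis
    by (simp add: array_type_def)
qed

lemma sum_positive_coords:
  fixes k :: nat
  assumes y: "\<And>l. l < k \<Longrightarrow> y l \<in> star \<kappa> n"
  shows "(\<Sum>i=1..n. card {l. l < k \<and> 0 < edge_coord i (y l)}) = card {l. l < k \<and> y l \<noteq> (0, 0)}"
proof -
  have "(\<Sum>i=1..n. card {l. l < k \<and> 0 < edge_coord i (y l)}) = card (\<Union>i\<in>{1..n}. {l. l < k \<and> 0 < edge_coord i (y l)})"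
  proof (rule card_UN_disjoint[symmetric])
    show "\<forall>i\<in>{1..n}. \<forall>j\<in>{1..n}. i \<noteq> j \<longrightarrow>
        {l. l < k \<and> 0 < edge_coord i (y l)} \<inter> {l. l < k \<and> 0 < edge_coord j (y l)} = {}"
      by (auto simp: edge_coord_def split: if_splits)
    show "\<forall>i\<in>{1..n}. finite {l. l < k \<and> 0 < edge_coord i (y l)}"
      by (intro ballI finite_subset[OF _ finite_lessThan[of k]]) auto
  qed simp
  also have "(\<Union>i\<in>{1..n}. {l. l < k \<and> 0 < edge_coord i (y l)}) = {l. l < k \<and> y l \<noteq> (0, 0)}"
  proof (intro equalityI subsetI)
    fix l assume "l \<in> {l. l < k \<and> y l \<noteq> (0, 0)}"
    then show "l \<in> (\<Union>i\<in>{1..n}. {l. l < k \<and> 0 < edge_coord i (y l)})"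
      using y[of l] by (auto elim!: star_cases simp: edge_coord_def)
  qed (auto simp: edge_coord_def split: if_splits)
  finally show ?thesis .
qed

lemma card_off_centre:
  assumes "inj_on y {..<k}"
  shows "card {l. l < k \<and> y l \<noteq> (0, 0)} = (if (0, 0) \<in> y ` {..<k} then k - 1 else k)"
proof (cases "(0, 0) \<in> y ` {..<k}")
  case True
  then obtain m where m: "m < k" "y m = (0, 0)"
    by auto
  then have "{l. l < k \<and> y l \<noteq> (0, 0)} = {..<k} - {m}"
    using assms by (auto simp: inj_on_def)
  then show ?thesis
    using True m by simp
next
  case False
  then have "{l. l < k \<and> y l \<noteq> (0, 0)} = {..<k}"
    by force
  then show ?thesis
    using False by simp
qed

lemma sorted_coords_in_model:
  assumes \<kappa>: "0 \<le> \<kappa>" and y: "\<And>l. l < k \<Longrightarrow> y l \<in> star \<kappa> n" and inj: "inj_on y {..<k}"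
  shows "sorted_coords k n y \<in> model \<kappa> k n"
proof -
  have count: "Suc j \<le> coord_count k y i (order_stat k y i j)" if "j < k" for i j
    using order_stat_ge_iff[OF that, of "order_stat k y i j" y i] by simp
  have "0 \<le> order_stat k y i j \<and> order_stat k y i j \<le> \<kappa>" if j: "j < k" for i j
  proof
    have "{l. l < k \<and> 0 \<le> edge_coord i (y l)} = {..<k}"
      using y[THEN edge_coord_star(1)] by auto
    then show "0 \<le> order_stat k y i j"
      using j by (simp add: order_stat_ge_iff coord_count_def)
    have "coord_count k y i (order_stat k y i j) \<noteq> 0"
      using count[OF j, of i] by simp
    then obtain l where "l < k" "order_stat k y i j \<le> edge_coord i (y l)"
      by (auto simp: coord_count_def)
    then show "order_stat k y i j \<le> \<kappa>"
      using y edge_coord_star(2)[OF _ \<kappa>] order_trans by blast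
  qed
  moreover have "order_stat k y i j' < order_stat k y i j"
    if j: "j < j'" "j' < k" and pos: "0 < order_stat k y i j'" for i j j'
  proof -
    define t where "t = order_stat k y i j'"
    let ?S = "{l. l < k \<and> t \<le> edge_coord i (y l)}" and ?S' = "{l. l < k \<and> t < edge_coord i (y l)}"
    \<comment> \<open>Two points with the same positive coordinate on one edge coincide, so by
      injectivity the value \<open>t\<close> is attained at most once and leaving it out lowers the
      count by at most one.\<close>
    have "card {l. l < k \<and> edge_coord i (y l) = t} \<le> 1"
    proof (rule card_le_Suc0_iff_eq[THEN iffD2, simplified One_nat_def[symmetric]], simp, safe)
      fix l m assume lm: "l < k" "m < k" "edge_coord i (y m) = edge_coord i (y l)" "t = edge_coord i (y l)"
      then have "y l = (i, t)" "y m = (i, t)"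
        using pos unfolding t_def[symmetric] by (auto simp: edge_coord_def prod_eq_iff split: if_splits)
      then show "l = m"
        using inj lm by (auto simp: inj_on_def)
    qed
    moreover have "card ?S = card ?S' + card {l. l < k \<and> edge_coord i (y l) = t}"
      by (subst card_Un_disjoint[symmetric]) (auto intro!: arg_cong[of _ _ card])
    moreover have "Suc j' \<le> card ?S"
      using count[OF j(2), of i] by (simp add: coord_count_def t_def)
    ultimately have card: "Suc j \<le> card ?S'"
      using j(1) by linarith
    then have S': "finite ?S'" "?S' \<noteq> {}"
      by (simp, intro notI) (simp only: card.empty)
    \<comment> \<open>The least coordinate above \<open>t\<close> is a threshold that at least
      \<open>Suc j\<close> coordinates reach.\<close>
    let ?m = "Min ((\<lambda>l. edge_coord i (y l)) ` ?S')"
    have "t < ?m"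
      using S' by (subst Min_gr_iff) auto
    have "card ?S' \<le> coord_count k y i ?m"
      unfolding coord_count_def using S' by (intro card_mono) auto
    then have "?m \<le> order_stat k y i j"
      using card j by (simp add: order_stat_ge_iff)
    then show ?thesis
      using \<open>t < ?m\<close> by (simp add: t_def)
  qed
  ultimately have "decreasing_array \<kappa> k n (sorted_coords k n y)"
    using \<kappa> by (auto simp: decreasing_array_def apply_sorted_coords split: if_splits)
  moreover have "(\<Sum>i=1..n. array_type (sorted_coords k n y) i) \<in> {k - 1, k}"
    using sum_positive_coords[of k y \<kappa> n, OF y] card_off_centre[OF inj] by (simp add: array_type_sorted_coords)
  ultimately show ?thesis
    by (simp add: model_def)
qed

section \<open>Every array of the model comes from a configuration\<close>

lemma positive_entries:
  assumes "decreasing_array \<kappa> k n x"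
  shows "{j. 0 < apply_bcontfun x (i, j)} = {..<array_type x i}"
proof -
  let ?P = "{j. 0 < apply_bcontfun x (i, j)}"
  have sub: "?P \<subseteq> {..<k}"
  proof
    fix j assume "j \<in> ?P"
    then show "j \<in> {..<k}"
      using decreasing_arrayD(3)[OF assms, of i j] by simp
  qed
  have down: "j \<in> ?P" if "j < j'" "j' \<in> ?P" for j j'
  proof -
    have "apply_bcontfun x (i, j') < apply_bcontfun x (i, j)"
      using assms that by (simp add: decreasing_array_def)
    then show ?thesis
      using that by simp
  qed
  have "?P = {..<card ?P}"
  proof (rule card_subset_eq[symmetric])
    show "finite ?P"
      using sub finite_subset by blast
    show "{..<card ?P} \<subseteq> ?P"
    proof
      fix j assume j: "j \<in> {..<card ?P}"
      show "j \<in> ?P"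
      proof (rule ccontr)
        assume "j \<notin> ?P"
        then have "?P \<subseteq> {..<j}"
          using down by (metis lessThan_iff linorder_neqE_nat subsetI)
        then have "card ?P \<le> j"
          using card_mono[of "{..<j}" ?P] by simp
        then show False
          using j by simp
      qed
    qed
  qed simp
  then show ?thesis
    by (simp add: array_type_def)
qed

text \<open>Counterpart of \<open>order_stat_ge_iff\<close> for an array: the indices whose entries
  reach a positive threshold form an initial segment. Equal counts will therefore force equal
  entries.\<close>

lemma card_entries_ge:
  assumes dec: "decreasing_array \<kappa> k n x" and r: "0 < r"
  shows "Suc j \<le> card {j. r \<le> apply_bcontfun x (i, j)} \<longleftrightarrow> r \<le> apply_bcontfun x (i, j)"
proof -
  let ?R = "{j. r \<le> apply_bcontfun x (i, j)}"
  have "?R \<subseteq> {..<array_type x i}"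
    unfolding positive_entries[OF dec, symmetric] using r by (auto intro: less_le_trans)
  then have fin: "finite ?R"
    by (rule finite_subset) simp
  have down: "a \<in> ?R" if "a < b" "b \<in> ?R" for a b
  proof -
    have "0 < apply_bcontfun x (i, b)"
      using that(2) r by simp
    then have "apply_bcontfun x (i, b) < apply_bcontfun x (i, a)"
      by (rule decreasing_arrayD(4)[OF dec that(1)])
    then show ?thesis
      using that(2) by simp
  qed
  show ?thesis
  proof
    assume "r \<le> apply_bcontfun x (i, j)"
    then have "{..j} \<subseteq> ?R"
      using down by (metis atMost_iff le_neq_implies_less mem_Collect_eq subsetI)
    then have "card {..j} \<le> card ?R"
      by (rule card_mono[OF fin])
    then show "Suc j \<le> card ?R"
      by simp
  next
    assume card: "Suc j \<le> card ?R"
    show "r \<le> apply_bcontfun x (i, j)"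
    proof (rule ccontr)
      assume "\<not> r \<le> apply_bcontfun x (i, j)"
      then have "?R \<subseteq> {..<j}"
        using down by (metis lessThan_iff linorder_neqE_nat mem_Collect_eq subsetI)
      then have "card ?R \<le> card {..<j}"
        by (rule card_mono[rotated]) simp
      then show False
        using card by simp
    qed
  qed
qed

lemma model_realised:
  assumes x: "x \<in> model \<kappa> k n" and k: "1 \<le> k" and n: "1 \<le> n" and \<kappa>: "0 < \<kappa>"
  obtains y where "y \<in> {..<k} \<rightarrow>\<^sub>E star \<kappa> n" "inj_on y {..<k}" "sorted_coords k n y = x"
proof -
  let ?x = "apply_bcontfun x"
  have dec: "decreasing_array \<kappa> k n x" and tot: "(\<Sum>i=1..n. array_type x i) \<in> {k - 1, k}"
    using x by (auto simp: model_def)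
  define P where "P = (SIGMA i:{1..n}. {..<array_type x i})"
  \<comment> \<open>The entries account for \<open>k - 1\<close> or \<open>k\<close> points; in the
    former case the missing point is at the centre.\<close>
  define c where "c = (\<lambda>(i, j). (i, ?x (i, j))) ` P \<union> (if card P = k then {} else {(0, 0)})"
  have P: "(i, j) \<in> P \<longleftrightarrow> 0 < ?x (i, j)" for i j
  proof -
    have "i \<in> {1..n}" if "0 < ?x (i, j)"
      using decreasing_arrayD(3)[OF dec that] by simp
    then show ?thesis
      using positive_entries[OF dec, of i] by (auto simp: P_def)
  qed
  have cardP: "card P \<in> {k - 1, k}" and finP: "finite P"
    using tot by (auto simp: P_def)
  have strict: "?x (i, j') < ?x (i, j)" if "j < j'" "0 < ?x (i, j')" for i j j'
    using dec that by (simp add: decreasing_array_def)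
  have injP: "inj_on (\<lambda>(i, j). (i, ?x (i, j))) P"
  proof (rule inj_onI)
    fix p q assume pq: "p \<in> P" "q \<in> P" "(\<lambda>(i, j). (i, ?x (i, j))) p = (\<lambda>(i, j). (i, ?x (i, j))) q"
    obtain i j j' where ij: "p = (i, j)" "q = (i, j')" "?x (i, j) = ?x (i, j')"
      using pq(3) by (cases p; cases q) auto
    have "j = j'"
      using strict[of j j' i] strict[of j' j i] P[of i j] P[of i j'] pq ij by (cases j j' rule: linorder_cases) auto
    then show "p = q"
      using ij by simp
  qed
  have cardc: "card c = k" "finite c"
  proof -
    show "finite c"
      using finP by (simp add: c_def)
    have "(0, 0) \<notin> (\<lambda>(i, j). (i, ?x (i, j))) ` P"
      by (auto simp: P_def)
    then show "card c = k"
      using cardP k finP card_image[OF injP] by (auto simp: c_def)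
  qed
  obtain h where h: "bij_betw h {..<k} c"
    using ex_bij_betw_nat_finite[OF cardc(2)] cardc(1) by (auto simp: atLeast0LessThan)
  define y where "y = restrict h {..<k}"
  have y: "inj_on y {..<k}" "y ` {..<k} = c"
    using h by (auto simp: y_def bij_betw_def)
  have c_star: "c \<subseteq> star \<kappa> n"
  proof
    fix p assume "p \<in> c"
    then consider "p = (0, 0)" | i j where "p = (i, ?x (i, j))" "(i, j) \<in> P"
      by (auto simp: c_def split: if_splits)
    then show "p \<in> star \<kappa> n"
    proof cases
      case 1
      then show ?thesis
        using centre_in_star n \<kappa> by simp
    next
      case 2
      then show ?thesis
        using P[of i j] dec by (auto simp: P_def decreasing_array_def intro!: edge_in_star)
    qed
  qed
  have count: "coord_count k y i r = card {j. r \<le> ?x (i, j)}" if "0 < r" for i r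
  proof -
    have "coord_count k y i r = card {p \<in> c. r \<le> edge_coord i p}"
    proof -
      have "y ` {l. l < k \<and> r \<le> edge_coord i (y l)} = {p \<in> c. r \<le> edge_coord i p}"
        using y(2) by auto
      moreover have "inj_on y {l. l < k \<and> r \<le> edge_coord i (y l)}"
        using y(1) by (rule inj_on_subset) auto
      then have "card (y ` {l. l < k \<and> r \<le> edge_coord i (y l)}) = card {l. l < k \<and> r \<le> edge_coord i (y l)}"
        by (rule card_image)
      ultimately show ?thesis
        by (simp only: coord_count_def)
    qed
    also have "{p \<in> c. r \<le> edge_coord i p} = (\<lambda>j. (i, ?x (i, j))) ` {j. r \<le> ?x (i, j)}"
    proof (intro equalityI subsetI)
      fix p assume p: "p \<in> {p \<in> c. r \<le> edge_coord i p}"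
      then have "fst p = i" "r \<le> snd p" "p \<noteq> (0, 0)"
        using \<open>0 < r\<close> by (auto simp: edge_coord_def split: if_splits)
      then show "p \<in> (\<lambda>j. (i, ?x (i, j))) ` {j. r \<le> ?x (i, j)}"
        using p by (auto simp: c_def split: if_splits)
    next
      fix p assume "p \<in> (\<lambda>j. (i, ?x (i, j))) ` {j. r \<le> ?x (i, j)}"
      then obtain j where j: "p = (i, ?x (i, j))" "r \<le> ?x (i, j)"
        by auto
      then have "(i, j) \<in> P"
        using P \<open>0 < r\<close> by simp
      then show "p \<in> {p \<in> c. r \<le> edge_coord i p}"
        using j by (force simp: c_def edge_coord_def)
    qed
    also have "card \<dots> = card {j. r \<le> ?x (i, j)}"
    proof (rule card_image, rule inj_onI)
      fix j j' assume "j \<in> {j. r \<le> ?x (i, j)}" "j' \<in> {j. r \<le> ?x (i, j)}" "(i, ?x (i, j)) = (i, ?x (i, j'))"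
      then show "j = j'"
        using inj_onD[OF injP, of "(i, j)" "(i, j')"] P \<open>0 < r\<close> by auto
    qed
    finally show ?thesis .
  qed
  have eq: "order_stat k y i j = ?x (i, j)" if ij: "i \<in> {1..n}" "j < k" for i j
  proof -
    \<comment> \<open>Both numbers are nonnegative, so agreement for positive thresholds suffices.
      At the threshold zero the zeros of the padding would be counted as well.\<close>
    have iff: "r \<le> order_stat k y i j \<longleftrightarrow> r \<le> ?x (i, j)" if r: "0 < r" for r
    proof -
      have "Suc j \<le> card {j. r \<le> ?x (i, j)} \<longleftrightarrow> r \<le> ?x (i, j)"
        by (rule card_entries_ge[OF dec r])
      then show ?thesis
        using order_stat_ge_iff[OF ij(2), of r y i] count[OF r, of i] by simp
    qed
    have "0 \<le> edge_coord i (y l)" if "l < k" for l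
    proof (rule edge_coord_star(1))
      show "y l \<in> star \<kappa> n"
        using c_star y(2) that by auto
    qed
    then have "{l. l < k \<and> 0 \<le> edge_coord i (y l)} = {..<k}"
      by auto
    then have "0 \<le> order_stat k y i j"
      using ij by (simp add: order_stat_ge_iff coord_count_def)
    moreover have "0 \<le> ?x (i, j)"
      using dec by (simp add: decreasing_array_def)
    ultimately show ?thesis
      using iff[of "order_stat k y i j"] iff[of "?x (i, j)"] by linarith
  qed
  have "sorted_coords k n y = x"
  proof (rule bcontfun_eqI)
    fix p :: "nat \<times> nat"
    show "apply_bcontfun (sorted_coords k n y) p = ?x p"
      using eq dec by (cases p) (auto simp: apply_sorted_coords decreasing_array_def)
  qed
  moreover have "y \<in> {..<k} \<rightarrow>\<^sub>E star \<kappa> n"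
    using y(2) c_star by (auto simp: y_def)
  ultimately show thesis
    using that y(1) by blast
qed

section \<open>Fibres of the sorting map\<close>

lemma coord_count_eq:
  assumes eq: "sorted_coords k n y = sorted_coords k n y'" and i: "i \<in> {1..n}"
  shows "coord_count k y i r = coord_count k y' i r"
proof -
  have os: "order_stat k y i j = order_stat k y' i j" if "j < k" for j
    using arg_cong[OF eq, of "\<lambda>x. apply_bcontfun x (i, j)"] that i by (simp add: apply_sorted_coords)
  have le: "coord_count k z i r \<le> k" for z
  proof -
    have "coord_count k z i r \<le> card {..<k}"
      unfolding coord_count_def by (intro card_mono) auto
    then show ?thesis by simp
  qed
  have "Suc j \<le> coord_count k y i r \<longleftrightarrow> Suc j \<le> coord_count k y' i r" if "j < k" for j
    using order_stat_ge_iff[OF that, of r y i] order_stat_ge_iff[OF that, of r y' i] os[OF that] by simp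
  then have "m \<le> coord_count k y i r \<longleftrightarrow> m \<le> coord_count k y' i r" if "m \<le> k" for m
    using that by (cases m) auto
  then show ?thesis
    using le[of y] le[of y'] by (metis order_antisym order_refl)
qed

lemma multiplicity_eq:
  assumes eq: "sorted_coords k n y = sorted_coords k n y'" and i: "i \<in> {1..n}" and t: "0 < t"
  shows "card {l. l < k \<and> y l = (i, t)} = card {l. l < k \<and> y' l = (i, t)}"
proof -
  define V where "V = (\<lambda>l. edge_coord i (y l)) ` {..<k} \<union> (\<lambda>l. edge_coord i (y' l)) ` {..<k}"
  \<comment> \<open>No coordinate of either tuple lies strictly between \<open>t\<close> and
    \<open>m\<close>, so a multiplicity is the difference of the counts at \<open>t\<close> and at
    \<open>m\<close>. Inserting \<open>t + 1\<close> keeps the set nonempty when \<open>t\<close> is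
    the largest value.\<close>
  define m where "m = Min (insert (t + 1) {v \<in> V. t < v})"
  have fin: "finite (insert (t + 1) {v \<in> V. t < v})"
    by (simp add: V_def)
  have m: "t < m" "\<And>v. v \<in> V \<Longrightarrow> t < v \<Longrightarrow> m \<le> v"
    unfolding m_def using fin by (auto intro!: Min_le)
  have mult: "card {l. l < k \<and> z l = (i, t)} = coord_count k z i t - coord_count k z i m"
    if z: "\<And>l. l < k \<Longrightarrow> edge_coord i (z l) \<in> V" for z
  proof -
    have "{l. l < k \<and> z l = (i, t)} = {l. l < k \<and> t \<le> edge_coord i (z l)} - {l. l < k \<and> m \<le> edge_coord i (z l)}"
    proof (intro equalityI subsetI)
      fix l assume l: "l \<in> {l. l < k \<and> t \<le> edge_coord i (z l)} - {l. l < k \<and> m \<le> edge_coord i (z l)}"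
      then have "edge_coord i (z l) = t"
        using m(2)[OF z, of l] by force
      then show "l \<in> {l. l < k \<and> z l = (i, t)}"
        using l t by (auto simp: edge_coord_def prod_eq_iff split: if_splits)
    qed (use m(1) in \<open>auto simp: edge_coord_def\<close>)
    moreover have "{l. l < k \<and> m \<le> edge_coord i (z l)} \<subseteq> {l. l < k \<and> t \<le> edge_coord i (z l)}"
      using m(1) by auto
    ultimately show ?thesis
      unfolding coord_count_def by (simp add: card_Diff_subset)
  qed
  show ?thesis
    using mult[of y] mult[of y'] coord_count_eq[OF eq i] by (auto simp: V_def)
qed

text \<open>Positive coordinates give the multiplicity of every point but the centre, whose
  multiplicity is what remains of \<open>k\<close>. Injectivity of \<open>y'\<close> is a
  conclusion: it shows that the complement of the fat diagonal is saturated.\<close>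

lemma sorted_coords_determines:
  assumes eq: "sorted_coords k n y = sorted_coords k n y'"
    and y: "\<And>l. l < k \<Longrightarrow> y l \<in> star \<kappa> n" and y': "\<And>l. l < k \<Longrightarrow> y' l \<in> star \<kappa> n"
    and inj: "inj_on y {..<k}"
  shows "inj_on y' {..<k}" "y' ` {..<k} = y ` {..<k}"
proof -
  let ?N = "{l. l < k \<and> y l \<noteq> (0, 0)}" and ?N' = "{l. l < k \<and> y' l \<noteq> (0, 0)}"
  have mult: "card {l. l < k \<and> y l = p} = card {l. l < k \<and> y' l = p}" if "p \<in> star \<kappa> n" "p \<noteq> (0, 0)" for p
    using that(1)
  proof (cases rule: star_cases)
    case (2 i t)
    then show ?thesis
      using multiplicity_eq[OF eq, of i t] by simp
  qed (use that(2) in simp)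
  have le1: "card {l. l < k \<and> y l = p} \<le> 1" for p
    using inj by (subst One_nat_def, subst card_le_Suc0_iff_eq) (auto simp: inj_on_def)
  have mem: "p \<in> y ` ?N \<longleftrightarrow> p \<in> y' ` ?N'" if p: "p \<in> star \<kappa> n" for p
  proof (cases "p = (0, 0)")
    case False
    have iff: "p \<in> z ` {l. l < k \<and> z l \<noteq> (0, 0)} \<longleftrightarrow> card {l. l < k \<and> z l = p} \<noteq> 0" for z :: "nat \<Rightarrow> nat \<times> real"
    proof -
      have "p \<in> z ` {l. l < k \<and> z l \<noteq> (0, 0)} \<longleftrightarrow> {l. l < k \<and> z l = p} \<noteq> {}"
        using False by auto
      then show ?thesis
        by (simp add: card_eq_0_iff)
    qed
    then show ?thesis
      by (simp only: iff mult[OF p False])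
  qed auto
  have imN: "y ` ?N = y' ` ?N'"
  proof (intro equalityI subsetI)
    fix p assume "p \<in> y ` ?N"
    then show "p \<in> y' ` ?N'"
      using mem[of p] y by auto
  next
    fix p assume "p \<in> y' ` ?N'"
    then show "p \<in> y ` ?N"
      using mem[of p] y' by auto
  qed
  have injN': "inj_on y' ?N'"
  proof (rule inj_onI)
    fix l m assume lm: "l \<in> ?N'" "m \<in> ?N'" "y' l = y' m"
    have "card {j. j < k \<and> y' j = y' l} \<le> 1"
      using mult[of "y' l"] le1[of "y' l"] lm y' by auto
    then show "l = m"
      using lm by (subst (asm) One_nat_def, subst (asm) card_le_Suc0_iff_eq) auto
  qed
  have injN: "inj_on y ?N"
    using inj by (rule inj_on_subset) auto
  have cardN: "card ?N' = card ?N"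
    using card_image[OF injN] card_image[OF injN'] imN by simp
  have compl: "card {l. l < k \<and> z l = (0, 0)} = k - card {l. l < k \<and> z l \<noteq> (0, 0)}" for z :: "nat \<Rightarrow> nat \<times> real"
  proof -
    have "{l. l < k \<and> z l = (0, 0)} = {..<k} - {l. l < k \<and> z l \<noteq> (0, 0)}"
      by auto
    then show ?thesis
      by (simp add: card_Diff_subset subset_iff)
  qed
  have mult0: "card {l. l < k \<and> y l = (0, 0)} = card {l. l < k \<and> y' l = (0, 0)}"
    using compl[of y] compl[of y'] cardN by simp
  show "inj_on y' {..<k}"
  proof (rule inj_onI)
    fix l m assume lm: "l \<in> {..<k}" "m \<in> {..<k}" "y' l = y' m"
    show "l = m"
    proof (cases "y' l = (0, 0)")
      case False
      then show ?thesis
        using lm injN' by (auto simp: inj_on_def)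
    next
      case True
      have "card {l. l < k \<and> y' l = (0, 0)} \<le> 1"
        using le1[of "(0, 0)"] mult0 by simp
      then show ?thesis
        using lm True by (subst (asm) One_nat_def, subst (asm) card_le_Suc0_iff_eq) auto
    qed
  qed
  have split_im: "z ` {..<k} = z ` {l. l < k \<and> z l \<noteq> (0, 0)} \<union> (if card {l. l < k \<and> z l = (0, 0)} = 0 then {} else {(0, 0)})"
    for z :: "nat \<Rightarrow> nat \<times> real"
    by force
  show "y' ` {..<k} = y ` {..<k}"
    using split_im[of y] split_im[of y'] imN mult0 by simp
qed

lemma sorted_coords_image:
  assumes inj: "inj_on y {..<k}" "inj_on y' {..<k}" and im: "y ` {..<k} = y' ` {..<k}"
  shows "sorted_coords k n y = sorted_coords k n y'"
proof -
  have cc: "coord_count k z i r = card {p \<in> z ` {..<k}. r \<le> edge_coord i p}" if "inj_on z {..<k}" for z i r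
  proof -
    have "z ` {l. l < k \<and> r \<le> edge_coord i (z l)} = {p \<in> z ` {..<k}. r \<le> edge_coord i p}"
      by auto
    moreover have "inj_on z {l. l < k \<and> r \<le> edge_coord i (z l)}"
      using that by (rule inj_on_subset) auto
    then have "card (z ` {l. l < k \<and> r \<le> edge_coord i (z l)}) = card {l. l < k \<and> r \<le> edge_coord i (z l)}"
      by (rule card_image)
    ultimately show ?thesis
      by (simp only: coord_count_def)
  qed
  have "order_stat k y i j = order_stat k y' i j" if "j < k" for i j
  proof -
    have "r \<le> order_stat k y i j \<longleftrightarrow> r \<le> order_stat k y' i j" for r
      using order_stat_ge_iff[OF that] cc[OF inj(1)] cc[OF inj(2)] im by simp
    then show ?thesis
      by (metis order_antisym order_refl)
  qed
  then show ?thesis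
    by (intro bcontfun_eqI) (auto simp: apply_sorted_coords)
qed

section \<open>The model as a quotient\<close>

lemma topspace_ordered_configuration_space:
  "topspace (ordered_configuration_space X k) = {y \<in> {..<k} \<rightarrow>\<^sub>E topspace X. inj_on y {..<k}}"
  by (auto simp: ordered_configuration_space_def fat_diagonal_def inj_on_def)

text \<open>The ordered configuration space is not compact in general, but the full product is, so
  sorting is a closed map there. Closedness survives the restriction to the full preimage of the
  model, which is exactly the complement of the fat diagonal.\<close>

lemma quotient_map_sorted_coords:
  assumes k: "1 \<le> k" and n: "1 \<le> n" and \<kappa>: "0 < \<kappa>"
  shows "quotient_map (ordered_configuration_space (star_topology \<kappa> n) k) (top_of_set (model \<kappa> k n)) (sorted_coords k n)"
proof -
  let ?T = "product_topology (\<lambda>_. star_topology \<kappa> n) {..<k}"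
  let ?O = "{y \<in> {..<k} \<rightarrow>\<^sub>E star \<kappa> n. inj_on y {..<k}}"
  have O: "ordered_configuration_space (star_topology \<kappa> n) k = subtopology ?T ?O"
  proof -
    have "({..<k} \<rightarrow>\<^sub>E star \<kappa> n) - fat_diagonal (star_topology \<kappa> n) k = ?O"
      by (auto simp: fat_diagonal_def inj_on_def)
    then show ?thesis
      by (simp add: ordered_configuration_space_def)
  qed
  have image: "sorted_coords k n ` ?O = model \<kappa> k n"
  proof
    show "sorted_coords k n ` ?O \<subseteq> model \<kappa> k n"
    proof (rule image_subsetI)
      fix y assume "y \<in> ?O"
      then have "y l \<in> star \<kappa> n" "inj_on y {..<k}" if "l < k" for l
        using that by auto
      then show "sorted_coords k n y \<in> model \<kappa> k n"
        using \<kappa> k by (intro sorted_coords_in_model) (auto dest: less_imp_le)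
    qed
    show "model \<kappa> k n \<subseteq> sorted_coords k n ` ?O"
      using model_realised[OF _ k n \<kappa>] by blast
  qed
  have saturated: "{y \<in> topspace ?T. sorted_coords k n y \<in> model \<kappa> k n} = ?O"
  proof (intro equalityI subsetI)
    fix y assume y: "y \<in> {y \<in> topspace ?T. sorted_coords k n y \<in> model \<kappa> k n}"
    then obtain z where z: "z \<in> ?O" "sorted_coords k n z = sorted_coords k n y"
      using image by (metis (no_types, lifting) imageE mem_Collect_eq)
    have "inj_on y {..<k}"
      using z y by (intro sorted_coords_determines(1)[OF z(2), of \<kappa>]) auto
    then show "y \<in> ?O"
      using y by auto
  qed (use image in auto)
  have "compact_space ?T"
    by (simp add: compact_space_product_topology compact_space_star)
  then have "closed_map ?T euclidean (sorted_coords k n)"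
    by (intro T1_Spaces.continuous_imp_closed_map[OF continuous_map_sorted_coords]) auto
  then have "closed_map (subtopology ?T ?O) (subtopology euclidean (model \<kappa> k n)) (sorted_coords k n)"
    using saturated by (rule closed_map_restriction)
  moreover have "continuous_map (subtopology ?T ?O) (subtopology euclidean (model \<kappa> k n)) (sorted_coords k n)"
    using image continuous_map_from_subtopology[OF continuous_map_sorted_coords]
    by (auto simp: continuous_map_in_subtopology)
  moreover have "topspace ?T \<inter> ?O = ?O"
    by auto
  ultimately show ?thesis
    unfolding O using image by (intro continuous_closed_imp_quotient_map) auto
qed

text \<open>Both the configuration space and the model are quotients of the ordered configuration space
  with the same fibres.\<close>

lemma homeomorphic_model:
  assumes k: "1 \<le> k" and n: "1 \<le> n" and \<kappa>: "0 < \<kappa>"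
  obtains f g where "homeomorphic_maps (configuration_space (star_topology \<kappa> n) k) (top_of_set (model \<kappa> k n)) f g"
    "\<And>y. y \<in> {..<k} \<rightarrow>\<^sub>E star \<kappa> n \<Longrightarrow> inj_on y {..<k} \<Longrightarrow> f (y ` {..<k}) = sorted_coords k n y"
proof -
  let ?O = "ordered_configuration_space (star_topology \<kappa> n) k"
  let ?C = "configuration_space (star_topology \<kappa> n) k"
  let ?M = "top_of_set (model \<kappa> k n)"
  let ?q = "\<lambda>y :: nat \<Rightarrow> nat \<times> real. y ` {..<k}" and ?s = "sorted_coords k n"
  have q: "quotient_map ?O ?C ?q"
    unfolding configuration_space_def by (rule quotient_map_quotient_topology)
  have s: "quotient_map ?O ?M ?s"
    by (rule quotient_map_sorted_coords[OF k n \<kappa>])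
  have fib: "?q y = ?q z \<longleftrightarrow> ?s y = ?s z" if "y \<in> topspace ?O" "z \<in> topspace ?O" for y z
  proof -
    have yz: "y \<in> {..<k} \<rightarrow>\<^sub>E star \<kappa> n" "z \<in> {..<k} \<rightarrow>\<^sub>E star \<kappa> n" "inj_on y {..<k}" "inj_on z {..<k}"
      using that by (auto simp: topspace_ordered_configuration_space)
    show ?thesis
    proof
      assume "?q y = ?q z"
      then show "?s y = ?s z"
        by (rule sorted_coords_image[OF yz(3,4)])
    next
      assume eq: "?s y = ?s z"
      have "?q z = ?q y"
        using yz by (intro sorted_coords_determines(2)[OF eq, of \<kappa>]) auto
      then show "?q y = ?q z" ..
    qed
  qed
  obtain f where f: "continuous_map ?C ?M f" "f ` topspace ?C = ?s ` topspace ?O" "\<And>y. y \<in> topspace ?O \<Longrightarrow> f (?q y) = ?s y"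
    using quotient_map_lift_exists[OF q quotient_imp_continuous_map[OF s]] fib by metis
  obtain g where g: "continuous_map ?M ?C g" "g ` topspace ?M = ?q ` topspace ?O" "\<And>y. y \<in> topspace ?O \<Longrightarrow> g (?s y) = ?q y"
    using quotient_map_lift_exists[OF s quotient_imp_continuous_map[OF q]] fib by metis
  have "homeomorphic_maps ?C ?M f g"
    unfolding homeomorphic_maps_def
  proof (intro conjI ballI f(1) g(1))
    fix c assume "c \<in> topspace ?C"
    then obtain y where "y \<in> topspace ?O" "c = ?q y"
      using quotient_imp_surjective_map[OF q] by blast
    then show "g (f c) = c"
      using f(3) g(3) by simp
  next
    fix x assume "x \<in> topspace ?M"
    then obtain y where "y \<in> topspace ?O" "x = ?s y"
      using quotient_imp_surjective_map[OF s] by blast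
    then show "f (g x) = x"
      using f(3) g(3) by simp
  qed
  moreover have "f (?q y) = ?s y" if "y \<in> {..<k} \<rightarrow>\<^sub>E star \<kappa> n" "inj_on y {..<k}" for y
    using f(3)[of y] that by (simp add: topspace_ordered_configuration_space)
  ultimately show thesis
    using that by blast
qed

section \<open>Cells and walls of the model\<close>

definition types :: "nat \<Rightarrow> nat \<Rightarrow> (nat \<Rightarrow> nat) set" where
  "types n m = {v. (\<forall>i. i \<notin> {1..n} \<longrightarrow> v i = 0) \<and> (\<Sum>i=1..n. v i) = m}"

abbreviation bump :: "(nat \<Rightarrow> nat) \<Rightarrow> nat \<Rightarrow> nat \<Rightarrow> nat" where
  "bump v i \<equiv> v(i := Suc (v i))"

lemma card_types:
  assumes "1 \<le> n"
  shows "card (types n m) = (m + n - 1) choose (n - 1)"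
proof -
  let ?L = "{l :: nat list. size l = n \<and> sum_list l = m}"
  let ?f = "\<lambda>v :: nat \<Rightarrow> nat. map v [1..<Suc n]"
  have sum: "sum_list (?f v) = (\<Sum>i=1..n. v i)" for v
    by (simp add: interv_sum_list_conv_sum_set_nat atLeastLessThanSuc_atLeastAtMost del: upt_Suc)
  have "bij_betw ?f (types n m) ?L"
    unfolding bij_betw_def
  proof
    show "inj_on ?f (types n m)"
    proof (rule inj_onI, rule ext)
      fix v w i assume vw: "v \<in> types n m" "w \<in> types n m" "?f v = ?f w"
      show "v i = w i"
      proof (cases "i \<in> {1..n}")
        case True
        then have "i \<in> set [1..<Suc n]"
          by auto
        then show ?thesis
          using vw(3) by (simp only: map_eq_conv)
      qed (use vw in \<open>auto simp: types_def\<close>)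
    qed
    show "?f ` types n m = ?L"
    proof (intro equalityI subsetI)
      fix l assume "l \<in> ?f ` types n m"
      then show "l \<in> ?L"
        using sum by (auto simp: types_def simp del: upt_Suc)
    next
      fix l assume l: "l \<in> ?L"
      define v where "v i = (if i \<in> {1..n} then l ! (i - 1) else 0)" for i
      have fv: "?f v = l"
        by (rule nth_equalityI) (use l in \<open>auto simp: v_def simp del: upt_Suc\<close>)
      then have "v \<in> types n m"
        using sum[of v] l by (auto simp: types_def v_def)
      then show "l \<in> ?f ` types n m"
        using fv by (metis imageI)
    qed
  qed
  then have "card (types n m) = card ?L"
    by (rule bij_betw_same_card)
  also have "\<dots> = (m + n - 1) choose m"
    by (rule card_length_sum_list)
  also have "\<dots> = (m + n - 1) choose (n - 1)"
    using assms binomial_symmetric[of m "m + n - 1"] by simp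
  finally show ?thesis .
qed

lemma finite_types: "1 \<le> n \<Longrightarrow> finite (types n m)"
  by (rule card_ge_0_finite) (simp add: card_types)

lemma types_eqI:
  assumes "v \<in> types n m" "w \<in> types n m'" "m' \<le> m" and le: "\<And>i. i \<in> {1..n} \<Longrightarrow> v i \<le> w i"
  shows "w = v"
proof
  fix i
  have "(\<Sum>i=1..n. w i - v i) = (\<Sum>i=1..n. w i) - (\<Sum>i=1..n. v i)"
    using le by (rule sum_subtractf_nat)
  then have "(\<Sum>i=1..n. w i - v i) = 0"
    using assms by (simp add: types_def)
  then show "w i = v i"
    using assms le by (cases "i \<in> {1..n}") (auto simp: types_def intro: le_antisym)
qed

text \<open>The factor \<open>g\<close> is one for the number of points and \<open>j - 1\<close> for
  \<open>spread\<close>.\<close>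

lemma sum_bump:
  fixes v :: "nat \<Rightarrow> nat"
  assumes "i \<in> {1..n}"
  shows "(\<Sum>j=1..n. g j * bump v i j) = (\<Sum>j=1..n. g j * v j) + g i"
proof -
  have "(\<Sum>j=1..n. g j * bump v i j) = g i * Suc (v i) + (\<Sum>j\<in>{1..n} - {i}. g j * bump v i j)"
    using assms by (subst sum.remove[of _ i]) auto
  also have "(\<Sum>j\<in>{1..n} - {i}. g j * bump v i j) = (\<Sum>j\<in>{1..n} - {i}. g j * v j)"
    by (rule sum.cong) auto
  also have "g i * Suc (v i) + (\<Sum>j\<in>{1..n} - {i}. g j * v j) = (\<Sum>j=1..n. g j * v j) + g i"
    using assms by (subst (2) sum.remove[of _ i]) auto
  finally show ?thesis .
qed

lemma bump_types: "i \<in> {1..n} \<Longrightarrow> v \<in> types n m \<Longrightarrow> bump v i \<in> types n (Suc m)"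
  using sum_bump[of i n "\<lambda>_. 1" v] by (simp add: types_def)

lemma types_Suc_cases:
  assumes v: "v \<in> types n m" and w: "w \<in> types n (Suc m)" and le: "\<And>i. i \<in> {1..n} \<Longrightarrow> v i \<le> w i"
  obtains i where "i \<in> {1..n}" "w = bump v i"
proof -
  have "\<exists>i\<in>{1..n}. v i < w i"
  proof (rule ccontr)
    assume "\<not> (\<exists>i\<in>{1..n}. v i < w i)"
    then have "(\<Sum>i=1..n. w i) \<le> (\<Sum>i=1..n. v i)"
      by (intro sum_mono) (auto simp: not_less)
    then show False
      using v w by (simp add: types_def)
  qed
  then obtain i where i: "i \<in> {1..n}" "v i < w i"
    by blast
  have "w = bump v i"
    using i le by (intro types_eqI[OF bump_types[OF i(1) v] w]) auto
  then show thesis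
    using that i by blast
qed

definition cell :: "real \<Rightarrow> nat \<Rightarrow> nat \<Rightarrow> (nat \<Rightarrow> nat) \<Rightarrow> array set" where
  "cell \<kappa> k n a = {x \<in> model \<kappa> k n. array_type x = a}"

text \<open>The configurations in which one point is strictly closer to the centre than all others, and
  these others have type \<open>b\<close>.\<close>

definition wall_nbhd :: "real \<Rightarrow> nat \<Rightarrow> nat \<Rightarrow> (nat \<Rightarrow> nat) \<Rightarrow> array set" where
  "wall_nbhd \<kappa> k n b = {x \<in> model \<kappa> k n.
     \<forall>i\<in>{1..n}. \<forall>j<b i. \<forall>i'\<in>{1..n}. apply_bcontfun x (i', b i') < apply_bcontfun x (i, j)}"

text \<open>One of the two arrays may have its zeros where the other is still positive. A positive
  entry of the combination has a positive contribution from at least one array, which decreases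
  strictly there; the other decreases weakly.\<close>

lemma decreasing_array_convex:
  assumes x: "decreasing_array \<kappa> k n x" and z: "decreasing_array \<kappa> k n z" and u: "0 \<le> u" "u \<le> 1"
  shows "decreasing_array \<kappa> k n ((1 - u) *\<^sub>R x + u *\<^sub>R z)"
proof -
  let ?x = "apply_bcontfun x" and ?z = "apply_bcontfun z"
  have weak: "(0 < apply_bcontfun y (i, j') \<longrightarrow> apply_bcontfun y (i, j') < apply_bcontfun y (i, j)) \<and>
      apply_bcontfun y (i, j') \<le> apply_bcontfun y (i, j)"
    if "decreasing_array \<kappa> k n y" "j < j'" for y i j j'
    using decreasing_arrayD(1)[OF that(1), of "(i, j)"] decreasing_arrayD(4)[OF that, of i]
      decreasing_arrayD(1)[OF that(1), of "(i, j')"] by force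
  show ?thesis
    unfolding decreasing_array_def plus_bcontfun.rep_eq scaleR_bcontfun.rep_eq
  proof (intro conjI allI impI)
    fix p :: "nat \<times> nat"
    show "(1 - u) *\<^sub>R ?x p + u *\<^sub>R ?z p = 0" if "p \<notin> {1..n} \<times> {..<k}"
    proof -
      have "?x p = 0" "?z p = 0"
        using x z that unfolding decreasing_array_def by blast+
      then show ?thesis by simp
    qed
    show "0 \<le> (1 - u) *\<^sub>R ?x p + u *\<^sub>R ?z p"
      using decreasing_arrayD(1)[OF x] decreasing_arrayD(1)[OF z] u by simp
    show "(1 - u) *\<^sub>R ?x p + u *\<^sub>R ?z p \<le> \<kappa>"
      using convex_bound_le[OF decreasing_arrayD(2)[OF x] decreasing_arrayD(2)[OF z], of "1 - u" u p p] u by simp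
  next
    fix i j j' :: nat assume j: "j < j'" and pos: "0 < (1 - u) *\<^sub>R ?x (i, j') + u *\<^sub>R ?z (i, j')"
    note wx = weak[OF x j, of i] and wz = weak[OF z j, of i]
    have "0 < (1 - u) * ?x (i, j') \<or> 0 < u * ?z (i, j')"
      using pos by auto
    then have "(1 - u) * ?x (i, j') < (1 - u) * ?x (i, j) \<or> u * ?z (i, j') < u * ?z (i, j)"
      using wx wz u by (auto simp: zero_less_mult_iff)
    moreover have "(1 - u) * ?x (i, j') \<le> (1 - u) * ?x (i, j)" "u * ?z (i, j') \<le> u * ?z (i, j)"
      using wx wz u by (auto intro!: mult_left_mono)
    ultimately show "(1 - u) *\<^sub>R ?x (i, j') + u *\<^sub>R ?z (i, j') < (1 - u) *\<^sub>R ?x (i, j) + u *\<^sub>R ?z (i, j)"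
      by auto
  qed
qed

section \<open>The cover of the model by cells and wall neighbourhoods\<close>

locale star_model =
  fixes \<kappa> :: real and k n :: nat
  assumes k_pos: "1 \<le> k" and n_pos: "1 \<le> n" and \<kappa>_pos: "0 < \<kappa>"
begin

abbreviation "A \<equiv> types n k"
abbreviation "B \<equiv> types n (k - 1)"

lemma AB_disjoint: "A \<inter> B = {}"
  using k_pos by (auto simp: types_def)

lemma decreasing: "x \<in> model \<kappa> k n \<Longrightarrow> decreasing_array \<kappa> k n x"
  by (simp add: model_def)

lemma pos_iff: "x \<in> model \<kappa> k n \<Longrightarrow> 0 < apply_bcontfun x (i, j) \<longleftrightarrow> j < array_type x i"
  using positive_entries[OF decreasing, of x i] by auto

lemma nonneg: "x \<in> model \<kappa> k n \<Longrightarrow> 0 \<le> apply_bcontfun x p"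
  using decreasing_arrayD(1)[OF decreasing] .

lemma array_type_in: 
  assumes "x \<in> model \<kappa> k n"
  shows "array_type x \<in> A \<union> B"
proof -
  have "array_type x i = 0" if "i \<notin> {1..n}" for i
  proof -
    have "{j. 0 < apply_bcontfun x (i, j)} = {}"
      using decreasing_arrayD(3)[OF decreasing[OF assms]] that by blast
    then show ?thesis
      by (simp only: array_type_def card.empty)
  qed
  then show ?thesis
    using assms by (auto simp: types_def model_def)
qed

lemma modelI: "decreasing_array \<kappa> k n x \<Longrightarrow> array_type x \<in> A \<union> B \<Longrightarrow> x \<in> model \<kappa> k n"
  by (auto simp: model_def types_def)

lemma wall_subset: "x \<in> model \<kappa> k n \<Longrightarrow> array_type x = b \<Longrightarrow> x \<in> wall_nbhd \<kappa> k n b"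
proof -
  assume x: "x \<in> model \<kappa> k n" "array_type x = b"
  have "apply_bcontfun x (i', b i') \<le> 0" for i'
    using pos_iff[OF x(1), of i' "b i'"] x(2) by simp
  moreover have "0 < apply_bcontfun x (i, j)" if "j < b i" for i j
    using pos_iff[OF x(1), of i j] x(2) that by simp
  ultimately show ?thesis
    using x(1) by (auto simp: wall_nbhd_def intro: le_less_trans)
qed

lemma wall_nbhd_type_ge:
  assumes "x \<in> wall_nbhd \<kappa> k n b" "i \<in> {1..n}"
  shows "b i \<le> array_type x i"
proof (cases "b i")
  case (Suc j)
  have x: "x \<in> model \<kappa> k n"
    using assms by (simp add: wall_nbhd_def)
  have "apply_bcontfun x (i, b i) < apply_bcontfun x (i, j)"
  proof -
    have "j < b i"
      using Suc by simp
    then show ?thesis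
      using assms unfolding wall_nbhd_def by blast
  qed
  then have "0 < apply_bcontfun x (i, j)"
    using nonneg[OF x] by (rule le_less_trans[rotated])
  then show ?thesis
    using pos_iff[OF x] Suc by simp
qed simp

lemma wall_nbhd_cases:
  assumes x: "x \<in> wall_nbhd \<kappa> k n b" and b: "b \<in> B"
  obtains "array_type x = b" | i where "i \<in> {1..n}" "array_type x = bump b i"
proof -
  have "array_type x \<in> A \<union> B"
    using x array_type_in by (simp add: wall_nbhd_def)
  then show thesis
  proof
    assume "array_type x \<in> A"
    then have "array_type x \<in> types n (Suc (k - 1))"
      using k_pos by simp
    then show thesis
      using types_Suc_cases[OF b _ wall_nbhd_type_ge[OF x]] that(2) by blast
  next
    assume "array_type x \<in> B"
    then show thesis
      using types_eqI[OF b _ order_refl wall_nbhd_type_ge[OF x]] that(1) by blast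
  qed
qed

text \<open>Zeros of \<open>x\<close> are zeros of \<open>z\<close>, and positive entries of
  \<open>x\<close> stay positive before the end of the segment is reached. For equal types this
  gives the convexity of cells, for a smaller type of \<open>z\<close> the contraction towards a
  wall.\<close>

lemma array_type_convex:
  assumes x: "x \<in> model \<kappa> k n" and z: "z \<in> model \<kappa> k n" and le: "\<And>i. array_type z i \<le> array_type x i"
    and u: "0 \<le> u" "u < 1"
  shows "array_type ((1 - u) *\<^sub>R x + u *\<^sub>R z) = array_type x" "(1 - u) *\<^sub>R x + u *\<^sub>R z \<in> model \<kappa> k n"
proof -
  have "0 < (1 - u) * apply_bcontfun x (i, j) + u * apply_bcontfun z (i, j) \<longleftrightarrow> 0 < apply_bcontfun x (i, j)" for i j
  proof
    assume "0 < apply_bcontfun x (i, j)"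
    then show "0 < (1 - u) * apply_bcontfun x (i, j) + u * apply_bcontfun z (i, j)"
      using u nonneg[OF z, of "(i, j)"] by (intro add_pos_nonneg) auto
  next
    assume *: "0 < (1 - u) * apply_bcontfun x (i, j) + u * apply_bcontfun z (i, j)"
    show "0 < apply_bcontfun x (i, j)"
    proof (rule ccontr)
      assume "\<not> 0 < apply_bcontfun x (i, j)"
      then have "\<not> 0 < apply_bcontfun z (i, j)"
        using le[of i] by (simp add: pos_iff[OF x] pos_iff[OF z])
      then have "apply_bcontfun x (i, j) = 0" "apply_bcontfun z (i, j) = 0"
        using \<open>\<not> 0 < apply_bcontfun x (i, j)\<close> nonneg[OF x, of "(i, j)"] nonneg[OF z, of "(i, j)"] by auto
      then show False
        using * by simp
    qed
  qed
  then show type: "array_type ((1 - u) *\<^sub>R x + u *\<^sub>R z) = array_type x"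
    by (intro ext) (simp add: array_type_def)
  show "(1 - u) *\<^sub>R x + u *\<^sub>R z \<in> model \<kappa> k n"
    using decreasing_array_convex[OF decreasing[OF x] decreasing[OF z], of u] u array_type_in[OF x] type
    by (intro modelI) auto
qed

lemma wall_ineq_convex:
  assumes x: "x \<in> wall_nbhd \<kappa> k n b" and z: "z \<in> wall_nbhd \<kappa> k n b" and u: "0 \<le> u" "u \<le> 1"
    and "(1 - u) *\<^sub>R x + u *\<^sub>R z \<in> model \<kappa> k n"
  shows "(1 - u) *\<^sub>R x + u *\<^sub>R z \<in> wall_nbhd \<kappa> k n b"
proof -
  have "(1 - u) * p + u * q < (1 - u) * p' + u * q'" if "p < p'" "q < q'" for p p' q q' :: real
  proof (cases "u = 0")
    case False
    then show ?thesis
      using that u by (intro add_le_less_mono mult_left_mono mult_strict_left_mono) auto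
  qed (use that in simp)
  then show ?thesis
    using assms by (simp add: wall_nbhd_def)
qed

lemma convex_cell: "convex (cell \<kappa> k n a)"
  unfolding convex_alt
proof (intro ballI allI impI)
  fix x z and u :: real assume xz: "x \<in> cell \<kappa> k n a" "z \<in> cell \<kappa> k n a" and u: "0 \<le> u \<and> u \<le> 1"
  show "(1 - u) *\<^sub>R x + u *\<^sub>R z \<in> cell \<kappa> k n a"
  proof (cases "u = 1")
    case False
    then show ?thesis
      using xz u array_type_convex[of x z u] by (simp add: cell_def)
  qed (use xz in simp)
qed

lemma convex_cell_Int_wall: "convex (cell \<kappa> k n a \<inter> wall_nbhd \<kappa> k n b)"
  unfolding convex_alt
proof (intro ballI allI impI)
  fix x z and u :: real
  assume xz: "x \<in> cell \<kappa> k n a \<inter> wall_nbhd \<kappa> k n b" "z \<in> cell \<kappa> k n a \<inter> wall_nbhd \<kappa> k n b" and u: "0 \<le> u \<and> u \<le> 1"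
  have "(1 - u) *\<^sub>R x + u *\<^sub>R z \<in> cell \<kappa> k n a"
    using convex_cell xz u unfolding convex_alt by blast
  then show "(1 - u) *\<^sub>R x + u *\<^sub>R z \<in> cell \<kappa> k n a \<inter> wall_nbhd \<kappa> k n b"
    using xz u wall_ineq_convex[of x b z u] by (simp add: cell_def)
qed

text \<open>\<open>t = b\<close> gives a point of the wall itself, and \<open>t = bump b i\<close> one in an adjacent cell.\<close>

lemma model_point:
  assumes b: "b \<in> B" and t: "t = b \<or> (\<exists>i\<in>{1..n}. t = bump b i)"
  obtains x where "x \<in> model \<kappa> k n" "array_type x = t" "x \<in> wall_nbhd \<kappa> k n b"
proof -
  \<comment> \<open>Equal spacing: the optional innermost entry, at index \<open>b i\<close>, is
    \<kappa> / (k + 1), and all entries at smaller indices are at least twice that. The denominator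
    keeps everything below \<kappa>, since \<open>b i < k\<close>.\<close>
  define x where "x = array_of k n (\<lambda>(i, j). if j < t i then \<kappa> * (real (b i) + 1 - real j) / (real k + 1) else 0)"
  have b_le: "b i \<le> k - 1" for i
  proof (cases "i \<in> {1..n}")
    case True
    then have "b i \<le> (\<Sum>i=1..n. b i)"
      by (intro member_le_sum) auto
    then show ?thesis
      using b by (simp add: types_def)
  qed (use b in \<open>simp add: types_def\<close>)
  have t_bounds: "b i \<le> t i" "t i \<le> Suc (b i)" for i
    using t by auto
  have t_type: "t \<in> A \<union> B"
    using t b bump_types[of _ n b "k - 1"] k_pos by auto
  have t_out: "t i = 0" if "i \<notin> {1..n}" for i
    using t_type that by (auto simp: types_def)
  have t_k: "t i \<le> k" for i
    using t_bounds[of i] b_le[of i] k_pos by linarith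
  have xij: "apply_bcontfun x (i, j) = (if j < t i then \<kappa> * (real (b i) + 1 - real j) / (real k + 1) else 0)" for i j
    using t_out[of i] t_k[of i] by (auto simp: x_def apply_array_of)
  have pos: "\<kappa> / (real k + 1) \<le> \<kappa> * (real (b i) + 1 - real j) / (real k + 1)" if "j < t i" for i j
    using that t_bounds(2)[of i] \<kappa>_pos by (intro divide_right_mono) auto
  have pos': "0 < \<kappa> / (real k + 1)"
    using \<kappa>_pos by simp
  have pos_iff': "0 < apply_bcontfun x (i, j) \<longleftrightarrow> j < t i" for i j
    using pos[of j i] pos' by (auto simp: xij)
  have type: "array_type x = t"
    by (rule ext) (simp add: array_type_def pos_iff')
  have dec: "decreasing_array \<kappa> k n x"
    unfolding decreasing_array_def
  proof (intro conjI allI impI)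
    fix p
    show "apply_bcontfun x p = 0" if "p \<notin> {1..n} \<times> {..<k}"
      using that by (simp add: x_def apply_array_of)
    obtain i j where p: "p = (i, j)"
      by (cases p)
    show "0 \<le> apply_bcontfun x p"
      using pos[of j i] pos' by (auto simp: p xij)
    have "real (b i) + 1 - real j \<le> real k + 1"
      using b_le[of i] by linarith
    then have "\<kappa> * (real (b i) + 1 - real j) / (real k + 1) \<le> \<kappa> * (real k + 1) / (real k + 1)"
      using \<kappa>_pos by (intro divide_right_mono mult_left_mono) auto
    then show "apply_bcontfun x p \<le> \<kappa>"
      using \<kappa>_pos by (auto simp: p xij)
  next
    fix i j j' assume "j < j'" "0 < apply_bcontfun x (i, j')"
    then show "apply_bcontfun x (i, j') < apply_bcontfun x (i, j)"
      using \<kappa>_pos by (auto simp: pos_iff' xij intro!: divide_strict_right_mono)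
  qed
  have x: "x \<in> model \<kappa> k n"
    using dec t_type type by (intro modelI) auto
  have "apply_bcontfun x (i', b i') < apply_bcontfun x (i, j)" if "j < b i" for i j i'
  proof -
    have "apply_bcontfun x (i', b i') \<le> \<kappa> * 1 / (real k + 1)"
      using pos' by (auto simp: xij)
    also have "\<dots> < \<kappa> * (real (b i) + 1 - real j) / (real k + 1)"
      using that \<kappa>_pos by (intro divide_strict_right_mono mult_strict_left_mono) auto
    also have "\<dots> = apply_bcontfun x (i, j)"
      using that t_bounds(1)[of i] by (auto simp: xij)
    finally show ?thesis .
  qed
  then show thesis
    using that x type by (auto simp: wall_nbhd_def)
qed

text \<open>The star centre is a point of the wall itself, whose type is the least. For
  \<open>n\<close> at least two the set is not convex: the midpoint of arrays in two different
  adjacent cells has \<open>k + 1\<close> positive entries and leaves the model.\<close>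

lemma starlike_wall_nbhd:
  assumes b: "b \<in> B"
  shows "starlike (wall_nbhd \<kappa> k n b)"
proof -
  obtain z where z: "z \<in> model \<kappa> k n" "array_type z = b" "z \<in> wall_nbhd \<kappa> k n b"
    using model_point[OF b] by blast
  have seg: "closed_segment z x \<subseteq> wall_nbhd \<kappa> k n b" if x: "x \<in> wall_nbhd \<kappa> k n b" for x
  proof
    fix w assume "w \<in> closed_segment z x"
    then obtain u where u: "0 \<le> u" "u \<le> 1" "w = (1 - u) *\<^sub>R x + u *\<^sub>R z"
      unfolding closed_segment_commute[of z x] by (auto simp: in_segment)
    have le: "array_type z i \<le> array_type x i" for i
    proof (cases "i \<in> {1..n}")
      case True
      then show ?thesis
        using wall_nbhd_type_ge[OF x] z by simp
    qed (use b z in \<open>simp add: types_def\<close>)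
    have "w \<in> model \<kappa> k n"
    proof (cases "u = 1")
      case False
      then show ?thesis
        using array_type_convex(2)[OF _ z(1) le, of u] u x by (simp add: wall_nbhd_def)
    qed (use u z in simp)
    then show "w \<in> wall_nbhd \<kappa> k n b"
      using wall_ineq_convex[OF x z(3)] u by simp
  qed
  then show ?thesis
    using z(3) unfolding starlike_def by blast
qed

lemma open_less: "open {x :: array. apply_bcontfun x p < apply_bcontfun x q}" "open {x :: array. 0 < apply_bcontfun x q}"
  by (intro open_Collect_less continuous_on_apply_array continuous_on_const)+

text \<open>Positivity of the prescribed entries bounds the type only from below, but
  \<open>a\<close> already has the maximal total \<open>k\<close>, so the type must be
  \<open>a\<close>.\<close>

lemma openin_cell:
  assumes a: "a \<in> A"
  shows "openin (top_of_set (model \<kappa> k n)) (cell \<kappa> k n a)"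
proof -
  have "cell \<kappa> k n a = model \<kappa> k n \<inter> (\<Inter>i\<in>{1..n}. \<Inter>j\<in>{..<a i}. {x. 0 < apply_bcontfun x (i, j)})"
  proof (intro equalityI subsetI)
    fix x assume "x \<in> cell \<kappa> k n a"
    then show "x \<in> model \<kappa> k n \<inter> (\<Inter>i\<in>{1..n}. \<Inter>j\<in>{..<a i}. {x. 0 < apply_bcontfun x (i, j)})"
      by (auto simp: cell_def pos_iff)
  next
    fix x assume x: "x \<in> model \<kappa> k n \<inter> (\<Inter>i\<in>{1..n}. \<Inter>j\<in>{..<a i}. {x. 0 < apply_bcontfun x (i, j)})"
    have le: "a i \<le> array_type x i" if "i \<in> {1..n}" for i
    proof (cases "a i")
      case (Suc j)
      then have "0 < apply_bcontfun x (i, j)"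
        using x that by auto
      then show ?thesis
        using x Suc pos_iff[of x i j] by auto
    qed simp
    have "array_type x \<in> A \<union> B"
      using x array_type_in by blast
    then have "array_type x = a"
      using types_eqI[OF a _ _ le] by auto
    then show "x \<in> cell \<kappa> k n a"
      using x by (simp add: cell_def)
  qed
  moreover have "open (\<Inter>i\<in>{1..n}. \<Inter>j\<in>{..<a i}. {x :: array. 0 < apply_bcontfun x (i, j)})"
    by (intro open_INT finite_lessThan finite_atLeastAtMost ballI open_less)
  ultimately show ?thesis
    by (simp add: openin_open_Int)
qed

lemma openin_wall_nbhd: "openin (top_of_set (model \<kappa> k n)) (wall_nbhd \<kappa> k n b)"
proof -
  have "wall_nbhd \<kappa> k n b = model \<kappa> k n \<inter> (\<Inter>i\<in>{1..n}. \<Inter>j\<in>{..<b i}. \<Inter>i'\<in>{1..n}.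
      {x. apply_bcontfun x (i', b i') < apply_bcontfun x (i, j)})"
    by (auto simp: wall_nbhd_def)
  moreover have "open (\<Inter>i\<in>{1..n}. \<Inter>j\<in>{..<b i}. \<Inter>i'\<in>{1..n}.
      {x :: array. apply_bcontfun x (i', b i') < apply_bcontfun x (i, j)})"
    by (intro open_INT finite_lessThan finite_atLeastAtMost ballI open_less)
  ultimately show ?thesis
    by (simp add: openin_open_Int)
qed

text \<open>A common point has a type that exceeds both \<open>b\<close> and \<open>b'\<close> by
  one, on different edges. Each neighbourhood then declares a different point to be strictly
  innermost.\<close>

lemma wall_nbhds_disjoint:
  assumes b: "b \<in> B" and b': "b' \<in> B" and neq: "b \<noteq> b'"
  shows "wall_nbhd \<kappa> k n b \<inter> wall_nbhd \<kappa> k n b' = {}"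
proof (rule ccontr)
  assume "wall_nbhd \<kappa> k n b \<inter> wall_nbhd \<kappa> k n b' \<noteq> {}"
  then obtain x where x: "x \<in> wall_nbhd \<kappa> k n b" "x \<in> wall_nbhd \<kappa> k n b'"
    by blast
  have "bump v i \<notin> B" if "v \<in> B" "i \<in> {1..n}" for v i
    using bump_types[OF that(2,1)] k_pos AB_disjoint by auto
  then obtain i i' where i: "i \<in> {1..n}" "i' \<in> {1..n}" "bump b i = bump b' i'"
    using wall_nbhd_cases[OF x(1) b] wall_nbhd_cases[OF x(2) b'] b b' neq by metis
  have "i \<noteq> i'"
  proof
    assume "i = i'"
    then have "b j = b' j" for j
      using fun_cong[OF i(3), of j] by (cases "j = i") auto
    then show False
      using neq by blast
  qed
  then have bi: "b' i = Suc (b i)" "b i' = Suc (b' i')"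
    using fun_cong[OF i(3), of i] fun_cong[OF i(3), of i'] by auto
  have "apply_bcontfun x (i, b i) < apply_bcontfun x (i', b' i')"
    using x(1) i bi by (simp add: wall_nbhd_def)
  moreover have "apply_bcontfun x (i', b' i') < apply_bcontfun x (i, b i)"
    using x(2) i bi by (simp add: wall_nbhd_def)
  ultimately show False
    by simp
qed

definition piece :: "(nat \<Rightarrow> nat) \<Rightarrow> array set" where
  "piece v = (if v \<in> A then cell \<kappa> k n v else wall_nbhd \<kappa> k n v)"

lemma piece_A: "v \<in> A \<Longrightarrow> piece v = cell \<kappa> k n v" and piece_B: "v \<in> B \<Longrightarrow> piece v = wall_nbhd \<kappa> k n v"
  using AB_disjoint by (auto simp: piece_def)

lemma piece_meet_iff:
  assumes a: "a \<in> A" and b: "b \<in> B"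
  shows "piece a \<inter> piece b \<noteq> {} \<longleftrightarrow> (\<exists>i\<in>{1..n}. a = bump b i)"
proof
  assume "piece a \<inter> piece b \<noteq> {}"
  then obtain x where x: "x \<in> wall_nbhd \<kappa> k n b" "array_type x = a"
    using a b by (auto simp: piece_A piece_B cell_def)
  then show "\<exists>i\<in>{1..n}. a = bump b i"
    using wall_nbhd_cases[OF x(1) b] a b AB_disjoint by blast
next
  assume "\<exists>i\<in>{1..n}. a = bump b i"
  then show "piece a \<inter> piece b \<noteq> {}"
    using model_point[OF b, of a] a b by (auto simp: piece_A piece_B cell_def)
qed

sublocale two_family_cover "model \<kappa> k n" A B piece
proof
  show "A \<inter> B = {}"
    by (rule AB_disjoint)
  show "openin (top_of_set (model \<kappa> k n)) (piece v)" for v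
    using openin_cell openin_wall_nbhd by (simp add: piece_def)
  show "simply_connected (piece v)" if "v \<in> A \<union> B" for v
    using that convex_imp_simply_connected[OF convex_cell] starlike_imp_simply_connected[OF starlike_wall_nbhd]
    by (auto simp: piece_def)
  show "piece a \<inter> piece a' = {}" if "a \<in> A" "a' \<in> A" "a \<noteq> a'" for a a'
    using that by (auto simp: piece_A cell_def)
  show "piece b \<inter> piece b' = {}" if "b \<in> B" "b' \<in> B" "b \<noteq> b'" for b b'
    using wall_nbhds_disjoint[OF that] that by (simp add: piece_B)
  show "path_connected (piece a \<inter> piece b)" if "a \<in> A" "b \<in> B" for a b
    using convex_imp_path_connected[OF convex_cell_Int_wall] that by (simp add: piece_A piece_B)
  show "model \<kappa> k n \<subseteq> (\<Union>v\<in>A \<union> B. piece v)"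
  proof
    fix x assume x: "x \<in> model \<kappa> k n"
    have "x \<in> piece (array_type x)"
      using x wall_subset by (simp add: piece_def cell_def)
    then show "x \<in> (\<Union>v\<in>A \<union> B. piece v)"
      using array_type_in[OF x] by blast
  qed
qed

section \<open>The spanning tree and the count of edges\<close>

definition base_type :: "nat \<Rightarrow> nat" where
  "base_type i = (if i = 1 then k - 1 else 0)"

text \<open>The spanning tree: the parent of a cell is obtained by retracting a point from the last
  nonempty edge into the centre, the parent of a wall by moving its central point into edge \<open>1\<close>.\<close>

definition last_edge :: "(nat \<Rightarrow> nat) \<Rightarrow> nat" where
  "last_edge v = Max {i \<in> {1..n}. v i \<noteq> 0}"

definition parent :: "(nat \<Rightarrow> nat) \<Rightarrow> nat \<Rightarrow> nat" where
  "parent v = (if v \<in> A then v(last_edge v := v (last_edge v) - 1) else bump v 1)"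

text \<open>The total number of edges separating the points from edge \<open>1\<close> in the
  numbering: unchanged when edge \<open>1\<close> gains a point, smaller when another edge loses
  one.\<close>

definition spread :: "(nat \<Rightarrow> nat) \<Rightarrow> nat" where
  "spread v = (\<Sum>i=1..n. (i - 1) * v i)"

text \<open>A wall other than the root and its parent cell have the same spread, so the offsets
  \<open>2\<close> and \<open>1\<close> decide. A cell with a point outside edge \<open>1\<close>
  has a parent of smaller spread. The remaining cell has all points on edge \<open>1\<close>; its
  spread does not drop, but its parent is the root, of rank zero.\<close>

definition tree_rank :: "(nat \<Rightarrow> nat) \<Rightarrow> nat" where
  "tree_rank v = (if v \<in> A then 2 * spread v + 1 else if v = base_type then 0 else 2 * spread v + 2)"

lemma base_type_B: "base_type \<in> B"
  using n_pos by (auto simp: types_def base_type_def sum.delta)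

lemma last_edge:
  assumes "v \<in> A"
  shows "last_edge v \<in> {1..n}" "v (last_edge v) \<noteq> 0" "\<And>i. last_edge v < i \<Longrightarrow> v i = 0"
proof -
  let ?S = "{i \<in> {1..n}. v i \<noteq> 0}"
  have "(\<Sum>i=1..n. v i) \<noteq> 0"
    using assms k_pos by (simp add: types_def)
  then have S: "?S \<noteq> {}" "finite ?S"
    by auto
  then have "last_edge v \<in> ?S"
    unfolding last_edge_def by (intro Max_in)
  then show "last_edge v \<in> {1..n}" "v (last_edge v) \<noteq> 0"
    by auto
  fix i assume i: "last_edge v < i"
  show "v i = 0"
  proof (rule ccontr)
    assume "v i \<noteq> 0"
    moreover have "i \<in> {1..n}"
      using assms \<open>v i \<noteq> 0\<close> by (auto simp: types_def)
    ultimately have "i \<le> last_edge v"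
      unfolding last_edge_def using S by (intro Max_ge) auto
    then show False
      using i by simp
  qed
qed

lemma bump_parent: "v \<in> A \<Longrightarrow> bump (parent v) (last_edge v) = v"
  using last_edge(2)[of v] by (auto simp: parent_def)

lemma parent_A:
  assumes v: "v \<in> A"
  shows "parent v \<in> B"
proof -
  have "(\<Sum>i=1..n. parent v i) + 1 = k"
    using sum_bump[OF last_edge(1)[OF v], of "\<lambda>_. 1" "parent v"] bump_parent[OF v] v by (simp add: types_def)
  moreover have "parent v i = 0" if "i \<notin> {1..n}" for i
    using v that by (auto simp: types_def parent_def)
  ultimately show ?thesis
    by (auto simp: types_def)
qed

lemma parent_B: "v \<in> B \<Longrightarrow> parent v = bump v 1" "v \<in> B \<Longrightarrow> bump v 1 \<in> A"
  using AB_disjoint bump_types[of 1 n v "k - 1"] n_pos k_pos by (auto simp: parent_def)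

lemma spread_bump: "i \<in> {1..n} \<Longrightarrow> spread (bump v i) = spread v + (i - 1)"
  unfolding spread_def by (rule sum_bump)

lemma rank_parent_A:
  assumes v: "v \<in> A"
  shows "tree_rank (parent v) < tree_rank v"
proof (cases "parent v = base_type")
  case True
  then show ?thesis
    using v base_type_B AB_disjoint by (auto simp: tree_rank_def)
next
  case False
  have "last_edge v \<noteq> 1"
  proof
    assume "last_edge v = 1"
    then have "v i = 0" if "i \<noteq> 1" for i
      using that last_edge(3)[OF v, of i] v by (cases "i = 0") (auto simp: types_def)
    then have "parent v i = 0" if "i \<noteq> 1" for i
      using that v by (simp add: parent_def)
    then have "(\<Sum>i=1..n. parent v i) = (\<Sum>i=1..n. if i = 1 then parent v 1 else 0)"
      by (intro sum.cong) auto
    then have "parent v 1 = k - 1"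
      using parent_A[OF v] n_pos by (simp add: types_def)
    then have "parent v = base_type"
      using \<open>\<And>i. i \<noteq> 1 \<Longrightarrow> parent v i = 0\<close> by (auto simp: base_type_def)
    then show False
      using False by simp
  qed
  then have "1 < last_edge v"
    using last_edge(1)[OF v] by simp
  then have "spread (parent v) < spread v"
    using spread_bump[OF last_edge(1)[OF v], of "parent v"] bump_parent[OF v] by simp
  then show ?thesis
    using v parent_A[OF v] False AB_disjoint by (auto simp: tree_rank_def)
qed

lemma rank_parent_B:
  assumes v: "v \<in> B" "v \<noteq> base_type"
  shows "tree_rank (parent v) < tree_rank v"
  using v parent_B[OF v(1)] spread_bump[of 1 v] n_pos AB_disjoint by (auto simp: tree_rank_def)

lemma rooted:
  assumes "c \<in> wall_nbhd \<kappa> k n base_type"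
  shows "rooted_cover (model \<kappa> k n) A B piece base_type c parent tree_rank"
proof (intro rooted_cover.intro two_family_cover_axioms rooted_cover_axioms.intro)
  show "base_type \<in> B"
    by (rule base_type_B)
  show "c \<in> piece base_type"
    using assms by (simp only: piece_B[OF base_type_B])
  show "parent v \<in> A \<union> B" if "v \<in> A \<union> B" for v
    using that parent_A parent_B by auto
  show "tree_rank (parent v) < tree_rank v" if "v \<in> A \<union> B" "v \<noteq> base_type" for v
    using that rank_parent_A rank_parent_B by blast
  show "piece v \<inter> piece (parent v) \<noteq> {}" if "v \<in> A \<union> B" for v
    using that
  proof
    assume v: "v \<in> A"
    have "\<exists>i\<in>{1..n}. v = bump (parent v) i"
      using last_edge(1)[OF v] bump_parent[OF v] by metis
    then show ?thesis
      using piece_meet_iff[OF v parent_A[OF v]] by blast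
  next
    assume v: "v \<in> B"
    have "\<exists>i\<in>{1..n}. bump v 1 = bump v i"
      using n_pos by (intro bexI[of _ 1]) auto
    then show ?thesis
      using piece_meet_iff[OF parent_B(2)[OF v] v] parent_B(1)[OF v] by (simp add: Int_commute)
  qed
qed

lemma card_edges: "card {(a, b) \<in> A \<times> B. piece a \<inter> piece b \<noteq> {}} = n * card B"
proof -
  have "{(a, b) \<in> A \<times> B. piece a \<inter> piece b \<noteq> {}} = (\<lambda>(b, i). (bump b i, b)) ` (B \<times> {1..n})"
  proof (intro equalityI subsetI)
    fix e assume "e \<in> {(a, b) \<in> A \<times> B. piece a \<inter> piece b \<noteq> {}}"
    then obtain a b where e: "e = (a, b)" "a \<in> A" "b \<in> B" "piece a \<inter> piece b \<noteq> {}"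
      by auto
    then obtain i where "i \<in> {1..n}" "a = bump b i"
      using piece_meet_iff by blast
    then show "e \<in> (\<lambda>(b, i). (bump b i, b)) ` (B \<times> {1..n})"
      using e by (intro image_eqI[of _ _ "(b, i)"]) auto
  next
    fix e assume "e \<in> (\<lambda>(b, i). (bump b i, b)) ` (B \<times> {1..n})"
    then obtain b i where e: "e = (bump b i, b)" "b \<in> B" "i \<in> {1..n}"
      by auto
    have "bump b i \<in> A"
      using bump_types[OF e(3,2)] k_pos by simp
    then show "e \<in> {(a, b) \<in> A \<times> B. piece a \<inter> piece b \<noteq> {}}"
      using piece_meet_iff[of "bump b i" b] e by auto
  qed
  moreover have "inj_on (\<lambda>(b, i). (bump b i, b)) (B \<times> {1..n})"
  proof (rule inj_onI)
    fix p q assume pq: "(\<lambda>(b, i). (bump b i, b)) p = (\<lambda>(b, i). (bump b i, b)) q"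
    obtain b i j where bij: "p = (b, i)" "q = (b, j)" "bump b i = bump b j"
      using pq by (cases p; cases q) auto
    have "i = j"
      using fun_cong[OF bij(3), of i] by (cases "i = j") simp_all
    then show "p = q"
      using bij by simp
  qed
  ultimately show ?thesis
    by (simp add: card_image card_cartesian_product mult.commute)
qed

text \<open>The point at distance zero is the centre and the other \<open>k - 1\<close> points are
  on edge \<open>1\<close>; this is why \<open>base_type\<close> was chosen as the root.\<close>

lemma base_configuration_wall:
  assumes "real k - 1 \<le> \<kappa>"
  obtains y where "y \<in> {..<k} \<rightarrow>\<^sub>E star \<kappa> n" "inj_on y {..<k}" "y ` {..<k} = base_configuration k"
    "sorted_coords k n y \<in> wall_nbhd \<kappa> k n base_type"
proof -
  define y where "y = restrict (\<lambda>l. edge_point 1 (real l)) {..<k}"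
  have star: "edge_point 1 (real l) \<in> star \<kappa> n" if "l < k" for l
  proof -
    have "real l \<le> \<kappa>"
      using that assms by linarith
    then show ?thesis
      unfolding star_def using n_pos by (intro CollectI exI[of _ 1] exI[of _ "real l"]) simp
  qed
  then have y: "y \<in> {..<k} \<rightarrow>\<^sub>E star \<kappa> n"
    by (simp add: y_def)
  have inj: "inj_on y {..<k}"
    by (auto simp: inj_on_def y_def edge_point_def split: if_splits)
  have model: "sorted_coords k n y \<in> model \<kappa> k n"
    using \<kappa>_pos star inj by (intro sorted_coords_in_model) (simp_all add: y_def)
  have "array_type (sorted_coords k n y) = base_type"
  proof
    fix i
    show "array_type (sorted_coords k n y) i = base_type i"
    proof (cases "i \<in> {1..n}")
      case True
      have "{l. l < k \<and> 0 < edge_coord i (y l)} = (if i = 1 then {1..<k} else {})"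
        using True by (auto simp: y_def edge_coord_def edge_point_def)
      then show ?thesis
        using array_type_sorted_coords[OF True, of k y] by (simp add: base_type_def)
    next
      case False
      then show ?thesis
        using array_type_in[OF model] base_type_B by (auto simp: types_def)
    qed
  qed
  then have "sorted_coords k n y \<in> wall_nbhd \<kappa> k n base_type"
    using model wall_subset by blast
  moreover have "y ` {..<k} = base_configuration k"
    by (simp add: y_def base_configuration_def)
  ultimately show thesis
    using that y inj by blast
qed

end

theorem corollary3:
  fixes n k :: nat and \<kappa> :: real
  assumes "2 \<le> n" and "1 \<le> k" and "0 < \<kappa>" and "real k - 1 \<le> \<kappa>"
  shows "\<exists>r. int r = \<phi> k n \<and>
    free_on_generators (star_braid_group \<kappa> n k (base_configuration k)) r"
proof -
  interpret star_model \<kappa> k n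
    using assms by unfold_locales auto
  obtain f g where fg: "homeomorphic_maps (configuration_space (star_topology \<kappa> n) k) (top_of_set (model \<kappa> k n)) f g"
    and f: "\<And>y. y \<in> {..<k} \<rightarrow>\<^sub>E star \<kappa> n \<Longrightarrow> inj_on y {..<k} \<Longrightarrow> f (y ` {..<k}) = sorted_coords k n y"
    using homeomorphic_model[OF assms(2) n_pos assms(3)] by blast
  obtain y where y: "y \<in> {..<k} \<rightarrow>\<^sub>E star \<kappa> n" "inj_on y {..<k}" "y ` {..<k} = base_configuration k"
    "sorted_coords k n y \<in> wall_nbhd \<kappa> k n base_type"
    using base_configuration_wall[OF assms(4)] by blast
  interpret R: rooted_cover "model \<kappa> k n" A B piece base_type "sorted_coords k n y" parent tree_rank
    by (rule rooted[OF y(4)])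
  have fin: "finite A" "finite B"
    using finite_types n_pos by auto
  have base: "base_configuration k \<in> topspace (configuration_space (star_topology \<kappa> n) k)"
    by (rule base_configuration_in_configuration_space[OF n_pos assms(3,4)])
  have "f (base_configuration k) = sorted_coords k n y"
    using f[OF y(1,2)] y(3) by simp
  then have "free_on_generators (star_braid_group \<kappa> n k (base_configuration k)) (card R.generator_edges)"
    unfolding star_braid_group_def by (rule R.fundamental_group_free[OF fin fg base])
  moreover have "int (card R.generator_edges) = \<phi> k n"
  proof -
    have "card R.generator_edges + card A + card B = n * card B + 1"
      using R.card_generator_edges(2)[OF fin] unfolding card_edges .
    \<comment> \<open>The count is moved to the integers before it is solved for the number of
      generators, since \<phi> involves a genuine subtraction.\<close>
    then have "int (card R.generator_edges) + int (card A) + int (card B) = int n * int (card B) + 1"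
      by (metis of_nat_1 of_nat_add of_nat_mult)
    moreover have "card A = (n + k - 1) choose (n - 1)"
      using card_types[OF n_pos, of k] by (simp add: add.commute)
    moreover have "k - 1 + n - 1 = n + k - 2"
      using assms(1,2) by simp
    then have "card B = (n + k - 2) choose (n - 1)"
      using card_types[OF n_pos, of "k - 1"] by simp
    ultimately show ?thesis
      unfolding \<phi>_def by (simp add: algebra_simps)
  qed
  ultimately show ?thesis
    by blast
qed

end
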